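(* For every complete $k$-partite quiver $\mathcal{G}$ on nodes $I$, every family of finite-dimensional complex vector spaces $\{V_i\}_{i\in I}$ and every reading $a$, the universal simply-laced quantum connection $\widehat{\nabla} = d - \sum_{i \in I} \widehat{H}_i\,dt_i$ on the trivial bundle $\widehat{A}\times\mathbf{B}\to\mathbf{B}$ is strongly flat, i.e. $$\bigl[\widehat{H}_i,\widehat{H}_j\bigr] = 0 = \frac{\partial \widehat{H}_i}{\partial t_j} - \frac{\partial \widehat{H}_j}{\partial t_i} \qquad \text{for all } i,j \in I.$$
   Context: Everything is over $\mathbb{C}$. Graph data. Let $J$ be a finite set with $|J|=k\ge 2$, $I$ a finite set, $\pi\colon I\to J$ a surjection with parts $I^j=\pi^{-1}(j)$; for $i\in I$ write $I_i$ for the part containing $i$. The complete $k$-partite quiver $\mathcal{G}$ has node set $I$, with exactly one arrow in each direction between two nodes lying in different parts, and no other arrows. Let $V_i$ ($i\in I$) be finite-dimensional vector spaces, $W^j=\bigoplus_{i\in I^j}V_i$, $V=\bigoplus_{i\in I} V_i$. A reading is an injection $a\colon J\to\mathbb{C}\cup\{\infty\}$; write $a_i=a_{\pi(i)}$ for $i\in I$. It is degenerate if $\infty\in a(J)$; then $I^\infty\subseteq I$ denotes the part sent to $\infty$ (put $I^\infty=\emptyset$ otherwise). For $i,j\in I$ in different parts put $\phi_{ij}=(a_i-a_j)^{-1}$ if $a_i,a_j\neq\infty$, $\phi_{ij}=1$ if $a_i=\infty$, $\phi_{ij}=-1$ if $a_j=\infty$. Phase space and times. $\mathbb{M}=\bigoplus_{i\neq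 j\in J}\mathrm{Hom}(W^i,W^j)$ is the space of representations of $\mathcal{G}$; a point has components $B_{ij}\in\mathrm{Hom}(V_j,V_i)$ for $i,j\in I$ in different parts. It carries the symplectic form $\omega_a=\frac12\sum\mathrm{Tr}(dX_{ij}\wedge dB_{ji})$, where $X_{ij}=\phi_{ij}B_{ij}$ and the sum is over ordered pairs of nodes in different parts. In bases of the $V_i$, the associated Poisson bracket is $\{(B_{ij})_{pq},(B_{ji})_{rs}\}=\phi_{ij}^{-1}\delta_{ps}\delta_{qr}$, all other brackets of coordinates being zero. The space of times is $\mathbf{B}=\prod_{j\in J}\bigl(\mathbb{C}^{I^j}\setminus\{\text{diagonals}\}\bigr)\subseteq\mathbb{C}^I$, with coordinates $(t_i)_{i\in I}$ (so $t_i\ne t_m$ for distinct $i,m$ in the same part). Quantum algebras. $A$ is the Weyl algebra: the quotient of the tensor algebra of $\mathbb{M}^*$ by the two-sided ideal generated by $f\otimes g-g\otimes f-\{f,g\}$, $f,g\in\mathbb{M}^*$, with the filtration $A_{\le k}$ induced by tensor degree. Write $\widehat f\in A$ for the image of $f\in\mathbb{M}^*$. For $f\in A$ let $|f|=\min\{k : f\in A_{\le k}\}$. With $\hslash$ a formal variable, $\mathrm{Rees}(A)=\bigoplus_{k\ge0}A_{\le k}\hslash^k\subseteq A[\hslash]$ and $\widehat{A}=\{\sum_k f_k\hslash^k : f_k\in A_{\le k},\ \lim_{k\to\infty}(k-|f_k|)=+\infty\}\subseteq A[[\hslash]]$. Let $\widehat B_{ij}$ be the matrix whose entries are the elements $\widehat{(B_{ij})_{pq}}\in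 A$; traces of products are $\mathrm{Tr}(\widehat B_{1}\cdots\widehat B_{n})=\sum_{k_1,\dots,k_n}(\widehat B_1)_{k_nk_{n-1}}\cdots(\widehat B_n)_{k_1k_n}$, with the factors in the written order. Hamiltonians. The classical simply-laced isomonodromy Hamiltonians are, for $i\in I$, $$H_i=\sum_{m\in I_i\setminus\{i\}}\ \sum_{j,l\in I\setminus I_i}\frac{\phi_{ij}\phi_{il}}{t_i-t_m}\mathrm{Tr}(B_{ij}B_{jm}B_{ml}B_{li})-\sum_{j,l\in I\setminus I_i,\ I_j\ne I_l}\phi_{il}\phi_{ji}\mathrm{Tr}(B_{il}B_{lj}B_{ji})+\sum_{j\in I\setminus I_i}c_{ij}\mathrm{Tr}(B_{ij}B_{ji}),$$ where $c_{ij}=(t_j-t_i)\phi_{ij}^2$ if $i,j\notin I^\infty$; $c_{ij}=t_j$ if $i\notin I^\infty,\ j\in I^\infty$; $c_{ij}=t_j+a_jt_i$ if $i\in I^\infty$. They are quantised by the following rule: 3-cycles, and 4-cycles through four distinct nodes, are quantised by the trace of the product of the matrices $\widehat B$ in any cyclic order (all give the same element of $A$); degenerate 4-cycles ($j=l$) are quantised with the trace starting and ending at the centre $j$ (the first arrow, i.e. the rightmost matrix, leaves $j$); 2-cycles by the average of the two possible orders; and a cycle of length $n$ is multiplied by $\hslash^n$. Explicitly, the universal simply-laced quantum Hamiltonians $\widehat H_i\colon\mathbf{B}\to\mathrm{Rees}(A)\subseteq\widehat A$ are $$\widehat H_i=\sum_{m\in I_i\setminus\{i\}}\Bigl(\sum_{j\ne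 l\in I\setminus I_i}\frac{\phi_{ij}\phi_{il}}{t_i-t_m}\mathrm{Tr}(\widehat B_{ij}\widehat B_{jm}\widehat B_{ml}\widehat B_{li})+\sum_{j\in I\setminus I_i}\frac{\phi_{ij}^2}{t_i-t_m}\mathrm{Tr}(\widehat B_{jm}\widehat B_{mj}\widehat B_{ji}\widehat B_{ij})\Bigr)\hslash^4$$ $$\qquad-\sum_{j,l\in I\setminus I_i,\ I_j\neq I_l}\phi_{il}\phi_{ji}\mathrm{Tr}(\widehat B_{il}\widehat B_{lj}\widehat B_{ji})\,\hslash^3+\sum_{j\in I\setminus I_i}\frac{c_{ij}}{2}\bigl(\mathrm{Tr}(\widehat B_{ij}\widehat B_{ji})+\mathrm{Tr}(\widehat B_{ji}\widehat B_{ij})\bigr)\hslash^2.$$ The algebra $\widehat A$ acts on itself by left multiplication.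
   Formalization: For i in I^∞ the coefficient is c_ij = t_j − a_j t_i instead of the printed t_j + a_j t_i; with the printed sign, three one-dimensional nodes in three parts with readings ∞, a_1, a_2 give a commutator with leading part 2t_0(u−v) ≠ 0. *)

theory Defs
  imports Complex_Main "HOL-Library.Poly_Mapping" "HOL-Library.Cardinality"
    "HOL-Algebra.QuotRing"
begin

section \<open>Noncommutative monomials and formal power series over a ring\<close>

text \<open>
  \<open>'x ncmonom \<Rightarrow>\<^sub>0 complex\<close>, with the convolution product of \<open>Poly_Mapping\<close>, is the free associative
  algebra on \<open>'x\<close>, that is, the tensor algebra of the vector space with basis \<open>'x\<close>; the length of
  a word is its tensor degree.
\<close>

datatype 'x ncmonom = Letters (letters: "'x list")

instantiation ncmonom :: (type) monoid_add
begin

definition zero_ncmonom :: "'a ncmonom" where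
  "0 = Letters []"

definition plus_ncmonom :: "'a ncmonom \<Rightarrow> 'a ncmonom \<Rightarrow> 'a ncmonom" where
  "u + v = Letters (letters u @ letters v)"

instance
  by standard (simp_all add: zero_ncmonom_def plus_ncmonom_def)

end

type_synonym 'x tens = "'x ncmonom \<Rightarrow>\<^sub>0 complex"

definition scalar :: "complex \<Rightarrow> 'x tens" where
  "scalar c = Poly_Mapping.single 0 c"

definition letter :: "'x \<Rightarrow> 'x tens" where
  "letter x = Poly_Mapping.single (Letters [x]) 1"

definition power_series :: "('a, 'm) ring_scheme \<Rightarrow> (nat \<Rightarrow> 'a) ring" where
  "power_series R =
    \<lparr>carrier = {f. \<forall>n. f n \<in> carrier R},
     mult = (\<lambda>f g n. \<Oplus>\<^bsub>R\<^esub>k\<in>{..n}. f k \<otimes>\<^bsub>R\<^esub> g (n - k)),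
     one = (\<lambda>n. if n = 0 then \<one>\<^bsub>R\<^esub> else \<zero>\<^bsub>R\<^esub>),
     zero = (\<lambda>n. \<zero>\<^bsub>R\<^esub>),
     add = (\<lambda>f g n. f n \<oplus>\<^bsub>R\<^esub> g n)\<rparr>"

definition commutator :: "('a, 'm) ring_scheme \<Rightarrow> 'a \<Rightarrow> 'a \<Rightarrow> 'a" where
  "commutator R x y = (x \<otimes>\<^bsub>R\<^esub> y) \<ominus>\<^bsub>R\<^esub> (y \<otimes>\<^bsub>R\<^esub> x)"


section \<open>The quantum algebras and the quantum Hamiltonians\<close>

text \<open>\<open>Coord i p j q\<close> stands for the matrix entry \<open>(B\<^bsub>ij\<^esub>)\<^bsub>pq\<^esub>\<close>.\<close>

datatype 'i coord = Coord 'i nat 'i nat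

type_synonym 'i weyl_elt = "'i coord tens set"
type_synonym 'i weyl_series = "nat \<Rightarrow> 'i weyl_elt"

text \<open>
  The sets \<open>I\<close> and \<open>J\<close> are the finite types \<open>'i\<close> and \<open>'j\<close>. Bases are chosen, so \<open>V\<^bsub>i\<^esub>\<close> has dimension
  \<open>d i\<close> (possibly 0) and basis indices \<open>p < d i\<close>. In a reading, \<open>None\<close> stands for \<open>\<infinity>\<close>.
\<close>

locale simply_laced =
  fixes \<pi> :: "'i::finite \<Rightarrow> 'j::finite"
    and d :: "'i \<Rightarrow> nat"
    and a :: "'j \<Rightarrow> complex option"
begin

definition others :: "'i \<Rightarrow> 'i set" where
  "others i = {j. \<pi> j \<noteq> \<pi> i}"

definition siblings :: "'i \<Rightarrow> 'i set" where
  "siblings i = {m. \<pi> m = \<pi> i \<and> m \<noteq> i}"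

text \<open>Only used for nodes in different parts, so at most one of the two readings is \<open>None\<close>.\<close>

definition \<phi> :: "'i \<Rightarrow> 'i \<Rightarrow> complex" where
  "\<phi> i j = (case a (\<pi> i) of
      None \<Rightarrow> 1
    | Some x \<Rightarrow> (case a (\<pi> j) of None \<Rightarrow> - 1 | Some y \<Rightarrow> inverse (x - y)))"

definition coords :: "'i coord set" where
  "coords = {Coord i p j q | i p j q. \<pi> i \<noteq> \<pi> j \<and> p < d i \<and> q < d j}"

fun coord_bracket :: "'i coord \<Rightarrow> 'i coord \<Rightarrow> complex" where
  "coord_bracket (Coord i p j q) (Coord k r l s) =
    (if k = j \<and> l = i \<and> p = s \<and> q = r then inverse (\<phi> i j) else 0)"

text \<open>
  A function \<open>f :: 'i coord \<Rightarrow> complex\<close> gives the linear form \<open>\<Sum>x\<in>coords. f x \<cdot> x\<close>, an element of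
  the dual of the space of representations; \<open>lin f\<close> is that form as a tensor of degree 1.
\<close>

definition lin :: "('i coord \<Rightarrow> complex) \<Rightarrow> 'i coord tens" where
  "lin f = (\<Sum>x\<in>coords. scalar (f x) * letter x)"

definition poisson :: "('i coord \<Rightarrow> complex) \<Rightarrow> ('i coord \<Rightarrow> complex) \<Rightarrow> complex" where
  "poisson f g = (\<Sum>x\<in>coords. \<Sum>y\<in>coords. f x * g y * coord_bracket x y)"

definition tensor_alg :: "'i coord tens ring" where
  "tensor_alg =
    \<lparr>carrier = {x. \<forall>w\<in>Poly_Mapping.keys x. set (letters w) \<subseteq> coords},
     mult = (*), one = 1, zero = 0, add = (+)\<rparr>"

definition weyl_ideal :: "'i coord tens set" where
  "weyl_ideal = Idl\<^bsub>tensor_alg\<^esub> {lin f * lin g - lin g * lin f - scalar (poisson f g) | f g. True}"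

definition weyl :: "'i weyl_elt ring" where
  "weyl = tensor_alg Quot weyl_ideal"

definition weyl_class :: "'i coord tens \<Rightarrow> 'i weyl_elt" where
  "weyl_class x = weyl_ideal +>\<^bsub>tensor_alg\<^esub> x"

definition weyl_scale :: "complex \<Rightarrow> 'i weyl_elt \<Rightarrow> 'i weyl_elt" (infixr \<open>\<cdot>\<close> 75) where
  "c \<cdot> X = weyl_class (scalar c) \<otimes>\<^bsub>weyl\<^esub> X"

definition weyl_le :: "nat \<Rightarrow> 'i weyl_elt set" where
  "weyl_le k = weyl_class `
    {x \<in> carrier tensor_alg. \<forall>w\<in>Poly_Mapping.keys x. length (letters w) \<le> k}"

definition weyl_ord :: "'i weyl_elt \<Rightarrow> nat" where
  "weyl_ord X = (LEAST k. X \<in> weyl_le k)"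

text \<open>The coefficient of \<open>\<hbar>\<^sup>k\<close> in \<open>f\<close> is \<open>f k\<close>.\<close>

definition rees :: "'i weyl_series set" where
  "rees = {f. (\<forall>k. f k \<in> weyl_le k) \<and> finite {k. f k \<noteq> \<zero>\<^bsub>weyl\<^esub>}}"

definition weyl_hat :: "'i weyl_series ring" where
  "weyl_hat = (power_series weyl)
    \<lparr>carrier := {f. (\<forall>k. f k \<in> weyl_le k) \<and>
                    filterlim (\<lambda>k. int k - int (weyl_ord (f k))) at_top sequentially}\<rparr>"

definition B :: "'i \<Rightarrow> 'i \<Rightarrow> nat \<Rightarrow> nat \<Rightarrow> 'i weyl_elt" where
  "B i j p q = weyl_class (letter (Coord i p j q))"

text \<open>
  Traces around closed paths with the factors in the written order:
  \<open>Tr4 i j m l = Tr (B\<^bsub>ij\<^esub> B\<^bsub>jm\<^esub> B\<^bsub>ml\<^esub> B\<^bsub>li\<^esub>)\<close>, and similarly for \<open>Tr2\<close> and \<open>Tr3\<close>.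
\<close>

definition Tr2 :: "'i \<Rightarrow> 'i \<Rightarrow> 'i weyl_elt" where
  "Tr2 i j = (\<Oplus>\<^bsub>weyl\<^esub>p\<in>{..<d i}. \<Oplus>\<^bsub>weyl\<^esub>q\<in>{..<d j}. B i j p q \<otimes>\<^bsub>weyl\<^esub> B j i q p)"

definition Tr3 :: "'i \<Rightarrow> 'i \<Rightarrow> 'i \<Rightarrow> 'i weyl_elt" where
  "Tr3 i j m = (\<Oplus>\<^bsub>weyl\<^esub>p\<in>{..<d i}. \<Oplus>\<^bsub>weyl\<^esub>q\<in>{..<d j}. \<Oplus>\<^bsub>weyl\<^esub>r\<in>{..<d m}.
      B i j p q \<otimes>\<^bsub>weyl\<^esub> B j m q r \<otimes>\<^bsub>weyl\<^esub> B m i r p)"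

definition Tr4 :: "'i \<Rightarrow> 'i \<Rightarrow> 'i \<Rightarrow> 'i \<Rightarrow> 'i weyl_elt" where
  "Tr4 i j m l = (\<Oplus>\<^bsub>weyl\<^esub>p\<in>{..<d i}. \<Oplus>\<^bsub>weyl\<^esub>q\<in>{..<d j}. \<Oplus>\<^bsub>weyl\<^esub>r\<in>{..<d m}. \<Oplus>\<^bsub>weyl\<^esub>s\<in>{..<d l}.
      B i j p q \<otimes>\<^bsub>weyl\<^esub> B j m q r \<otimes>\<^bsub>weyl\<^esub> B m l r s \<otimes>\<^bsub>weyl\<^esub> B l i s p)"

definition times :: "('i \<Rightarrow> complex) set" where
  "times = {t. \<forall>i m. \<pi> i = \<pi> m \<and> i \<noteq> m \<longrightarrow> t i \<noteq> t m}"

text \<open>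
  In the case \<open>a\<^bsub>i\<^esub> = \<infinity>\<close> the sign is the one for which the connection is flat: with
  \<open>t\<^bsub>j\<^esub> + a\<^bsub>j\<^esub> t\<^bsub>i\<^esub>\<close> instead, and \<open>\<phi>\<close> and the Poisson bracket as above, already the classical
  Hamiltonians fail to Poisson commute for three nodes in three parts, \<open>d = 1\<close> and readings
  \<open>\<infinity>\<close>, \<open>x\<close>, \<open>y\<close>. The value for two nodes with reading \<open>\<infinity>\<close> is never used.
\<close>

definition cf :: "'i \<Rightarrow> 'i \<Rightarrow> ('i \<Rightarrow> complex) \<Rightarrow> complex" where
  "cf i j t = (case (a (\<pi> i), a (\<pi> j)) of
      (Some x, Some y) \<Rightarrow> (t j - t i) * (\<phi> i j)\<^sup>2
    | (Some x, None) \<Rightarrow> t j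
    | (None, Some y) \<Rightarrow> t j - y * t i
    | (None, None) \<Rightarrow> 0)"

definition H4 :: "'i \<Rightarrow> ('i \<Rightarrow> complex) \<Rightarrow> 'i weyl_elt" where
  "H4 i t = (\<Oplus>\<^bsub>weyl\<^esub>m\<in>siblings i.
      (\<Oplus>\<^bsub>weyl\<^esub>j\<in>others i. \<Oplus>\<^bsub>weyl\<^esub>l\<in>others i - {j}.
         (\<phi> i j * \<phi> i l / (t i - t m)) \<cdot> Tr4 i j m l)
      \<oplus>\<^bsub>weyl\<^esub>
      (\<Oplus>\<^bsub>weyl\<^esub>j\<in>others i. ((\<phi> i j)\<^sup>2 / (t i - t m)) \<cdot> Tr4 j m j i))"

definition H3 :: "'i \<Rightarrow> 'i weyl_elt" where
  "H3 i = (\<Oplus>\<^bsub>weyl\<^esub>j\<in>others i. \<Oplus>\<^bsub>weyl\<^esub>l\<in>{l \<in> others i. \<pi> j \<noteq> \<pi> l}.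
      (\<phi> i l * \<phi> j i) \<cdot> Tr3 i l j)"

definition H2 :: "'i \<Rightarrow> ('i \<Rightarrow> complex) \<Rightarrow> 'i weyl_elt" where
  "H2 i t = (\<Oplus>\<^bsub>weyl\<^esub>j\<in>others i. (cf i j t / 2) \<cdot> (Tr2 i j \<oplus>\<^bsub>weyl\<^esub> Tr2 j i))"

definition quantum_hamiltonian :: "'i \<Rightarrow> ('i \<Rightarrow> complex) \<Rightarrow> 'i weyl_series" where
  "quantum_hamiltonian i t = (\<lambda>k.
     if k = 4 then H4 i t
     else if k = 3 then \<ominus>\<^bsub>weyl\<^esub> H3 i
     else if k = 2 then H2 i t
     else \<zero>\<^bsub>weyl\<^esub>)"


section \<open>Strong flatness\<close>

text \<open>
  Partial derivatives of functions of the times with values in the Weyl algebra, which carries no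
  topology: locally along the \<open>t\<^bsub>j\<^esub>\<close>-line the function must be a finite combination of fixed
  elements with complex differentiable coefficients, and one differentiates the coefficients.
\<close>

definition has_partial ::
    "(('i \<Rightarrow> complex) \<Rightarrow> 'i weyl_elt) \<Rightarrow> 'i \<Rightarrow> ('i \<Rightarrow> complex) \<Rightarrow> 'i weyl_elt \<Rightarrow> bool" where
  "has_partial F j t D \<longleftrightarrow> (\<exists>N X f f'.
      (\<forall>n<N. X n \<in> carrier weyl \<and> (f n has_field_derivative f' n) (at (t j))) \<and>
      (\<forall>\<^sub>F z in nhds (t j). F (t(j := z)) = (\<Oplus>\<^bsub>weyl\<^esub>n\<in>{..<(N::nat)}. f n z \<cdot> X n)) \<and>
      D = (\<Oplus>\<^bsub>weyl\<^esub>n\<in>{..<N}. f' n \<cdot> X n))"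

text \<open>Formal power series in \<open>\<hbar>\<close> are differentiated coefficientwise.\<close>

definition differentiable_in ::
    "(('i \<Rightarrow> complex) \<Rightarrow> 'i weyl_series) \<Rightarrow> 'i \<Rightarrow> ('i \<Rightarrow> complex) \<Rightarrow> bool" where
  "differentiable_in F j t \<longleftrightarrow> (\<forall>k. \<exists>D. has_partial (\<lambda>s. F s k) j t D)"

definition partial ::
    "(('i \<Rightarrow> complex) \<Rightarrow> 'i weyl_series) \<Rightarrow> 'i \<Rightarrow> ('i \<Rightarrow> complex) \<Rightarrow> 'i weyl_series" where
  "partial F j t = (\<lambda>k. THE D. has_partial (\<lambda>s. F s k) j t D)"

text \<open>
  The connection \<open>d - \<Sum>i. H i dt\<^bsub>i\<^esub>\<close> on the trivial bundle with fibre \<open>weyl_hat\<close> over \<open>times\<close> is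
  given by the coefficients \<open>H\<close> of its connection form, which act by left multiplication.
\<close>

definition connection_form :: "('i \<Rightarrow> ('i \<Rightarrow> complex) \<Rightarrow> 'i weyl_series) \<Rightarrow> bool" where
  "connection_form H \<longleftrightarrow>
    (\<forall>t\<in>times. \<forall>i. H i t \<in> carrier weyl_hat \<and> (\<forall>j. differentiable_in (H i) j t))"

definition strongly_flat :: "('i \<Rightarrow> ('i \<Rightarrow> complex) \<Rightarrow> 'i weyl_series) \<Rightarrow> bool" where
  "strongly_flat H \<longleftrightarrow> connection_form H \<and>
    (\<forall>t\<in>times. \<forall>i j.
       commutator weyl_hat (H i t) (H j t) = \<zero>\<^bsub>weyl_hat\<^esub> \<and>
       partial (H i) j t \<ominus>\<^bsub>weyl_hat\<^esub> partial (H j) i t = \<zero>\<^bsub>weyl_hat\<^esub>)"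

section \<open>Well-definedness\<close>

text \<open>
  The Weyl algebra is a ring, partial derivatives are unique, and the quantum Hamiltonians take
  values in the Rees algebra, which is contained in \<open>weyl_hat\<close>.
\<close>


lemma letters_add: "letters (u + v) = letters u @ letters v"
  by (simp add: plus_ncmonom_def)

lemma letters_zero: "letters 0 = []"
  by (simp add: zero_ncmonom_def)

lemma tensor_alg_simps:
  "mult tensor_alg = (*)" "one tensor_alg = 1" "zero tensor_alg = 0" "add tensor_alg = (+)"
  by (simp_all add: tensor_alg_def)

lemma tensor_alg_carrier:
  "x \<in> carrier tensor_alg \<longleftrightarrow> (\<forall>w\<in>Poly_Mapping.keys x. set (letters w) \<subseteq> coords)"
  by (simp add: tensor_alg_def)

lemma ring_tensor_alg: "ring tensor_alg"
proof (rule ringI)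
  have neg: "- x \<in> carrier tensor_alg" if "x \<in> carrier tensor_alg" for x
    using that by (simp add: tensor_alg_carrier)
  show "abelian_group tensor_alg"
  proof (rule abelian_groupI)
    fix x y assume xy: "x \<in> carrier tensor_alg" "y \<in> carrier tensor_alg"
    then show "x \<oplus>\<^bsub>tensor_alg\<^esub> y \<in> carrier tensor_alg"
      using Poly_Mapping.keys_add[of x y] by (auto simp: tensor_alg_carrier tensor_alg_simps)
    show "\<exists>z\<in>carrier tensor_alg. z \<oplus>\<^bsub>tensor_alg\<^esub> x = \<zero>\<^bsub>tensor_alg\<^esub>"
      using neg[OF xy(1)] by (intro bexI[of _ "- x"]) (auto simp: tensor_alg_simps)
  qed (auto simp: tensor_alg_simps tensor_alg_carrier algebra_simps)
  show "monoid tensor_alg"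
  proof (rule monoidI)
    fix x y assume xy: "x \<in> carrier tensor_alg" "y \<in> carrier tensor_alg"
    then show "x \<otimes>\<^bsub>tensor_alg\<^esub> y \<in> carrier tensor_alg"
      using keys_mult[of x y] 
      by (fastforce simp: tensor_alg_carrier tensor_alg_simps letters_add)
  qed (auto simp: tensor_alg_simps tensor_alg_carrier algebra_simps letters_zero)
qed (auto simp: tensor_alg_simps algebra_simps)

lemma tensor_alg_minus:
  assumes "x \<in> carrier tensor_alg" "y \<in> carrier tensor_alg"
  shows "x \<ominus>\<^bsub>tensor_alg\<^esub> y = x - y"
proof -
  interpret ring tensor_alg by (rule ring_tensor_alg)
  have "\<ominus>\<^bsub>tensor_alg\<^esub> y = - y"
    using assms by (intro minus_equality) (auto simp: tensor_alg_simps tensor_alg_carrier)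
  then show ?thesis by (simp add: a_minus_def tensor_alg_simps)
qed

lemma scalar_closed: "scalar c \<in> carrier tensor_alg"
  by (auto simp: tensor_alg_carrier scalar_def letters_zero split: if_splits)

lemma letter_closed: "x \<in> coords \<Longrightarrow> letter x \<in> carrier tensor_alg"
  by (auto simp: tensor_alg_carrier letter_def split: if_splits)

lemma tensor_alg_mult_closed:
  "x \<in> carrier tensor_alg \<Longrightarrow> y \<in> carrier tensor_alg \<Longrightarrow> x * y \<in> carrier tensor_alg"
  and tensor_alg_add_closed:
  "x \<in> carrier tensor_alg \<Longrightarrow> y \<in> carrier tensor_alg \<Longrightarrow> x + y \<in> carrier tensor_alg"
  and tensor_alg_diff_closed:
  "x \<in> carrier tensor_alg \<Longrightarrow> y \<in> carrier tensor_alg \<Longrightarrow> x - y \<in> carrier tensor_alg"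
proof -
  interpret ring tensor_alg by (rule ring_tensor_alg)
  assume a: "x \<in> carrier tensor_alg" "y \<in> carrier tensor_alg"
  show "x * y \<in> carrier tensor_alg" using m_closed[OF a] by (simp add: tensor_alg_simps)
  show "x + y \<in> carrier tensor_alg" using a_closed[OF a] by (simp add: tensor_alg_simps)
  show "x - y \<in> carrier tensor_alg" using minus_closed[OF a] by (simp add: tensor_alg_minus a)
qed

lemma tensor_alg_sum_closed:
  "(\<And>n. n \<in> S \<Longrightarrow> x n \<in> carrier tensor_alg) \<Longrightarrow> (\<Sum>n\<in>S. x n) \<in> carrier tensor_alg"
  by (induction S rule: infinite_finite_induct)
     (auto simp: tensor_alg_add_closed, simp_all add: tensor_alg_carrier)

lemma lin_closed: "lin f \<in> carrier tensor_alg"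
  unfolding lin_def
  by (intro tensor_alg_sum_closed tensor_alg_mult_closed scalar_closed letter_closed)

lemma ideal_weyl_ideal: "ideal weyl_ideal tensor_alg"
proof -
  interpret ring tensor_alg by (rule ring_tensor_alg)
  show ?thesis unfolding weyl_ideal_def
    by (rule genideal_ideal)
       (auto intro!: tensor_alg_diff_closed tensor_alg_mult_closed lin_closed scalar_closed)
qed

lemma ring_weyl: "ring weyl"
  unfolding weyl_def using ideal_weyl_ideal by (rule ideal.quotient_is_ring)

lemma weyl_class_hom: "weyl_class \<in> ring_hom tensor_alg weyl"
  using ideal.rcos_ring_hom[OF ideal_weyl_ideal] by (simp add: weyl_def weyl_class_def [abs_def])

lemma weyl_class_closed: "x \<in> carrier tensor_alg \<Longrightarrow> weyl_class x \<in> carrier weyl"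
  using weyl_class_hom by (rule ring_hom_closed)

lemma weyl_class_add:
  "x \<in> carrier tensor_alg \<Longrightarrow> y \<in> carrier tensor_alg \<Longrightarrow>
   weyl_class x \<oplus>\<^bsub>weyl\<^esub> weyl_class y = weyl_class (x + y)"
  using ring_hom_add[OF weyl_class_hom] by (simp add: tensor_alg_simps)

lemma weyl_class_mult:
  "x \<in> carrier tensor_alg \<Longrightarrow> y \<in> carrier tensor_alg \<Longrightarrow>
   weyl_class x \<otimes>\<^bsub>weyl\<^esub> weyl_class y = weyl_class (x * y)"
  using ring_hom_mult[OF weyl_class_hom] by (simp add: tensor_alg_simps)

lemma weyl_class_zero: "weyl_class 0 = \<zero>\<^bsub>weyl\<^esub>"
  using ring_hom_zero[OF weyl_class_hom ring_tensor_alg ring_weyl] by (simp add: tensor_alg_simps)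

lemma weyl_class_surj: "X \<in> carrier weyl \<Longrightarrow> \<exists>x\<in>carrier tensor_alg. X = weyl_class x"
  by (auto simp: weyl_def FactRing_def A_RCOSETS_def' weyl_class_def)

lemma weyl_class_eq_iff:
  "x \<in> carrier tensor_alg \<Longrightarrow> y \<in> carrier tensor_alg \<Longrightarrow>
   weyl_class x = weyl_class y \<longleftrightarrow> x - y \<in> weyl_ideal"
  using ring.quotient_eq_iff_same_a_r_cos[OF ring_tensor_alg ideal_weyl_ideal, of x y]
  by (simp add: weyl_class_def tensor_alg_minus)

lemma weyl_class_sum:
  "finite S \<Longrightarrow> (\<And>n. n \<in> S \<Longrightarrow> x n \<in> carrier tensor_alg) \<Longrightarrow>
   (\<Oplus>\<^bsub>weyl\<^esub>n\<in>S. weyl_class (x n)) = weyl_class (\<Sum>n\<in>S. x n)"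
proof (induction S rule: finite_induct)
  interpret ring weyl by (rule ring_weyl)
  case empty show ?case by (simp add: weyl_class_zero)
next
  interpret ring weyl by (rule ring_weyl)
  case (insert n S)
  then show ?case
    by (subst finsum_insert) (auto simp: weyl_class_closed weyl_class_add tensor_alg_sum_closed)
qed

lemma weyl_scale_class:
  "x \<in> carrier tensor_alg \<Longrightarrow> c \<cdot> weyl_class x = weyl_class (scalar c * x)"
  by (simp add: weyl_scale_def weyl_class_mult scalar_closed)

lemma scalar_add: "scalar (b + c) = scalar b + scalar c"
  by (simp add: scalar_def single_add)

lemma scalar_mult: "scalar (b * c) = scalar b * scalar c"
  by (simp add: scalar_def mult_single)

lemma scalar_one: "scalar 1 = 1" and scalar_zero: "scalar 0 = 0"
  by (simp_all add: scalar_def)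

lemma weyl_ideal_closed:
  shows weyl_ideal_zero: "0 \<in> weyl_ideal"
    and weyl_ideal_add: "x \<in> weyl_ideal \<Longrightarrow> y \<in> weyl_ideal \<Longrightarrow> x + y \<in> weyl_ideal"
    and weyl_ideal_scale: "x \<in> weyl_ideal \<Longrightarrow> scalar c * x \<in> weyl_ideal"
proof -
  interpret ideal weyl_ideal tensor_alg by (rule ideal_weyl_ideal)
  show "0 \<in> weyl_ideal" using additive_subgroup.zero_closed [OF additive_subgroup_axioms]
    by (simp add: tensor_alg_simps)
  show "x + y \<in> weyl_ideal" if "x \<in> weyl_ideal" "y \<in> weyl_ideal"
    using additive_subgroup.a_closed [OF additive_subgroup_axioms that] by (simp add: tensor_alg_simps)
  show "scalar c * x \<in> weyl_ideal" if "x \<in> weyl_ideal"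
    using I_l_closed[OF that scalar_closed] by (simp add: tensor_alg_simps)
qed

lemma weyl_ideal_derivative:
  fixes h :: "nat \<Rightarrow> complex \<Rightarrow> complex"
  assumes "\<And>n. n < N \<Longrightarrow> (h n has_field_derivative h' n) (at z0)"
    and "\<forall>\<^sub>F z in nhds z0. (\<Sum>n<N. scalar (h n z) * u n) \<in> weyl_ideal"
  shows "(\<Sum>n<N. scalar (h' n) * u n) \<in> weyl_ideal"
  using assms
proof (induction N arbitrary: h h')
  case 0
  then show ?case by (simp add: weyl_ideal_zero)
next
  case (Suc N)
  show ?case
  proof (cases "\<exists>c. u N - (\<Sum>n<N. scalar (c n) * u n) \<in> weyl_ideal")
    case True
    then obtain c where c: "u N - (\<Sum>n<N. scalar (c n) * u n) \<in> weyl_ideal" by blast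
    have split: "(\<Sum>n<N. scalar (g n + g N * c n) * u n)
        = (\<Sum>n<Suc N. scalar (g n) * u n) + scalar (- g N) * (u N - (\<Sum>n<N. scalar (c n) * u n))" for g
    proof -
      have neg: "scalar (- g N) = - (scalar (g N) :: 'i coord tens)"
        by (simp add: scalar_def single_uminus)
      show ?thesis
        unfolding neg
        by (simp add: scalar_add scalar_mult distrib_right right_diff_distrib mult.assoc sum.distrib
            sum_distrib_left sum_negf)
    qed
    have "(\<Sum>n<N. scalar (h' n + h' N * c n) * u n) \<in> weyl_ideal"
    proof (rule Suc.IH)
      fix n assume "n < N"
      then show "((\<lambda>z. h n z + h N z * c n) has_field_derivative h' n + h' N * c n) (at z0)"
        using Suc.prems(1)[of n] Suc.prems(1)[of N] by (auto intro!: derivative_eq_intros)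
    next
      show "\<forall>\<^sub>F z in nhds z0. (\<Sum>n<N. scalar (h n z + h N z * c n) * u n) \<in> weyl_ideal"
        using Suc.prems(2)
      proof eventually_elim
        case (elim z)
        show ?case
          unfolding split[of "\<lambda>n. h n z"] by (intro weyl_ideal_add weyl_ideal_scale elim c)
      qed
    qed
    moreover have "(\<Sum>n<Suc N. scalar (h' n) * u n)
       = (\<Sum>n<N. scalar (h' n + h' N * c n) * u n)
         + scalar (h' N) * (u N - (\<Sum>n<N. scalar (c n) * u n))"
      by (simp add: scalar_add scalar_mult distrib_right right_diff_distrib mult.assoc sum.distrib
            sum_distrib_left sum_negf)
    ultimately show ?thesis using c by (simp only: weyl_ideal_add weyl_ideal_scale)
  next
    case False
    have hN: "\<forall>\<^sub>F z in nhds z0. h N z = 0"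
      using Suc.prems(2)
    proof eventually_elim
      case (elim z)
      show ?case
      proof (rule ccontr)
        assume nz: "h N z \<noteq> 0"
        have "scalar (inverse (h N z)) * (\<Sum>n<Suc N. scalar (h n z) * u n) \<in> weyl_ideal"
          by (intro weyl_ideal_scale elim)
        moreover have "scalar (inverse (h N z)) * (\<Sum>n<Suc N. scalar (h n z) * u n)
            = u N - (\<Sum>n<N. scalar (- inverse (h N z) * h n z) * u n)"
        proof -
          have "scalar (- inverse (h N z) * h n z) = - (scalar (inverse (h N z)) * scalar (h n z) :: 'i coord tens)" for n
            by (simp add: scalar_def mult_single single_uminus)
          moreover have "scalar (inverse (h N z)) * scalar (h N z) = (1 :: 'i coord tens)"
            using nz by (simp flip: scalar_mult scalar_one)
          ultimately show ?thesis
            by (simp only: sum.lessThan_Suc distrib_left sum_distrib_left sum_negf mult_minus_left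
                  mult.assoc [symmetric] mult_1_left) simp
        qed
        ultimately have "u N - (\<Sum>n<N. scalar (- inverse (h N z) * h n z) * u n) \<in> weyl_ideal"
          by (simp only:)
        then have "\<exists>c. u N - (\<Sum>n<N. scalar (c n) * u n) \<in> weyl_ideal"
          by (rule exI [of _ "\<lambda>n. - inverse (h N z) * h n z"])
        with False show False ..
      qed
    qed
    have "(h N has_field_derivative 0) (at z0)"
      using DERIV_cong_ev [OF refl hN refl, of 0] by simp
    then have h'N: "h' N = 0"
      using DERIV_unique [OF Suc.prems(1) [of N]] by simp
    have "(\<Sum>n<N. scalar (h' n) * u n) \<in> weyl_ideal"
    proof (rule Suc.IH)
      show "\<forall>\<^sub>F z in nhds z0. (\<Sum>n<N. scalar (h n z) * u n) \<in> weyl_ideal"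
        using Suc.prems(2) hN by eventually_elim (simp add: scalar_zero)
    qed (rule Suc.prems(1), simp)
    then show ?thesis by (simp add: h'N scalar_zero)
  qed
qed

lemma has_partial_unique:
  assumes "has_partial F j t D" "has_partial F j t E"
  shows "D = E"
proof -
  interpret ring weyl by (rule ring_weyl)
  have lift: "\<exists>(N::nat) u f f'. (\<forall>n<N. u n \<in> carrier tensor_alg \<and> (f n has_field_derivative f' n) (at (t j))) \<and>
      (\<forall>\<^sub>F z in nhds (t j). F (t(j := z)) = weyl_class (\<Sum>n<N. scalar (f n z) * u n)) \<and>
      D = weyl_class (\<Sum>n<N. scalar (f' n) * u n)" if prem: "has_partial F j t D" for D
  proof -
    obtain N X f f' where *:
      "\<forall>n<N. X n \<in> carrier weyl \<and> (f n has_field_derivative f' n) (at (t j))"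
      "\<forall>\<^sub>F z in nhds (t j). F (t(j := z)) = (\<Oplus>\<^bsub>weyl\<^esub>n\<in>{..<(N::nat)}. f n z \<cdot> X n)"
      "D = (\<Oplus>\<^bsub>weyl\<^esub>n\<in>{..<N}. f' n \<cdot> X n)"
      using prem unfolding has_partial_def by blast
    have "\<forall>n<N. \<exists>u\<in>carrier tensor_alg. X n = weyl_class u"
      using *(1) weyl_class_surj by blast
    then obtain u where u: "\<forall>n<N. u n \<in> carrier tensor_alg \<and> X n = weyl_class (u n)"
      by metis
    have eq: "(\<Oplus>\<^bsub>weyl\<^esub>n\<in>{..<N}. g n \<cdot> X n) = weyl_class (\<Sum>n<N. scalar (g n) * u n)" for g
    proof -
      have "(\<Oplus>\<^bsub>weyl\<^esub>n\<in>{..<N}. g n \<cdot> X n) = (\<Oplus>\<^bsub>weyl\<^esub>n\<in>{..<N}. weyl_class (scalar (g n) * u n))"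
        using u by (intro finsum_cong')
          (auto simp: weyl_scale_class intro!: weyl_class_closed tensor_alg_mult_closed scalar_closed)
      also have "\<dots> = weyl_class (\<Sum>n<N. scalar (g n) * u n)"
        using u by (intro weyl_class_sum) (auto intro!: tensor_alg_mult_closed scalar_closed)
      finally show ?thesis .
    qed
    show ?thesis
      using *(1) u *(2,3) unfolding eq by (intro exI[of _ N] exI[of _ u] exI[of _ f] exI[of _ f']) auto
  qed
  obtain N u f f' where 1:
    "\<forall>n<N. u n \<in> carrier tensor_alg \<and> (f n has_field_derivative f' n) (at (t j))"
    "\<forall>\<^sub>F z in nhds (t j). F (t(j := z)) = weyl_class (\<Sum>n<(N::nat). scalar (f n z) * u n)"
    "D = weyl_class (\<Sum>n<N. scalar (f' n) * u n)"
    using lift[OF assms(1)] by blast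
  obtain M v g g' where 2:
    "\<forall>n<M. v n \<in> carrier tensor_alg \<and> (g n has_field_derivative g' n) (at (t j))"
    "\<forall>\<^sub>F z in nhds (t j). F (t(j := z)) = weyl_class (\<Sum>n<(M::nat). scalar (g n z) * v n)"
    "E = weyl_class (\<Sum>n<M. scalar (g' n) * v n)"
    using lift[OF assms(2)] by blast
  define w where "w n = (if n < N then u n else v (n - N))" for n
  define h where "h n z = (if n < N then f n z else - g (n - N) z)" for n z
  define h' where "h' n = (if n < N then f' n else - g' (n - N))" for n
  have split: "(\<Sum>n<N+M. scalar (if n < N then p n else - q (n - N)) * w n)
      = (\<Sum>n<N. scalar (p n) * u n) - (\<Sum>n<M. scalar (q n) * v n)" for p q
  proof -
    have neg: "scalar (- c) = - (scalar c :: 'i coord tens)" for c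
      by (simp add: scalar_def single_uminus)
    have "(\<Sum>n<N+M. G n) = (\<Sum>n<N. G n) + (\<Sum>n<M. G (N + n))" for G :: "nat \<Rightarrow> 'i coord tens"
      by (induction M) (simp_all add: add.assoc)
    then show ?thesis by (simp add: w_def neg sum_negf)
  qed
  have cl: "(\<Sum>n<N. scalar (p n) * u n) \<in> carrier tensor_alg"
       "(\<Sum>n<M. scalar (p n) * v n) \<in> carrier tensor_alg" for p
    using 1(1) 2(1) by (auto intro!: tensor_alg_sum_closed tensor_alg_mult_closed scalar_closed)
  have "(\<Sum>n<N+M. scalar (h' n) * w n) \<in> weyl_ideal"
  proof (rule weyl_ideal_derivative)
    fix n assume "n < N + M"
    then show "(h n has_field_derivative h' n) (at (t j))"
      using 1(1) 2(1) by (cases "n < N") (auto simp: h_def [abs_def] h'_def intro!: derivative_eq_intros)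
  next
    show "\<forall>\<^sub>F z in nhds (t j). (\<Sum>n<N+M. scalar (h n z) * w n) \<in> weyl_ideal"
      using 1(2) 2(2)
    proof eventually_elim
      case (elim z)
      then show ?case
        using weyl_class_eq_iff [OF cl(1) cl(2), of "\<lambda>n. f n z" "\<lambda>n. g n z"]
        unfolding h_def split [of "\<lambda>n. f n z" "\<lambda>n. g n z"] by simp
    qed
  qed
  then show ?thesis
    unfolding h'_def split 1(3) 2(3) by (simp add: weyl_class_eq_iff cl)
qed

lemma partial_eqI:
  "(\<And>k. has_partial (\<lambda>s. F s k) j t (D k)) \<Longrightarrow> partial F j t = D"
  unfolding partial_def by (rule ext, rule the_equality, assumption, rule has_partial_unique)

lemma weyl_le_zero: "\<zero>\<^bsub>weyl\<^esub> \<in> weyl_le k"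
  unfolding weyl_le_def weyl_class_zero [symmetric]
  by (rule imageI) (simp add: tensor_alg_carrier)

lemma rees_subset: "rees \<subseteq> carrier weyl_hat"
proof
  fix f assume f: "f \<in> rees"
  have "weyl_ord \<zero>\<^bsub>weyl\<^esub> = 0"
    unfolding weyl_ord_def using weyl_le_zero by (intro Least_eq_0)
  moreover have "\<forall>\<^sub>F k in sequentially. f k = \<zero>\<^bsub>weyl\<^esub>"
    using f by (auto simp: rees_def cofinite_eq_sequentially [symmetric] eventually_cofinite)
  ultimately have "\<forall>\<^sub>F k in sequentially. int k = int k - int (weyl_ord (f k))"
    by (auto elim: eventually_mono)
  moreover have "filterlim int at_top sequentially"
    by (rule filterlim_int_sequentially)
  ultimately show "f \<in> carrier weyl_hat"
    using f filterlim_cong[OF refl refl, of int "\<lambda>k. int k - int (weyl_ord (f k))" sequentially]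
    by (simp add: weyl_hat_def rees_def)
qed

definition tensor_le :: "nat \<Rightarrow> 'i coord tens set" where
  "tensor_le k = {x \<in> carrier tensor_alg. \<forall>w\<in>Poly_Mapping.keys x. length (letters w) \<le> k}"

lemma weyl_le_eq: "weyl_le k = weyl_class ` tensor_le k"
  by (simp add: weyl_le_def tensor_le_def)

lemma weyl_le_closed: "X \<in> weyl_le k \<Longrightarrow> X \<in> carrier weyl"
  by (auto simp: weyl_le_def intro: weyl_class_closed)

lemma weyl_le_add:
  assumes "X \<in> weyl_le k" "Y \<in> weyl_le k"
  shows "X \<oplus>\<^bsub>weyl\<^esub> Y \<in> weyl_le k"
proof -
  obtain x y where xy: "X = weyl_class x" "Y = weyl_class y" "x \<in> tensor_le k" "y \<in> tensor_le k"
    using assms by (auto simp: weyl_le_eq)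
  have "x + y \<in> tensor_le k"
    using xy(3,4) Poly_Mapping.keys_add [of x y]
    by (auto simp: tensor_le_def intro: tensor_alg_add_closed)
  moreover have "X \<oplus>\<^bsub>weyl\<^esub> Y = weyl_class (x + y)"
    using xy by (simp add: weyl_class_add tensor_le_def)
  ultimately show ?thesis by (simp add: weyl_le_eq)
qed

lemma weyl_le_mult:
  assumes "X \<in> weyl_le k" "Y \<in> weyl_le l"
  shows "X \<otimes>\<^bsub>weyl\<^esub> Y \<in> weyl_le (k + l)"
proof -
  obtain x y where xy: "X = weyl_class x" "Y = weyl_class y" "x \<in> tensor_le k" "y \<in> tensor_le l"
    using assms by (auto simp: weyl_le_eq)
  have "x * y \<in> tensor_le (k + l)"
    using xy(3,4) keys_mult [of x y]
    by (fastforce simp: tensor_le_def letters_add intro: tensor_alg_mult_closed add_mono)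
  moreover have "X \<otimes>\<^bsub>weyl\<^esub> Y = weyl_class (x * y)"
    using xy by (simp add: weyl_class_mult tensor_le_def)
  ultimately show ?thesis by (simp add: weyl_le_eq)
qed

lemma weyl_le_scale: "X \<in> weyl_le k \<Longrightarrow> c \<cdot> X \<in> weyl_le k"
proof -
  assume X: "X \<in> weyl_le k"
  have "weyl_class (scalar c) \<in> weyl_le 0"
    unfolding weyl_le_eq using scalar_closed [of c]
    by (intro imageI) (auto simp: tensor_le_def scalar_def letters_zero split: if_splits)
  from weyl_le_mult [OF this X] show ?thesis by (simp add: weyl_scale_def)
qed

lemma weyl_le_minus:
  assumes "X \<in> weyl_le k"
  shows "\<ominus>\<^bsub>weyl\<^esub> X \<in> weyl_le k"
proof -
  interpret ring weyl by (rule ring_weyl)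
  obtain x where x: "X = weyl_class x" "x \<in> tensor_le k"
    using assms by (auto simp: weyl_le_eq)
  have m: "- x \<in> tensor_le k"
    using x(2) by (auto simp: tensor_le_def tensor_alg_carrier)
  have "weyl_class (- x) \<oplus>\<^bsub>weyl\<^esub> X = \<zero>\<^bsub>weyl\<^esub>"
    using x m by (simp add: weyl_class_add tensor_le_def weyl_class_zero)
  then have "\<ominus>\<^bsub>weyl\<^esub> X = weyl_class (- x)"
    using x m by (intro minus_equality) (auto simp: tensor_le_def intro: weyl_class_closed)
  then show ?thesis using m by (simp add: weyl_le_eq)
qed

lemma weyl_le_sum:
  assumes "\<And>n. n \<in> S \<Longrightarrow> X n \<in> weyl_le k"
  shows "(\<Oplus>\<^bsub>weyl\<^esub>n\<in>S. X n) \<in> weyl_le k"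
proof -
  interpret ring weyl by (rule ring_weyl)
  show ?thesis
    using assms
  proof (induction S rule: infinite_finite_induct)
    case (insert x F)
    have "(\<Oplus>\<^bsub>weyl\<^esub>n\<in>insert x F. X n) = X x \<oplus>\<^bsub>weyl\<^esub> (\<Oplus>\<^bsub>weyl\<^esub>n\<in>F. X n)"
      using insert.hyps insert.prems by (intro finsum_insert) (auto intro: weyl_le_closed)
    moreover have "X x \<in> weyl_le k" "(\<Oplus>\<^bsub>weyl\<^esub>n\<in>F. X n) \<in> weyl_le k"
      using insert.IH insert.prems by auto
    ultimately show ?case by (simp only: weyl_le_add)
  qed (simp_all add: finsum_infinite weyl_le_zero)
qed

lemma weyl_le_mult_Suc:
  "X \<in> weyl_le k \<Longrightarrow> Y \<in> weyl_le (Suc 0) \<Longrightarrow> X \<otimes>\<^bsub>weyl\<^esub> Y \<in> weyl_le (Suc k)"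
  using weyl_le_mult [of X k Y "Suc 0"] by simp

lemma B_le:
  assumes "\<pi> i \<noteq> \<pi> j" "p < d i" "q < d j"
  shows "B i j p q \<in> weyl_le (Suc 0)"
  unfolding B_def weyl_le_eq using assms letter_closed [of "Coord i p j q"]
  by (intro imageI) (auto simp: tensor_le_def letter_def coords_def)

lemma Tr2_le: "\<pi> i \<noteq> \<pi> j \<Longrightarrow> Tr2 i j \<in> weyl_le 2"
  unfolding Tr2_def numeral_2_eq_2 by (intro weyl_le_sum weyl_le_mult_Suc B_le) auto

lemma Tr3_le: "\<pi> i \<noteq> \<pi> j \<Longrightarrow> \<pi> j \<noteq> \<pi> m \<Longrightarrow> \<pi> m \<noteq> \<pi> i \<Longrightarrow> Tr3 i j m \<in> weyl_le 3"
  unfolding Tr3_def numeral_3_eq_3 by (intro weyl_le_sum weyl_le_mult_Suc B_le) auto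

lemma Tr4_le:
  "\<pi> i \<noteq> \<pi> j \<Longrightarrow> \<pi> j \<noteq> \<pi> m \<Longrightarrow> \<pi> m \<noteq> \<pi> l \<Longrightarrow> \<pi> l \<noteq> \<pi> i \<Longrightarrow> Tr4 i j m l \<in> weyl_le 4"
  unfolding Tr4_def eval_nat_numeral BitM.simps numeral_One One_nat_def
  by (intro weyl_le_sum weyl_le_mult_Suc B_le) auto

lemma quantum_hamiltonian_rees: "quantum_hamiltonian i t \<in> rees"
proof -
  have 4: "H4 i t \<in> weyl_le 4"
    unfolding H4_def
    by (intro weyl_le_sum weyl_le_add weyl_le_scale Tr4_le) (auto simp: others_def siblings_def)
  have 3: "\<ominus>\<^bsub>weyl\<^esub> H3 i \<in> weyl_le 3"
    unfolding H3_def
    by (intro weyl_le_minus weyl_le_sum weyl_le_scale Tr3_le) (auto simp: others_def)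
  have 2: "H2 i t \<in> weyl_le 2"
    unfolding H2_def
    by (intro weyl_le_sum weyl_le_add weyl_le_scale Tr2_le) (auto simp: others_def)
  have "finite {k. quantum_hamiltonian i t k \<noteq> \<zero>\<^bsub>weyl\<^esub>}"
    by (rule finite_subset [of _ "{2, 3, 4}"]) (auto simp: quantum_hamiltonian_def)
  then show ?thesis
    using 4 3 2 by (simp add: rees_def quantum_hamiltonian_def weyl_le_zero)
qed

end

end

theory Submission
  imports Defs
begin

text \<open>
  After a choice of bases every trace is a sum of words in the matrix entries \<open>b \<alpha> \<beta>\<close>, where \<open>\<alpha>\<close> and
  \<open>\<beta>\<close> are pairs of a node and a basis index. All brackets can be computed as if the nodes had
  dimension one, followed by a summation over the indices of a node. The indices of one node share
  their time; this matters only for the bracket of a quartic with a quadratic term of another part,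
  where the terms between two indices of one node cancel by antisymmetry.

  In homogeneous coordinates \<open>(x : y)\<close> of the reading, with \<open>\<infinity> = (1 : 0)\<close>, the inverse of \<open>\<phi>\<close> is the
  determinant \<open>u \<alpha> \<beta> = x \<alpha> * y \<beta> - x \<beta> * y \<alpha>\<close>. This treats degenerate and generic readings alike:
  the scalar identities follow from the Pluecker relation between these determinants and from one
  relation for the coefficients \<open>kap\<close> with which the time of the node itself enters its quadratic
  term.

  For \<open>\<alpha>\<close> and \<open>\<beta>\<close> in one part, the elements \<open>E \<alpha> \<beta> = \<Sum>\<eta>. \<phi> \<alpha> \<eta> * b \<alpha> \<eta> * b \<eta> \<beta>\<close> are the quantum
  moment map of the general linear group of that part. The prescribed order of the degenerate
  4-cycles is the one for which the 4-cycles between two indices \<open>\<alpha>\<close> and \<open>\<mu>\<close> of a part add up, apart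
  from a constant, to \<open>\<Omega> \<alpha> \<mu> = E \<alpha> \<mu> * E \<mu> \<alpha> - E \<mu> \<mu>\<close>. This is symmetric in \<open>\<alpha>\<close> and \<open>\<mu>\<close>, and satisfies
  the infinitesimal braid relations, as in the Casimir connection. The 3-cycles through \<open>\<alpha>\<close> add up
  to the diagonal entry \<open>G \<alpha>\<close> of a family on which the \<open>E\<close>'s act as on matrix units. The 2-cycles are,
  apart from constants, the elements \<open>N \<alpha> \<beta> = b \<alpha> \<beta> * b \<beta> \<alpha>\<close>, which act on words by weights.

  Now consider the commutator of two Hamiltonians, one power of \<open>\<hbar>\<close> at a time. In degree 4, the
  elements \<open>N\<close> commute. In degree 5, the weights of the 3-cycles through two indices cancel
  (\<open>br_h2_G\<close>). In degree 7, \<open>\<Omega> \<alpha> \<mu>\<close> commutes with \<open>G \<alpha> + G \<mu>\<close> and with all other \<open>G \<gamma>\<close>, by equivariance.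
  In degree 8, the braid relations and partial fractions give zero. In degree 6, the bracket of two
  cubic terms has to cancel the brackets of the quartic with the quadratic terms; this is
  \<open>br_G_G_same_part\<close> for indices in one part and \<open>br_G_G_other_part\<close> for indices in different
  parts. Both are exact identities, without terms of lower order. Finally, the mixed partial
  derivatives agree because \<open>\<Omega>\<close> and \<open>\<phi>\<^sup>2\<close> are symmetric.

  The Weyl algebra is a quotient by an ideal that depends on the parts, the dimensions and the
  reading. In order to calculate in it with the rules for the type class of rings, it is embedded
  into the product of all complex algebras whose elements have the same type.
\<close>

section \<open>Commutators in complex algebras\<close>

definition br :: "'r::ring \<Rightarrow> 'r \<Rightarrow> 'r" where
  "br x y = x * y - y * x"

lemma br_mult_right: "br x (y * z) = br x y * z + y * br x z"
  by (simp add: br_def algebra_simps)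

lemma br_mult_left: "br (x * y) z = x * br y z + br x z * y"
  by (simp add: br_def algebra_simps)

lemma br_add_right: "br x (y + z) = br x y + br x z"
  and br_add_left: "br (x + y) z = br x z + br y z"
  and br_diff_right: "br x (y - z) = br x y - br x z"
  and br_diff_left: "br (x - y) z = br x z - br y z"
  and br_minus_right: "br x (- y) = - br x y"
  and br_minus_left: "br (- x) y = - br x y"
  and br_zero_right [simp]: "br x 0 = 0"
  and br_zero_left [simp]: "br 0 x = 0"
  and br_self [simp]: "br x x = 0"
  by (simp_all add: br_def algebra_simps)

lemma br_swap: "br x y = - br y x"
  by (simp add: br_def)

lemma br_sum_right: "br x (\<Sum>i\<in>S. g i) = (\<Sum>i\<in>S. br x (g i))"
  and br_sum_left: "br (\<Sum>i\<in>S. g i) x = (\<Sum>i\<in>S. br (g i) x)"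
  by (simp_all add: br_def sum_distrib_left sum_distrib_right sum_subtractf)

lemma br_eq_zero_iff: "br x y = 0 \<longleftrightarrow> x * y = y * x"
  by (simp add: br_def)

text \<open>
  Complex algebras, possibly without a unit: the Weyl algebra will be one factor of a product of
  algebras, and it does not contain the unit of the product.
\<close>

locale complex_ring = vector_space scale
  for scale :: "complex \<Rightarrow> 'r::ring \<Rightarrow> 'r" (infixr \<open>\<odot>\<close> 75) +
  assumes scale_mult_left [simp]: "(c \<odot> X) * Y = c \<odot> (X * Y)"
    and scale_mult_right [simp]: "X * (c \<odot> Y) = c \<odot> (X * Y)"
begin

lemma br_scale_right [simp]: "br X (c \<odot> Y) = c \<odot> br X Y"
  and br_scale_left [simp]: "br (c \<odot> X) Y = c \<odot> br X Y"
  by (simp_all add: br_def scale_right_diff_distrib)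

lemmas word_simps = sum_distrib_left sum_distrib_right scale_sum_right mult.assoc

end

section \<open>Weyl algebra relations in homogeneous coordinates\<close>

text \<open>
  The relations of the matrix entries: \<open>K\<close> is the set of indices, \<open>(x P : y P)\<close> is the reading of the
  part \<open>P\<close>, and the idempotent \<open>e\<close> is the unit of the Weyl algebra inside the ring.
\<close>

locale weyl_relations = complex_ring scale
  for scale :: "complex \<Rightarrow> 'r::ring \<Rightarrow> 'r" (infixr \<open>\<odot>\<close> 75) +
  fixes K :: "'k set"
    and part :: "'k \<Rightarrow> 'j"
    and x y :: "'j \<Rightarrow> complex"
    and b :: "'k \<Rightarrow> 'k \<Rightarrow> 'r"
    and e :: 'r
  assumes finite_K [simp]: "finite K"
    and x_y_independent: "P \<noteq> Q \<Longrightarrow> x P * y Q \<noteq> x Q * y P"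
    and b_same_part: "part \<alpha> = part \<beta> \<Longrightarrow> b \<alpha> \<beta> = 0"
    and e_b [simp]: "e * b \<alpha> \<beta> = b \<alpha> \<beta>"
    and b_e [simp]: "b \<alpha> \<beta> * e = b \<alpha> \<beta>"
    and br_b: "\<lbrakk>\<alpha> \<in> K; \<beta> \<in> K; \<gamma> \<in> K; \<delta> \<in> K\<rbrakk> \<Longrightarrow> br (b \<alpha> \<beta>) (b \<gamma> \<delta>) =
      (if \<alpha> = \<delta> \<and> \<beta> = \<gamma> then (x (part \<alpha>) * y (part \<beta>) - x (part \<beta>) * y (part \<alpha>)) \<odot> e else 0)"
begin

definition u :: "'k \<Rightarrow> 'k \<Rightarrow> complex" where
  "u \<alpha> \<beta> = x (part \<alpha>) * y (part \<beta>) - x (part \<beta>) * y (part \<alpha>)"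

text \<open>
  The function \<open>\<phi>\<close>, extended by zero to pairs of indices in the same part.
\<close>

definition f :: "'k \<Rightarrow> 'k \<Rightarrow> complex" where
  "f \<alpha> \<beta> = inverse (u \<alpha> \<beta>)"

lemma u_swap: "u \<alpha> \<beta> = - u \<beta> \<alpha>"
  by (simp add: u_def)

lemma f_swap: "f \<alpha> \<beta> = - f \<beta> \<alpha>"
  unfolding f_def by (subst u_swap) simp

lemma u_cong: "part \<alpha> = part \<alpha>' \<Longrightarrow> part \<beta> = part \<beta>' \<Longrightarrow> u \<alpha> \<beta> = u \<alpha>' \<beta>'"
  by (simp add: u_def)

lemma f_cong: "part \<alpha> = part \<alpha>' \<Longrightarrow> part \<beta> = part \<beta>' \<Longrightarrow> f \<alpha> \<beta> = f \<alpha>' \<beta>'"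
  unfolding f_def using u_cong by metis

lemma u_eq_0_iff [simp]: "u \<alpha> \<beta> = 0 \<longleftrightarrow> part \<alpha> = part \<beta>"
  unfolding u_def using x_y_independent by auto

lemma f_eq_0_iff [simp]: "f \<alpha> \<beta> = 0 \<longleftrightarrow> part \<alpha> = part \<beta>"
  by (simp add: f_def)

lemma f_u [simp]: "part \<alpha> \<noteq> part \<beta> \<Longrightarrow> f \<alpha> \<beta> * u \<alpha> \<beta> = 1"
  by (simp add: f_def)

lemma f_u_swap [simp]: "part \<alpha> \<noteq> part \<beta> \<Longrightarrow> f \<alpha> \<beta> * u \<beta> \<alpha> = - 1"
  by (subst u_swap) simp

lemma u_same [simp]: "u \<alpha> \<alpha> = 0" and f_same [simp]: "f \<alpha> \<alpha> = 0"
  by simp_all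

lemma b_same [simp]: "b \<alpha> \<alpha> = 0"
  by (simp add: b_same_part)

lemma e_b' [simp]: "e * (b \<alpha> \<beta> * X) = b \<alpha> \<beta> * X"
  by (simp add: mult.assoc [symmetric])

lemma b_e' [simp]: "b \<alpha> \<beta> * (e * X) = b \<alpha> \<beta> * X"
  by (simp add: mult.assoc [symmetric])

lemma plucker: "u \<alpha> \<beta> * u \<eta> \<xi> - u \<alpha> \<eta> * u \<beta> \<xi> + u \<alpha> \<xi> * u \<beta> \<eta> = 0"
  by (simp add: u_def algebra_simps)

lemma br_b_u: "\<lbrakk>\<alpha> \<in> K; \<beta> \<in> K; \<gamma> \<in> K; \<delta> \<in> K\<rbrakk> \<Longrightarrow>
    br (b \<alpha> \<beta>) (b \<gamma> \<delta>) = (if \<alpha> = \<delta> \<and> \<beta> = \<gamma> then u \<alpha> \<beta> \<odot> e else 0)"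
  by (simp add: br_b u_def)

lemma b_commute: "\<lbrakk>\<alpha> \<in> K; \<beta> \<in> K; \<gamma> \<in> K; \<delta> \<in> K; \<not> (\<alpha> = \<delta> \<and> \<beta> = \<gamma>)\<rbrakk> \<Longrightarrow>
    b \<alpha> \<beta> * b \<gamma> \<delta> = b \<gamma> \<delta> * b \<alpha> \<beta>"
  using br_b_u [of \<alpha> \<beta> \<gamma> \<delta>] by (simp add: br_eq_zero_iff split: if_splits)

lemma b_commute': "\<lbrakk>\<alpha> \<in> K; \<beta> \<in> K; \<gamma> \<in> K; \<delta> \<in> K; \<not> (\<alpha> = \<delta> \<and> \<beta> = \<gamma>)\<rbrakk> \<Longrightarrow>
    b \<alpha> \<beta> * (b \<gamma> \<delta> * X) = b \<gamma> \<delta> * (b \<alpha> \<beta> * X)"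
  using b_commute [of \<alpha> \<beta> \<gamma> \<delta>] by (simp add: mult.assoc [symmetric])

section \<open>The moment map of a part\<close>

definition E :: "'k \<Rightarrow> 'k \<Rightarrow> 'r" where
  "E \<alpha> \<beta> = (\<Sum>\<eta>\<in>K. f \<alpha> \<eta> \<odot> (b \<alpha> \<eta> * b \<eta> \<beta>))"

lemma e_E [simp]: "e * E \<alpha> \<beta> = E \<alpha> \<beta>" and E_e [simp]: "E \<alpha> \<beta> * e = E \<alpha> \<beta>"
  by (simp_all add: E_def word_simps)

text \<open>
  The family \<open>Z\<close> transforms like matrix units under the adjoint action of the \<open>E\<close>'s of every part. If
  \<open>\<gamma>\<close> and \<open>\<delta>\<close> lie outside of the part of \<open>\<alpha>\<close> and \<open>\<beta>\<close>, the right-hand side vanishes.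
\<close>

definition equivariant :: "('k \<Rightarrow> 'k \<Rightarrow> 'r) \<Rightarrow> bool" where
  "equivariant Z \<longleftrightarrow> (\<forall>\<alpha>\<in>K. \<forall>\<beta>\<in>K. \<forall>\<gamma>\<in>K. \<forall>\<delta>\<in>K. part \<alpha> = part \<beta> \<longrightarrow>
     br (E \<alpha> \<beta>) (Z \<gamma> \<delta>) = (if \<alpha> = \<delta> then Z \<gamma> \<beta> else 0) - (if \<beta> = \<gamma> then Z \<alpha> \<delta> else 0))"

lemma equivariantD:
  "\<lbrakk>equivariant Z; \<alpha> \<in> K; \<beta> \<in> K; \<gamma> \<in> K; \<delta> \<in> K; part \<alpha> = part \<beta>\<rbrakk> \<Longrightarrow>
     br (E \<alpha> \<beta>) (Z \<gamma> \<delta>) = (if \<alpha> = \<delta> then Z \<gamma> \<beta> else 0) - (if \<beta> = \<gamma> then Z \<alpha> \<delta> else 0)"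
  unfolding equivariant_def by blast

text \<open>
  The two contractions of \<open>E \<alpha> \<beta>\<close> with \<open>b \<gamma> \<delta>\<close> carry the factors \<open>\<phi> * u\<close>, which are \<open>1\<close> and \<open>- 1\<close>.
\<close>

lemma equivariant_b: "equivariant b"
  unfolding equivariant_def
proof (intro ballI impI)
  fix \<alpha> \<beta> \<gamma> \<delta> assume K: "\<alpha> \<in> K" "\<beta> \<in> K" "\<gamma> \<in> K" "\<delta> \<in> K" and part: "part \<alpha> = part \<beta>"
  have "br (E \<alpha> \<beta>) (b \<gamma> \<delta>) = (\<Sum>\<eta>\<in>K. f \<alpha> \<eta> \<odot> (b \<alpha> \<eta> * br (b \<eta> \<beta>) (b \<gamma> \<delta>) + br (b \<alpha> \<eta>) (b \<gamma> \<delta>) * b \<eta> \<beta>))"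
    by (simp add: E_def br_sum_left br_mult_left)
  also have "\<dots> = (\<Sum>\<eta>\<in>K. (if \<eta> = \<delta> then if \<beta> = \<gamma> then (f \<alpha> \<delta> * u \<delta> \<beta>) \<odot> b \<alpha> \<delta> else 0 else 0)
      + (if \<eta> = \<gamma> then if \<alpha> = \<delta> then (f \<alpha> \<gamma> * u \<alpha> \<gamma>) \<odot> b \<gamma> \<beta> else 0 else 0))"
    using K by (intro sum.cong refl) (auto simp: br_b_u scale_right_distrib)
  also have "\<dots> = (if \<beta> = \<gamma> then (f \<alpha> \<delta> * u \<delta> \<beta>) \<odot> b \<alpha> \<delta> else 0) + (if \<alpha> = \<delta> then (f \<alpha> \<gamma> * u \<alpha> \<gamma>) \<odot> b \<gamma> \<beta> else 0)"
    using K by (simp add: sum.distrib)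
  also have "(f \<alpha> \<gamma> * u \<alpha> \<gamma>) \<odot> b \<gamma> \<beta> = b \<gamma> \<beta>"
    using part by (cases "part \<alpha> = part \<gamma>") (auto simp: b_same_part)
  also have "(f \<alpha> \<delta> * u \<delta> \<beta>) \<odot> b \<alpha> \<delta> = - b \<alpha> \<delta>"
    unfolding u_cong [OF refl part [symmetric], of \<delta>]
    by (cases "part \<alpha> = part \<delta>") (simp_all add: b_same_part)
  finally show "br (E \<alpha> \<beta>) (b \<gamma> \<delta>) = (if \<alpha> = \<delta> then b \<gamma> \<beta> else 0) - (if \<beta> = \<gamma> then b \<alpha> \<delta> else 0)"
    by (auto split: if_splits)
qed

lemmas br_E_b = equivariantD [OF equivariant_b]

text \<open>
  A weight \<open>g\<close> that depends only on the parts commutes with the action, so the boundary terms at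
  \<open>\<eta> = \<alpha>\<close> and \<open>\<eta> = \<beta>\<close> cancel.
\<close>

lemma equivariant_product:
  assumes Z: "equivariant Z" and Z': "equivariant Z'"
    and g: "\<And>\<gamma> \<eta> \<delta> \<gamma>' \<eta>' \<delta>'. part \<gamma> = part \<gamma>' \<Longrightarrow> part \<eta> = part \<eta>' \<Longrightarrow> part \<delta> = part \<delta>' \<Longrightarrow> g \<gamma> \<eta> \<delta> = g \<gamma>' \<eta>' \<delta>'"
  shows "equivariant (\<lambda>\<gamma> \<delta>. \<Sum>\<eta>\<in>K. g \<gamma> \<eta> \<delta> \<odot> (Z \<gamma> \<eta> * Z' \<eta> \<delta>))"
  unfolding equivariant_def
proof (intro ballI impI)
  fix \<alpha> \<beta> \<gamma> \<delta> assume K: "\<alpha> \<in> K" "\<beta> \<in> K" "\<gamma> \<in> K" "\<delta> \<in> K" and part: "part \<alpha> = part \<beta>"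
  have "br (E \<alpha> \<beta>) (\<Sum>\<eta>\<in>K. g \<gamma> \<eta> \<delta> \<odot> (Z \<gamma> \<eta> * Z' \<eta> \<delta>))
      = (\<Sum>\<eta>\<in>K. (if \<eta> = \<alpha> then g \<gamma> \<alpha> \<delta> \<odot> (Z \<gamma> \<beta> * Z' \<alpha> \<delta>) else 0)
          - (if \<eta> = \<beta> then g \<gamma> \<beta> \<delta> \<odot> (Z \<gamma> \<beta> * Z' \<alpha> \<delta>) else 0)
          + (if \<alpha> = \<delta> then g \<gamma> \<eta> \<delta> \<odot> (Z \<gamma> \<eta> * Z' \<eta> \<beta>) else 0)
          - (if \<beta> = \<gamma> then g \<gamma> \<eta> \<delta> \<odot> (Z \<alpha> \<eta> * Z' \<eta> \<delta>) else 0))"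
    unfolding br_sum_right
    by (intro sum.cong refl)
       (use K part in \<open>auto simp: br_mult_right equivariantD [OF Z] equivariantD [OF Z'] left_diff_distrib right_diff_distrib scale_right_diff_distrib scale_right_distrib\<close>)
  also have "\<dots> = (if \<alpha> = \<delta> then \<Sum>\<eta>\<in>K. g \<gamma> \<eta> \<delta> \<odot> (Z \<gamma> \<eta> * Z' \<eta> \<beta>) else 0)
          - (if \<beta> = \<gamma> then \<Sum>\<eta>\<in>K. g \<gamma> \<eta> \<delta> \<odot> (Z \<alpha> \<eta> * Z' \<eta> \<delta>) else 0)"
    using K g [OF refl part refl, of \<gamma> \<delta>] by (simp add: sum.distrib sum_subtractf)
  also have "\<dots> = (if \<alpha> = \<delta> then \<Sum>\<eta>\<in>K. g \<gamma> \<eta> \<beta> \<odot> (Z \<gamma> \<eta> * Z' \<eta> \<beta>) else 0)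
          - (if \<beta> = \<gamma> then \<Sum>\<eta>\<in>K. g \<alpha> \<eta> \<delta> \<odot> (Z \<alpha> \<eta> * Z' \<eta> \<delta>) else 0)"
    using part by (intro arg_cong2 [where f = "(-)"] if_cong refl sum.cong arg_cong2 [where f = "(\<odot>)"] g) auto
  finally show "br (E \<alpha> \<beta>) (\<Sum>\<eta>\<in>K. g \<gamma> \<eta> \<delta> \<odot> (Z \<gamma> \<eta> * Z' \<eta> \<delta>)) = \<dots>" .
qed

lemma equivariant_E: "equivariant E"
  using equivariant_product [OF equivariant_b equivariant_b, of "\<lambda>\<gamma> \<eta> \<delta>. f \<gamma> \<eta>"] f_cong
  unfolding E_def [abs_def] by blast

lemmas br_E_E = equivariantD [OF equivariant_E]

definition R :: "'k \<Rightarrow> 'k \<Rightarrow> 'r" where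
  "R \<gamma> \<alpha> = (\<Sum>\<xi>\<in>K. f \<xi> \<alpha> \<odot> (b \<gamma> \<xi> * b \<xi> \<alpha>))"

lemma equivariant_R: "equivariant R"
  using equivariant_product [OF equivariant_b equivariant_b, of "\<lambda>\<gamma> \<eta> \<delta>. f \<eta> \<delta>"] f_cong
  unfolding R_def [abs_def] by blast

text \<open>
  Words through two intermediate indices; the diagonal entries are the sums of all quantised 3-cycles
  through an index.
\<close>

definition S :: "'k \<Rightarrow> 'k \<Rightarrow> 'r" where
  "S \<gamma> \<delta> = (\<Sum>\<eta>\<in>K. f \<gamma> \<eta> \<odot> (b \<gamma> \<eta> * R \<eta> \<delta>))"

lemma equivariant_S: "equivariant S"
  using equivariant_product [OF equivariant_b equivariant_R, of "\<lambda>\<gamma> \<eta> \<delta>. f \<gamma> \<eta>"] f_cong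
  unfolding S_def [abs_def] by blast

abbreviation G :: "'k \<Rightarrow> 'r" where
  "G \<alpha> \<equiv> S \<alpha> \<alpha>"

lemma G_eq: "G \<alpha> = (\<Sum>\<eta>\<in>K. \<Sum>\<xi>\<in>K. (f \<alpha> \<eta> * f \<xi> \<alpha>) \<odot> (b \<alpha> \<eta> * b \<eta> \<xi> * b \<xi> \<alpha>))"
  by (simp add: S_def R_def word_simps)

text \<open>
  The correction \<open>E \<mu> \<mu>\<close> makes the product symmetric, since \<open>E \<alpha> \<mu>\<close> and \<open>E \<mu> \<alpha>\<close> have the commutator
  \<open>E \<mu> \<mu> - E \<alpha> \<alpha>\<close>.
\<close>

definition \<Omega> :: "'k \<Rightarrow> 'k \<Rightarrow> 'r" where
  "\<Omega> \<alpha> \<mu> = E \<alpha> \<mu> * E \<mu> \<alpha> - E \<mu> \<mu>"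

lemma \<Omega>_swap:
  assumes "\<alpha> \<in> K" "\<mu> \<in> K" "part \<alpha> = part \<mu>"
  shows "\<Omega> \<alpha> \<mu> = \<Omega> \<mu> \<alpha>"
  using equivariantD [OF equivariant_E, of \<alpha> \<mu> \<mu> \<alpha>] assms
  by (simp add: \<Omega>_def br_def algebra_simps)

lemma br_\<Omega>: "br (\<Omega> \<alpha> \<mu>) X = E \<alpha> \<mu> * br (E \<mu> \<alpha>) X + br (E \<alpha> \<mu>) X * E \<mu> \<alpha> - br (E \<mu> \<mu>) X"
  by (simp add: \<Omega>_def br_diff_left br_mult_left)

lemma br_\<Omega>_diagonal:
  assumes Z: "equivariant Z" and K: "\<alpha> \<in> K" "\<mu> \<in> K" "\<gamma> \<in> K" and part: "part \<alpha> = part \<mu>"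
  shows br_\<Omega>_diagonal_other: "\<gamma> \<noteq> \<alpha> \<Longrightarrow> \<gamma> \<noteq> \<mu> \<Longrightarrow> br (\<Omega> \<alpha> \<mu>) (Z \<gamma> \<gamma>) = 0"
    and br_\<Omega>_diagonal_pair: "\<alpha> \<noteq> \<mu> \<Longrightarrow> br (\<Omega> \<alpha> \<mu>) (Z \<alpha> \<alpha> + Z \<mu> \<mu>) = 0"
  using K part by (simp_all add: br_\<Omega> br_add_right equivariantD [OF Z])

lemma br_\<Omega>_\<Omega>_other_part:
  assumes "\<alpha> \<in> K" "\<mu> \<in> K" "\<beta> \<in> K" "\<nu> \<in> K" "part \<alpha> = part \<mu>" "part \<beta> = part \<nu>"
    and "\<alpha> \<notin> {\<beta>, \<nu>}" "\<mu> \<notin> {\<beta>, \<nu>}"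
  shows "br (\<Omega> \<alpha> \<mu>) (\<Omega> \<beta> \<nu>) = 0"
proof -
  have "br (E \<gamma> \<delta>) (\<Omega> \<beta> \<nu>) = 0" if "\<gamma> \<in> {\<alpha>, \<mu>}" "\<delta> \<in> {\<alpha>, \<mu>}" for \<gamma> \<delta>
    using that assms by (auto simp: \<Omega>_def br_diff_right br_mult_right br_E_E)
  then show ?thesis by (simp add: br_\<Omega>)
qed

text \<open>
  The infinitesimal braid relation: \<open>E \<alpha> \<gamma> * E \<gamma> \<alpha> + E \<beta> \<gamma> * E \<gamma> \<beta>\<close> is invariant under the general linear
  algebra spanned by the \<open>E\<close>'s with indices \<open>\<alpha>\<close> and \<open>\<beta>\<close>, in which \<open>\<Omega> \<alpha> \<beta>\<close> is a polynomial.
\<close>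

lemma br_\<Omega>_\<Omega>_triple:
  assumes "\<alpha> \<in> K" "\<beta> \<in> K" "\<gamma> \<in> K" "part \<alpha> = part \<beta>" "part \<beta> = part \<gamma>"
    and "\<alpha> \<noteq> \<beta>" "\<alpha> \<noteq> \<gamma>" "\<beta> \<noteq> \<gamma>"
  shows "br (\<Omega> \<alpha> \<beta>) (\<Omega> \<alpha> \<gamma> + \<Omega> \<beta> \<gamma>) = 0"
proof -
  have "br (E \<eta> \<xi>) (\<Omega> \<alpha> \<gamma> + \<Omega> \<beta> \<gamma>) = 0" if "\<eta> \<in> {\<alpha>, \<beta>}" "\<xi> \<in> {\<alpha>, \<beta>}" for \<eta> \<xi>
    using that assms
    by (auto simp: \<Omega>_def br_diff_right br_add_right br_mult_right br_E_E)
  then show ?thesis by (simp add: br_\<Omega>)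
qed


section \<open>Derivations given by 3-cycles and 2-cycles\<close>

lemmas complex_ac = mult.assoc [where 'a = complex] mult.commute [where 'a = complex]
  mult.left_commute [where 'a = complex]

lemma R_eq_minus_E: "part \<gamma> = part \<delta> \<Longrightarrow> R \<gamma> \<delta> = - E \<gamma> \<delta>"
  unfolding R_def E_def sum_negf [symmetric]
  by (intro sum.cong refl) (metis f_cong f_swap scale_minus_left)

lemma br_b_b_b:
  assumes "\<alpha> \<in> K" "\<eta> \<in> K" "\<xi> \<in> K" "\<gamma> \<in> K" "\<delta> \<in> K"
  shows "br (b \<alpha> \<eta> * b \<eta> \<xi> * b \<xi> \<alpha>) (b \<gamma> \<delta>) =
      (if \<eta> = \<gamma> then if \<delta> = \<alpha> then u \<alpha> \<gamma> \<odot> (b \<gamma> \<xi> * b \<xi> \<alpha>) else 0 else 0)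
    + (if \<xi> = \<gamma> then if \<eta> = \<delta> then u \<delta> \<gamma> \<odot> (b \<alpha> \<delta> * b \<gamma> \<alpha>) else 0 else 0)
    + (if \<xi> = \<delta> then if \<gamma> = \<alpha> then u \<delta> \<alpha> \<odot> (b \<alpha> \<eta> * b \<eta> \<delta>) else 0 else 0)"
  using assms by (auto simp: br_mult_left br_b_u word_simps)

text \<open>
  The derivation given by the 3-cycles through \<open>\<alpha>\<close>: contracting the first or the last arrow leaves a
  sum over the remaining index, and contracting the middle arrow leaves a single word.
\<close>

lemma br_G_b:
  assumes K: "\<alpha> \<in> K" "\<gamma> \<in> K" "\<delta> \<in> K"
  shows "br (G \<alpha>) (b \<gamma> \<delta>) = (if part \<gamma> = part \<delta> then 0 else
      (if \<delta> = \<alpha> then R \<gamma> \<alpha> else 0)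
    + (f \<alpha> \<delta> * f \<gamma> \<alpha> * u \<delta> \<gamma>) \<odot> (b \<alpha> \<delta> * b \<gamma> \<alpha>)
    + (if \<gamma> = \<alpha> then E \<alpha> \<delta> else 0))"
proof (cases "part \<gamma> = part \<delta>")
  case False
  have "br (G \<alpha>) (b \<gamma> \<delta>) = (\<Sum>\<eta>\<in>K. \<Sum>\<xi>\<in>K.
      (if \<eta> = \<gamma> then if \<delta> = \<alpha> then (f \<alpha> \<gamma> * u \<alpha> \<gamma> * f \<xi> \<alpha>) \<odot> (b \<gamma> \<xi> * b \<xi> \<alpha>) else 0 else 0)
    + (if \<xi> = \<gamma> then if \<eta> = \<delta> then (f \<alpha> \<delta> * f \<gamma> \<alpha> * u \<delta> \<gamma>) \<odot> (b \<alpha> \<delta> * b \<gamma> \<alpha>) else 0 else 0)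
    + (if \<xi> = \<delta> then if \<gamma> = \<alpha> then (f \<alpha> \<eta> * (f \<delta> \<alpha> * u \<delta> \<alpha>)) \<odot> (b \<alpha> \<eta> * b \<eta> \<delta>) else 0 else 0))"
    unfolding G_eq br_sum_left br_scale_left using K
    by (intro sum.cong refl) (auto simp: br_b_b_b scale_right_distrib complex_ac)
  also have "\<dots> = (if \<delta> = \<alpha> then \<Sum>\<xi>\<in>K. (f \<alpha> \<gamma> * u \<alpha> \<gamma> * f \<xi> \<alpha>) \<odot> (b \<gamma> \<xi> * b \<xi> \<alpha>) else 0)
    + (f \<alpha> \<delta> * f \<gamma> \<alpha> * u \<delta> \<gamma>) \<odot> (b \<alpha> \<delta> * b \<gamma> \<alpha>)
    + (if \<gamma> = \<alpha> then \<Sum>\<eta>\<in>K. (f \<alpha> \<eta> * (f \<delta> \<alpha> * u \<delta> \<alpha>)) \<odot> (b \<alpha> \<eta> * b \<eta> \<delta>) else 0)"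
    using K by (simp add: sum.distrib sum.swap [of "\<lambda>\<eta> \<xi>. if \<eta> = \<gamma> then P \<eta> \<xi> else 0" for P])
  also have "\<dots> = (if \<delta> = \<alpha> then R \<gamma> \<alpha> else 0)
    + (f \<alpha> \<delta> * f \<gamma> \<alpha> * u \<delta> \<gamma>) \<odot> (b \<alpha> \<delta> * b \<gamma> \<alpha>)
    + (if \<gamma> = \<alpha> then E \<alpha> \<delta> else 0)"
    using False by (auto simp: R_def E_def)
  finally show ?thesis using False by simp
qed (simp add: b_same_part)

definition N :: "'k \<Rightarrow> 'k \<Rightarrow> 'r" where
  "N \<alpha> \<beta> = b \<alpha> \<beta> * b \<beta> \<alpha>"

lemma N_swap: "\<alpha> \<in> K \<Longrightarrow> \<beta> \<in> K \<Longrightarrow> N \<alpha> \<beta> = N \<beta> \<alpha> + u \<alpha> \<beta> \<odot> e"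
  using br_b_u [of \<alpha> \<beta> \<beta> \<alpha>] by (simp add: N_def br_def algebra_simps)

definition Q :: "('k \<Rightarrow> complex) \<Rightarrow> 'k \<Rightarrow> 'r" where
  "Q c \<alpha> = (\<Sum>\<eta>\<in>K. c \<eta> \<odot> N \<alpha> \<eta>)"

text \<open>
  The eigenvalue of the derivation \<open>br (Q c \<alpha>)\<close> on \<open>b \<gamma> \<delta>\<close>.
\<close>

definition weight :: "('k \<Rightarrow> complex) \<Rightarrow> 'k \<Rightarrow> 'k \<Rightarrow> 'k \<Rightarrow> complex" where
  "weight c \<alpha> \<gamma> \<delta> = u \<delta> \<gamma> * ((if \<gamma> = \<alpha> then c \<delta> else 0) + (if \<delta> = \<alpha> then c \<gamma> else 0))"

lemma weight_swap: "weight c \<alpha> \<gamma> \<delta> = - weight c \<alpha> \<delta> \<gamma>"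
  unfolding weight_def by (subst u_swap) (simp add: algebra_simps)

lemma br_Q_b:
  assumes K: "\<alpha> \<in> K" "\<gamma> \<in> K" "\<delta> \<in> K"
  shows "br (Q c \<alpha>) (b \<gamma> \<delta>) = weight c \<alpha> \<gamma> \<delta> \<odot> b \<gamma> \<delta>"
proof -
  have "br (Q c \<alpha>) (b \<gamma> \<delta>) = (\<Sum>\<eta>\<in>K.
      (if \<eta> = \<delta> then if \<gamma> = \<alpha> then (c \<delta> * u \<delta> \<alpha>) \<odot> b \<alpha> \<delta> else 0 else 0)
    + (if \<eta> = \<gamma> then if \<delta> = \<alpha> then (c \<gamma> * u \<alpha> \<gamma>) \<odot> b \<gamma> \<alpha> else 0 else 0))"
    unfolding Q_def N_def br_sum_left br_scale_left br_mult_left using K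
    by (intro sum.cong refl) (auto simp: br_b_u scale_right_distrib)
  also have "\<dots> = (if \<gamma> = \<alpha> then (c \<delta> * u \<delta> \<alpha>) \<odot> b \<alpha> \<delta> else 0) + (if \<delta> = \<alpha> then (c \<gamma> * u \<alpha> \<gamma>) \<odot> b \<gamma> \<alpha> else 0)"
    using K by (simp add: sum.distrib)
  also have "\<dots> = weight c \<alpha> \<gamma> \<delta> \<odot> b \<gamma> \<delta>"
    by (auto simp: weight_def algebra_simps)
  finally show ?thesis .
qed

lemma br_Q_N: "\<lbrakk>\<alpha> \<in> K; \<gamma> \<in> K; \<delta> \<in> K\<rbrakk> \<Longrightarrow> br (Q c \<alpha>) (N \<gamma> \<delta>) = 0"
  by (simp add: N_def br_mult_right br_Q_b weight_swap [of c \<alpha> \<delta> \<gamma>] scale_left_distrib [symmetric] del: scale_minus_left)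

lemma br_Q_Q: "\<lbrakk>\<alpha> \<in> K; \<beta> \<in> K\<rbrakk> \<Longrightarrow> br (Q c \<alpha>) (Q c' \<beta>) = 0"
  unfolding Q_def [of c'] by (simp add: br_sum_right br_Q_N)

text \<open>
  Only the 3-cycles through both \<open>\<alpha>\<close> and \<open>\<beta>\<close> have a nonzero weight; the first sum contains those along
  the arrow from \<open>\<alpha>\<close> to \<open>\<beta>\<close>, the second one those along the arrow from \<open>\<beta>\<close> to \<open>\<alpha>\<close>.
\<close>

lemma br_Q_G:
  assumes K: "\<alpha> \<in> K" "\<beta> \<in> K" and "\<alpha> \<noteq> \<beta>"
  shows "br (Q c \<alpha>) (G \<beta>) =
     (\<Sum>\<xi>\<in>K. (f \<beta> \<alpha> * f \<xi> \<beta> * (u \<alpha> \<beta> * c \<beta> + u \<xi> \<alpha> * c \<xi>)) \<odot> (b \<beta> \<alpha> * b \<alpha> \<xi> * b \<xi> \<beta>))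
   + (\<Sum>\<eta>\<in>K. (f \<beta> \<eta> * f \<alpha> \<beta> * (u \<alpha> \<eta> * c \<eta> + u \<beta> \<alpha> * c \<beta>)) \<odot> (b \<beta> \<eta> * b \<eta> \<alpha> * b \<alpha> \<beta>))"
  (is "_ = ?S1 + ?S2")
proof -
  have "br (Q c \<alpha>) (G \<beta>) = (\<Sum>\<eta>\<in>K. \<Sum>\<xi>\<in>K. (f \<beta> \<eta> * f \<xi> \<beta> *
      (weight c \<alpha> \<beta> \<eta> + weight c \<alpha> \<eta> \<xi> + weight c \<alpha> \<xi> \<beta>)) \<odot> (b \<beta> \<eta> * b \<eta> \<xi> * b \<xi> \<beta>))"
    unfolding G_eq br_sum_right br_scale_right using K
    by (intro sum.cong refl) (simp add: br_mult_right br_Q_b word_simps algebra_simps scale_left_distrib)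
  also have "\<dots> = (\<Sum>\<eta>\<in>K. \<Sum>\<xi>\<in>K.
      (if \<eta> = \<alpha> then (f \<beta> \<alpha> * f \<xi> \<beta> * (u \<alpha> \<beta> * c \<beta> + u \<xi> \<alpha> * c \<xi>)) \<odot> (b \<beta> \<alpha> * b \<alpha> \<xi> * b \<xi> \<beta>) else 0)
    + (if \<xi> = \<alpha> then (f \<beta> \<eta> * f \<alpha> \<beta> * (u \<alpha> \<eta> * c \<eta> + u \<beta> \<alpha> * c \<beta>)) \<odot> (b \<beta> \<eta> * b \<eta> \<alpha> * b \<alpha> \<beta>) else 0))"
    using \<open>\<alpha> \<noteq> \<beta>\<close> by (intro sum.cong refl) (auto simp: weight_def)
  also have "\<dots> = ?S1 + ?S2"
    using K by (simp add: sum.distrib sum.swap [of "\<lambda>\<eta> \<xi>. if \<eta> = \<gamma> then P \<eta> \<xi> else 0" for P \<gamma>])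
  finally show ?thesis .
qed

text \<open>
  The sum of \<open>N \<alpha> \<eta>\<close> and \<open>N \<mu> \<eta>\<close> is a trace over the pair \<open>\<alpha>, \<mu>\<close>, hence invariant under the \<open>E\<close>'s of
  this pair.
\<close>

lemma br_\<Omega>_N_pair:
  assumes K: "\<alpha> \<in> K" "\<mu> \<in> K" "\<eta> \<in> K" and part: "part \<alpha> = part \<mu>" and ne: "\<alpha> \<noteq> \<mu>"
    and other: "part \<eta> \<noteq> part \<alpha>"
  shows "br (\<Omega> \<alpha> \<mu>) (N \<alpha> \<eta> + N \<mu> \<eta>) = 0"
proof -
  have "\<eta> \<noteq> \<alpha>" "\<eta> \<noteq> \<mu>" using other part by auto
  then have "br (E \<gamma> \<delta>) (N \<alpha> \<eta> + N \<mu> \<eta>) = 0" if "\<gamma> \<in> {\<alpha>, \<mu>}" "\<delta> \<in> {\<alpha>, \<mu>}" for \<gamma> \<delta>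
    using that K part ne by (auto simp: N_def br_add_right br_mult_right br_E_b)
  then show ?thesis by (simp add: br_\<Omega>)
qed

lemma br_\<Omega>_N_other:
  assumes K: "\<alpha> \<in> K" "\<mu> \<in> K" "\<beta> \<in> K" "\<eta> \<in> K" and part: "part \<alpha> = part \<mu>"
    and "\<beta> \<notin> {\<alpha>, \<mu>}" "\<eta> \<notin> {\<alpha>, \<mu>}"
  shows "br (\<Omega> \<alpha> \<mu>) (N \<beta> \<eta>) = 0"
proof -
  have "br (E \<gamma> \<delta>) (N \<beta> \<eta>) = 0" if "\<gamma> \<in> {\<alpha>, \<mu>}" "\<delta> \<in> {\<alpha>, \<mu>}" for \<gamma> \<delta>
    using that assms by (auto simp: N_def br_mult_right br_E_b)
  then show ?thesis by (simp add: br_\<Omega>)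
qed

lemma br_\<Omega>_e: "br (\<Omega> \<alpha> \<mu>) e = 0"
  by (simp add: \<Omega>_def br_def word_simps algebra_simps, simp add: mult.assoc [symmetric])


section \<open>Brackets of 3-cycles through indices in different parts\<close>

definition same_part_sum :: "'k \<Rightarrow> ('k \<Rightarrow> 'r) \<Rightarrow> 'r" where
  "same_part_sum \<alpha> g = (\<Sum>\<mu>\<in>K. if part \<mu> = part \<alpha> \<and> \<mu> \<noteq> \<alpha> then g \<mu> else 0)"

lemma br_\<Omega>_N:
  assumes K: "\<alpha> \<in> K" "\<mu> \<in> K" "\<beta> \<in> K" and part: "part \<alpha> = part \<mu>" "part \<beta> \<noteq> part \<alpha>" and ne: "\<mu> \<noteq> \<alpha>"
  shows "br (\<Omega> \<alpha> \<mu>) (N \<beta> \<alpha>) = b \<beta> \<mu> * E \<mu> \<alpha> * b \<alpha> \<beta> - b \<beta> \<alpha> * E \<alpha> \<mu> * b \<mu> \<beta>"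
    and "br (\<Omega> \<alpha> \<mu>) (N \<alpha> \<beta>) = b \<beta> \<mu> * E \<mu> \<alpha> * b \<alpha> \<beta> - b \<beta> \<alpha> * E \<alpha> \<mu> * b \<mu> \<beta>"
proof -
  have d: "\<beta> \<noteq> \<alpha>" "\<beta> \<noteq> \<mu>" using part by auto
  have "br (E \<alpha> \<mu>) (b \<beta> \<alpha>) = b \<beta> \<mu>" "br (E \<alpha> \<mu>) (b \<alpha> \<beta>) = 0"
    "br (E \<mu> \<alpha>) (b \<beta> \<alpha>) = 0" "br (E \<mu> \<alpha>) (b \<alpha> \<beta>) = - b \<mu> \<beta>"
    "br (E \<mu> \<mu>) (b \<beta> \<alpha>) = 0" "br (E \<mu> \<mu>) (b \<alpha> \<beta>) = 0"
    using K part ne d by (simp_all add: br_E_b)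
  then show *: "br (\<Omega> \<alpha> \<mu>) (N \<beta> \<alpha>) = b \<beta> \<mu> * E \<mu> \<alpha> * b \<alpha> \<beta> - b \<beta> \<alpha> * E \<alpha> \<mu> * b \<mu> \<beta>"
    by (simp add: N_def br_mult_right br_\<Omega> mult.assoc)
  then show "br (\<Omega> \<alpha> \<mu>) (N \<alpha> \<beta>) = b \<beta> \<mu> * E \<mu> \<alpha> * b \<alpha> \<beta> - b \<beta> \<alpha> * E \<alpha> \<mu> * b \<mu> \<beta>"
    using K by (subst N_swap) (simp_all add: br_add_right br_\<Omega>_e)
qed

text \<open>
  The Pluecker relation in terms of \<open>\<phi>\<close>, as it occurs for the 4-cycles \<open>\<alpha> \<xi> \<beta> \<eta>\<close>.
\<close>

lemma scalar_4:
  assumes "part \<alpha> \<noteq> part \<beta>" "part \<eta> \<noteq> part \<alpha>" "part \<eta> \<noteq> part \<beta>" "part \<xi> \<noteq> part \<alpha>" "part \<xi> \<noteq> part \<beta>"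
  shows "f \<beta> \<alpha> * (f \<eta> \<alpha> * f \<xi> \<beta>) + f \<alpha> \<beta> * (f \<beta> \<eta> * f \<alpha> \<xi>) + f \<beta> \<eta> * f \<xi> \<beta> * (f \<alpha> \<xi> * f \<eta> \<alpha> * u \<xi> \<eta>) = 0"
proof -
  have f: "f \<eta> \<alpha> = - f \<alpha> \<eta>" "f \<xi> \<beta> = - f \<beta> \<xi>" "f \<beta> \<alpha> = - f \<alpha> \<beta>"
    by (rule f_swap)+
  have "f \<beta> \<alpha> * (f \<eta> \<alpha> * f \<xi> \<beta>) + f \<alpha> \<beta> * (f \<beta> \<eta> * f \<alpha> \<xi>) + f \<beta> \<eta> * f \<xi> \<beta> * (f \<alpha> \<xi> * f \<eta> \<alpha> * u \<xi> \<eta>)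
      = f \<alpha> \<beta> * f \<alpha> \<eta> * f \<alpha> \<xi> * f \<beta> \<eta> * f \<beta> \<xi> * (u \<alpha> \<beta> * u \<xi> \<eta> - u \<alpha> \<xi> * u \<beta> \<eta> + u \<alpha> \<eta> * u \<beta> \<xi>)"
    unfolding f using assms by (simp add: f_def field_simps)
  then show ?thesis using plucker [of \<alpha> \<beta> \<xi> \<eta>] by simp
qed

text \<open>
  The derivation of \<open>br_G_b\<close> is applied to the words of \<open>G \<beta>\<close>. The 4-cycles in which \<open>\<alpha>\<close> and \<open>\<beta>\<close> are
  opposite cancel by the Pluecker relation. The 4-cycles through an arrow between \<open>\<alpha>\<close> and \<open>\<beta>\<close> occur
  twice with opposite signs, except when the index opposite to \<open>\<alpha>\<close> lies in the part of \<open>\<alpha>\<close>, or the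
  index opposite to \<open>\<beta>\<close> lies in the part of \<open>\<beta>\<close>. In these exceptional words the sum over the fourth
  index is an \<open>E\<close>, and they are the words that \<open>br_\<Omega>_N\<close> produces.
\<close>

lemma br_G_G_other_part:
  assumes K: "\<alpha> \<in> K" "\<beta> \<in> K" and parts: "part \<alpha> \<noteq> part \<beta>"
  shows "br (G \<alpha>) (G \<beta>) = (f \<alpha> \<beta>)\<^sup>2 \<odot>
    (same_part_sum \<beta> (\<lambda>\<gamma>. br (\<Omega> \<beta> \<gamma>) (N \<alpha> \<beta>)) - same_part_sum \<alpha> (\<lambda>\<gamma>. br (\<Omega> \<alpha> \<gamma>) (N \<beta> \<alpha>)))"
proof -
  let ?D2 = "\<Sum>\<eta>\<in>K. if part \<eta> = part \<alpha> then b \<beta> \<eta> * E \<eta> \<alpha> * b \<alpha> \<beta> - b \<beta> \<alpha> * E \<alpha> \<eta> * b \<eta> \<beta> else 0"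
  let ?D1 = "\<Sum>\<eta>\<in>K. if part \<eta> = part \<beta> then b \<beta> \<alpha> * b \<alpha> \<eta> * E \<eta> \<beta> - E \<beta> \<eta> * b \<eta> \<alpha> * b \<alpha> \<beta> else 0"
  let ?P4 = "\<Sum>\<eta>\<in>K. if part \<eta> = part \<alpha> then b \<beta> \<eta> * E \<eta> \<alpha> else 0"
  let ?P3 = "\<Sum>\<xi>\<in>K. if part \<xi> = part \<beta> then E \<beta> \<xi> * b \<xi> \<alpha> else 0"
  let ?P2 = "\<Sum>\<xi>\<in>K. if part \<xi> = part \<alpha> then E \<alpha> \<xi> * b \<xi> \<beta> else 0"
  let ?P1 = "\<Sum>\<eta>\<in>K. if part \<eta> = part \<beta> then b \<alpha> \<eta> * E \<eta> \<beta> else 0"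
  have ne: "\<alpha> \<noteq> \<beta>" using parts by auto
  \<comment> \<open>The terms \<open>A\<close>, \<open>B\<close> and \<open>C\<close> come from the derivation of the first, second and third factor of the
    words in \<open>G \<beta>\<close>; the numbers follow the summands in \<open>br_G_b\<close>.\<close>
  define A1 where "A1 \<eta> \<xi> = (if \<eta> = \<alpha> then (f \<beta> \<alpha> * f \<xi> \<beta>) \<odot> (R \<beta> \<alpha> * (b \<alpha> \<xi> * b \<xi> \<beta>)) else 0)" for \<eta> \<xi>
  define A2 where "A2 \<eta> \<xi> = (if part \<eta> = part \<beta> then 0
      else - (f \<beta> \<alpha> * f \<xi> \<beta> * f \<alpha> \<eta>) \<odot> (b \<beta> \<alpha> * (b \<alpha> \<eta> * (b \<eta> \<xi> * b \<xi> \<beta>))))" for \<eta> \<xi>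
  define B1 where "B1 \<eta> \<xi> = (if \<xi> = \<alpha> then if part \<eta> = part \<alpha> then 0
      else (f \<beta> \<eta> * f \<alpha> \<beta>) \<odot> (b \<beta> \<eta> * (R \<eta> \<alpha> * b \<alpha> \<beta>)) else 0)" for \<eta> \<xi>
  define B2 where "B2 \<eta> \<xi> = (f \<beta> \<eta> * f \<xi> \<beta> * (f \<alpha> \<xi> * f \<eta> \<alpha> * u \<xi> \<eta>)) \<odot> (b \<beta> \<eta> * (b \<eta> \<alpha> * (b \<alpha> \<xi> * b \<xi> \<beta>)))" for \<eta> \<xi>
  define B3 where "B3 \<eta> \<xi> = (if \<eta> = \<alpha> then if part \<xi> = part \<alpha> then 0
      else (f \<beta> \<alpha> * f \<xi> \<beta>) \<odot> (b \<beta> \<alpha> * (E \<alpha> \<xi> * b \<xi> \<beta>)) else 0)" for \<eta> \<xi>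
  define C1 where "C1 \<eta> \<xi> = (if part \<xi> = part \<beta> then 0
      else - (f \<alpha> \<beta> * f \<beta> \<eta> * f \<xi> \<alpha>) \<odot> (b \<beta> \<eta> * (b \<eta> \<xi> * (b \<xi> \<alpha> * b \<alpha> \<beta>))))" for \<eta> \<xi>
  define C2 where "C2 \<eta> \<xi> = (if \<xi> = \<alpha> then (f \<beta> \<eta> * f \<alpha> \<beta>) \<odot> (b \<beta> \<eta> * (b \<eta> \<alpha> * E \<alpha> \<beta>)) else 0)" for \<eta> \<xi>
  have first: "(f \<beta> \<eta> * f \<xi> \<beta>) \<odot> (br (G \<alpha>) (b \<beta> \<eta>) * (b \<eta> \<xi> * b \<xi> \<beta>)) = A1 \<eta> \<xi> + A2 \<eta> \<xi>"
    if "\<eta> \<in> K" "\<xi> \<in> K" for \<eta> \<xi>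
  proof (cases "part \<eta> = part \<beta>")
    case False
    then have fu: "f \<beta> \<eta> * u \<eta> \<beta> = - 1" and "\<eta> \<noteq> \<beta>" by auto
    have "f \<beta> \<eta> * f \<xi> \<beta> * (f \<alpha> \<eta> * f \<beta> \<alpha> * u \<eta> \<beta>) = (f \<beta> \<eta> * u \<eta> \<beta>) * (f \<beta> \<alpha> * f \<xi> \<beta> * f \<alpha> \<eta>)"
      by (simp only: complex_ac)
    then have "f \<beta> \<eta> * f \<xi> \<beta> * (f \<alpha> \<eta> * f \<beta> \<alpha> * u \<eta> \<beta>) = - (f \<beta> \<alpha> * f \<xi> \<beta> * f \<alpha> \<eta>)"
      unfolding fu by simp
    then show ?thesis
      using False \<open>\<eta> \<noteq> \<beta>\<close> ne that K b_commute' [of \<alpha> \<eta> \<beta> \<alpha> "b \<eta> \<xi> * b \<xi> \<beta>"]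
      by (auto simp: A1_def A2_def br_G_b word_simps distrib_right scale_right_distrib)
  qed (use parts in \<open>auto simp: A1_def A2_def\<close>)
  have second: "(f \<beta> \<eta> * f \<xi> \<beta>) \<odot> (b \<beta> \<eta> * (br (G \<alpha>) (b \<eta> \<xi>) * b \<xi> \<beta>)) = B1 \<eta> \<xi> + B2 \<eta> \<xi> + B3 \<eta> \<xi>"
    if "\<eta> \<in> K" "\<xi> \<in> K" for \<eta> \<xi>
  proof (cases "part \<eta> = part \<xi>")
    case False
    then have "\<eta> \<noteq> \<xi>" by auto
    then show ?thesis
      using False that K b_commute' [of \<alpha> \<xi> \<eta> \<alpha> "b \<xi> \<beta>"]
      by (auto simp: B1_def B2_def B3_def br_G_b word_simps distrib_right distrib_left scale_right_distrib)
  qed (auto simp: B1_def B2_def B3_def br_G_b K that)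
  have third: "(f \<beta> \<eta> * f \<xi> \<beta>) \<odot> (b \<beta> \<eta> * (b \<eta> \<xi> * br (G \<alpha>) (b \<xi> \<beta>))) = C1 \<eta> \<xi> + C2 \<eta> \<xi>"
    if "\<eta> \<in> K" "\<xi> \<in> K" for \<eta> \<xi>
  proof (cases "part \<xi> = part \<beta>")
    case False
    then have fu: "f \<xi> \<beta> * u \<beta> \<xi> = - 1" and "\<xi> \<noteq> \<beta>" by auto
    have "f \<beta> \<eta> * f \<xi> \<beta> * (f \<alpha> \<beta> * f \<xi> \<alpha> * u \<beta> \<xi>) = (f \<xi> \<beta> * u \<beta> \<xi>) * (f \<alpha> \<beta> * f \<beta> \<eta> * f \<xi> \<alpha>)"
      by (simp only: complex_ac)
    then have "f \<beta> \<eta> * f \<xi> \<beta> * (f \<alpha> \<beta> * f \<xi> \<alpha> * u \<beta> \<xi>) = - (f \<alpha> \<beta> * f \<beta> \<eta> * f \<xi> \<alpha>)"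
      unfolding fu by simp
    then show ?thesis
      using False \<open>\<xi> \<noteq> \<beta>\<close> ne that K b_commute [of \<alpha> \<beta> \<xi> \<alpha>]
      by (auto simp: C1_def C2_def br_G_b word_simps distrib_left scale_right_distrib)
  qed (use parts in \<open>auto simp: C1_def C2_def\<close>)
  have "br (G \<alpha>) (G \<beta>) = (\<Sum>\<eta>\<in>K. \<Sum>\<xi>\<in>K.
      (f \<beta> \<eta> * f \<xi> \<beta>) \<odot> (br (G \<alpha>) (b \<beta> \<eta>) * (b \<eta> \<xi> * b \<xi> \<beta>))
    + (f \<beta> \<eta> * f \<xi> \<beta>) \<odot> (b \<beta> \<eta> * (br (G \<alpha>) (b \<eta> \<xi>) * b \<xi> \<beta>))
    + (f \<beta> \<eta> * f \<xi> \<beta>) \<odot> (b \<beta> \<eta> * (b \<eta> \<xi> * br (G \<alpha>) (b \<xi> \<beta>))))"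
    unfolding G_eq [of \<beta>] br_sum_right br_scale_right
    by (intro sum.cong refl) (simp add: br_mult_right word_simps distrib_right distrib_left scale_right_distrib add.assoc)
  also have "\<dots> = (\<Sum>\<eta>\<in>K. \<Sum>\<xi>\<in>K. (A1 \<eta> \<xi> + B2 \<eta> \<xi> + C2 \<eta> \<xi>) + (A2 \<eta> \<xi> + B3 \<eta> \<xi>) + (B1 \<eta> \<xi> + C1 \<eta> \<xi>))"
    by (intro sum.cong refl) (simp add: first second third)
  also have "\<dots> = (\<Sum>\<eta>\<in>K. \<Sum>\<xi>\<in>K. A1 \<eta> \<xi> + B2 \<eta> \<xi> + C2 \<eta> \<xi>) + (\<Sum>\<eta>\<in>K. \<Sum>\<xi>\<in>K. A2 \<eta> \<xi> + B3 \<eta> \<xi>)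
      + (\<Sum>\<eta>\<in>K. \<Sum>\<xi>\<in>K. B1 \<eta> \<xi> + C1 \<eta> \<xi>)"
    by (simp only: sum.distrib)
  \<comment> \<open>the 4-cycles in which \<open>\<alpha>\<close> and \<open>\<beta>\<close> are opposite\<close>
  also have "(\<Sum>\<eta>\<in>K. \<Sum>\<xi>\<in>K. A1 \<eta> \<xi> + B2 \<eta> \<xi> + C2 \<eta> \<xi>) = 0"
  proof -
    have "(\<Sum>\<eta>\<in>K. \<Sum>\<xi>\<in>K. A1 \<eta> \<xi>) = f \<beta> \<alpha> \<odot> (R \<beta> \<alpha> * R \<alpha> \<beta>)"
      using K by (simp add: A1_def R_def [of \<alpha> \<beta>] word_simps sum.swap [of "\<lambda>\<eta> \<xi>. if \<eta> = \<gamma> then P \<eta> \<xi> else 0" for P \<gamma>])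
    also have "\<dots> = (\<Sum>\<eta>\<in>K. \<Sum>\<xi>\<in>K. (f \<beta> \<alpha> * (f \<eta> \<alpha> * f \<xi> \<beta>)) \<odot> (b \<beta> \<eta> * (b \<eta> \<alpha> * (b \<alpha> \<xi> * b \<xi> \<beta>))))"
      by (simp add: R_def word_simps, rule trans [OF sum.swap], simp add: complex_ac)
    finally have 1: "(\<Sum>\<eta>\<in>K. \<Sum>\<xi>\<in>K. A1 \<eta> \<xi>) = \<dots>" .
    have "(\<Sum>\<eta>\<in>K. \<Sum>\<xi>\<in>K. C2 \<eta> \<xi>) = f \<alpha> \<beta> \<odot> (E \<beta> \<alpha> * E \<alpha> \<beta>)"
      using K by (simp add: C2_def E_def [of \<beta> \<alpha>] word_simps complex_ac)
    also have "\<dots> = (\<Sum>\<eta>\<in>K. \<Sum>\<xi>\<in>K. (f \<alpha> \<beta> * (f \<beta> \<eta> * f \<alpha> \<xi>)) \<odot> (b \<beta> \<eta> * (b \<eta> \<alpha> * (b \<alpha> \<xi> * b \<xi> \<beta>))))"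
      by (simp add: E_def word_simps, rule trans [OF sum.swap], simp add: complex_ac)
    finally have 2: "(\<Sum>\<eta>\<in>K. \<Sum>\<xi>\<in>K. C2 \<eta> \<xi>) = \<dots>" .
    have "(\<Sum>\<eta>\<in>K. \<Sum>\<xi>\<in>K. A1 \<eta> \<xi> + B2 \<eta> \<xi> + C2 \<eta> \<xi>) = (\<Sum>\<eta>\<in>K. \<Sum>\<xi>\<in>K.
        (f \<beta> \<alpha> * (f \<eta> \<alpha> * f \<xi> \<beta>) + f \<alpha> \<beta> * (f \<beta> \<eta> * f \<alpha> \<xi>) + f \<beta> \<eta> * f \<xi> \<beta> * (f \<alpha> \<xi> * f \<eta> \<alpha> * u \<xi> \<eta>))
        \<odot> (b \<beta> \<eta> * (b \<eta> \<alpha> * (b \<alpha> \<xi> * b \<xi> \<beta>))))"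
      unfolding sum.distrib 1 2 B2_def
      unfolding sum.distrib [symmetric] scale_left_distrib [symmetric] by (simp only: add_ac)
    also have "\<dots> = 0"
    proof (intro sum.neutral ballI)
      fix \<eta> \<xi>
      consider "part \<eta> = part \<alpha>" | "part \<eta> = part \<beta>" | "part \<xi> = part \<alpha>" | "part \<xi> = part \<beta>"
        | "part \<eta> \<noteq> part \<alpha>" "part \<eta> \<noteq> part \<beta>" "part \<xi> \<noteq> part \<alpha>" "part \<xi> \<noteq> part \<beta>" by blast
      then show "(f \<beta> \<alpha> * (f \<eta> \<alpha> * f \<xi> \<beta>) + f \<alpha> \<beta> * (f \<beta> \<eta> * f \<alpha> \<xi>) + f \<beta> \<eta> * f \<xi> \<beta> * (f \<alpha> \<xi> * f \<eta> \<alpha> * u \<xi> \<eta>))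
        \<odot> (b \<beta> \<eta> * (b \<eta> \<alpha> * (b \<alpha> \<xi> * b \<xi> \<beta>))) = 0"
        by cases (simp_all add: b_same_part scalar_4 parts)
    qed
    finally show ?thesis .
  qed
  \<comment> \<open>the 4-cycles through the arrow from \<open>\<alpha>\<close> to \<open>\<beta>\<close>, that is, the words beginning with \<open>b \<beta> \<alpha>\<close>\<close>
  also have "(\<Sum>\<eta>\<in>K. \<Sum>\<xi>\<in>K. A2 \<eta> \<xi> + B3 \<eta> \<xi>) = (f \<alpha> \<beta>)\<^sup>2 \<odot> (b \<beta> \<alpha> *
      (?P1 + ?P2))"
  proof -
    define m where "m \<eta> \<xi> = (f \<beta> \<alpha> * f \<xi> \<beta> * f \<alpha> \<eta>) \<odot> (b \<beta> \<alpha> * (b \<alpha> \<eta> * (b \<eta> \<xi> * b \<xi> \<beta>)))" for \<eta> \<xi>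
    have "(\<Sum>\<eta>\<in>K. \<Sum>\<xi>\<in>K. B3 \<eta> \<xi>) = (\<Sum>\<xi>\<in>K. if part \<xi> = part \<alpha> then 0 else (f \<beta> \<alpha> * f \<xi> \<beta>) \<odot> (b \<beta> \<alpha> * (E \<alpha> \<xi> * b \<xi> \<beta>)))"
      using K by (subst sum.swap) (simp add: B3_def)
    also have "\<dots> = (\<Sum>\<xi>\<in>K. \<Sum>\<eta>\<in>K. if part \<xi> = part \<alpha> then 0 else m \<eta> \<xi>)"
      by (intro sum.cong refl) (simp add: E_def m_def word_simps)
    finally have 1: "(\<Sum>\<eta>\<in>K. \<Sum>\<xi>\<in>K. B3 \<eta> \<xi>) = (\<Sum>\<eta>\<in>K. \<Sum>\<xi>\<in>K. if part \<xi> = part \<alpha> then 0 else m \<eta> \<xi>)"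
      by (subst (2) sum.swap)
    have "(\<Sum>\<eta>\<in>K. \<Sum>\<xi>\<in>K. A2 \<eta> \<xi> + B3 \<eta> \<xi>)
        = (\<Sum>\<eta>\<in>K. \<Sum>\<xi>\<in>K. if part \<eta> = part \<beta> then m \<eta> \<xi> else 0) - (\<Sum>\<eta>\<in>K. \<Sum>\<xi>\<in>K. if part \<xi> = part \<alpha> then m \<eta> \<xi> else 0)"
      unfolding sum.distrib 1 unfolding sum.distrib [symmetric] sum_subtractf [symmetric]
      by (intro sum.cong refl) (simp add: A2_def m_def)
    also have "(\<Sum>\<eta>\<in>K. \<Sum>\<xi>\<in>K. if part \<eta> = part \<beta> then m \<eta> \<xi> else 0)
        = (f \<alpha> \<beta>)\<^sup>2 \<odot> (b \<beta> \<alpha> * ?P1)"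
      unfolding sum_distrib_left scale_sum_right
    proof (intro sum.cong refl)
      fix \<eta>
      show "(\<Sum>\<xi>\<in>K. if part \<eta> = part \<beta> then m \<eta> \<xi> else 0)
          = (f \<alpha> \<beta>)\<^sup>2 \<odot> (b \<beta> \<alpha> * (if part \<eta> = part \<beta> then b \<alpha> \<eta> * E \<eta> \<beta> else 0))"
      proof (cases "part \<eta> = part \<beta>")
        case True
        then have "E \<eta> \<beta> = - R \<eta> \<beta>" by (simp add: R_eq_minus_E)
        moreover have "f \<alpha> \<eta> = f \<alpha> \<beta>" using True by (intro f_cong) auto
        ultimately show ?thesis
          using True f_swap [of \<beta> \<alpha>]
          by (simp add: m_def R_def word_simps power2_eq_square sum_negf complex_ac)
      qed simp
    qed
    also have "(\<Sum>\<eta>\<in>K. \<Sum>\<xi>\<in>K. if part \<xi> = part \<alpha> then m \<eta> \<xi> else 0)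
        = - ((f \<alpha> \<beta>)\<^sup>2 \<odot> (b \<beta> \<alpha> * ?P2))"
      unfolding sum_distrib_left scale_sum_right sum_negf [symmetric]
    proof (subst sum.swap, intro sum.cong refl)
      fix \<xi>
      show "(\<Sum>\<eta>\<in>K. if part \<xi> = part \<alpha> then m \<eta> \<xi> else 0)
          = - ((f \<alpha> \<beta>)\<^sup>2 \<odot> (b \<beta> \<alpha> * (if part \<xi> = part \<alpha> then E \<alpha> \<xi> * b \<xi> \<beta> else 0)))"
      proof (cases "part \<xi> = part \<alpha>")
        case True
        then have "f \<xi> \<beta> = f \<alpha> \<beta>" by (intro f_cong) auto
        then show ?thesis
          using True f_swap [of \<beta> \<alpha>]
          by (simp add: m_def E_def word_simps power2_eq_square sum_negf complex_ac)
      qed simp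
    qed
    finally show ?thesis by (simp add: distrib_left scale_right_distrib)
  qed
  \<comment> \<open>the 4-cycles through the arrow from \<open>\<beta>\<close> to \<open>\<alpha>\<close>, that is, the words ending with \<open>b \<alpha> \<beta>\<close>\<close>
  also have "(\<Sum>\<eta>\<in>K. \<Sum>\<xi>\<in>K. B1 \<eta> \<xi> + C1 \<eta> \<xi>) = - ((f \<alpha> \<beta>)\<^sup>2 \<odot> (
      (?P3 + ?P4) * b \<alpha> \<beta>))"
  proof -
    define m where "m \<eta> \<xi> = (f \<alpha> \<beta> * f \<beta> \<eta> * f \<xi> \<alpha>) \<odot> (b \<beta> \<eta> * (b \<eta> \<xi> * (b \<xi> \<alpha> * b \<alpha> \<beta>)))" for \<eta> \<xi>
    have "(\<Sum>\<eta>\<in>K. \<Sum>\<xi>\<in>K. B1 \<eta> \<xi>) = (\<Sum>\<eta>\<in>K. if part \<eta> = part \<alpha> then 0 else (f \<beta> \<eta> * f \<alpha> \<beta>) \<odot> (b \<beta> \<eta> * (R \<eta> \<alpha> * b \<alpha> \<beta>)))"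
      using K by (simp add: B1_def)
    also have "\<dots> = (\<Sum>\<eta>\<in>K. \<Sum>\<xi>\<in>K. if part \<eta> = part \<alpha> then 0 else m \<eta> \<xi>)"
      by (intro sum.cong refl) (simp add: R_def m_def word_simps complex_ac)
    finally have 1: "(\<Sum>\<eta>\<in>K. \<Sum>\<xi>\<in>K. B1 \<eta> \<xi>) = (\<Sum>\<eta>\<in>K. \<Sum>\<xi>\<in>K. if part \<eta> = part \<alpha> then 0 else m \<eta> \<xi>)" .
    have "(\<Sum>\<eta>\<in>K. \<Sum>\<xi>\<in>K. B1 \<eta> \<xi> + C1 \<eta> \<xi>)
        = (\<Sum>\<eta>\<in>K. \<Sum>\<xi>\<in>K. if part \<xi> = part \<beta> then m \<eta> \<xi> else 0) - (\<Sum>\<eta>\<in>K. \<Sum>\<xi>\<in>K. if part \<eta> = part \<alpha> then m \<eta> \<xi> else 0)"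
      unfolding sum.distrib 1 unfolding sum.distrib [symmetric] sum_subtractf [symmetric]
      by (intro sum.cong refl) (simp add: C1_def m_def)
    also have "(\<Sum>\<eta>\<in>K. \<Sum>\<xi>\<in>K. if part \<eta> = part \<alpha> then m \<eta> \<xi> else 0)
        = (f \<alpha> \<beta>)\<^sup>2 \<odot> (?P4 * b \<alpha> \<beta>)"
      unfolding sum_distrib_right scale_sum_right
    proof (intro sum.cong refl)
      fix \<eta>
      show "(\<Sum>\<xi>\<in>K. if part \<eta> = part \<alpha> then m \<eta> \<xi> else 0)
          = (f \<alpha> \<beta>)\<^sup>2 \<odot> ((if part \<eta> = part \<alpha> then b \<beta> \<eta> * E \<eta> \<alpha> else 0) * b \<alpha> \<beta>)"
      proof (cases "part \<eta> = part \<alpha>")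
        case True
        then have "E \<eta> \<alpha> = - R \<eta> \<alpha>" by (simp add: R_eq_minus_E)
        moreover have "f \<beta> \<eta> = f \<beta> \<alpha>" using True by (intro f_cong) auto
        ultimately show ?thesis
          using True f_swap [of \<beta> \<alpha>]
          by (simp add: m_def R_def word_simps power2_eq_square sum_negf complex_ac)
      qed simp
    qed
    also have "(\<Sum>\<eta>\<in>K. \<Sum>\<xi>\<in>K. if part \<xi> = part \<beta> then m \<eta> \<xi> else 0)
        = - ((f \<alpha> \<beta>)\<^sup>2 \<odot> (?P3 * b \<alpha> \<beta>))"
      unfolding sum_distrib_right scale_sum_right sum_negf [symmetric]
    proof (subst sum.swap, intro sum.cong refl)
      fix \<xi>
      show "(\<Sum>\<eta>\<in>K. if part \<xi> = part \<beta> then m \<eta> \<xi> else 0)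
          = - ((f \<alpha> \<beta>)\<^sup>2 \<odot> ((if part \<xi> = part \<beta> then E \<beta> \<xi> * b \<xi> \<alpha> else 0) * b \<alpha> \<beta>))"
      proof (cases "part \<xi> = part \<beta>")
        case True
        then have "f \<xi> \<alpha> = f \<beta> \<alpha>" by (intro f_cong) auto
        then show ?thesis
          using True f_swap [of \<beta> \<alpha>]
          by (simp add: m_def E_def word_simps power2_eq_square sum_negf complex_ac)
      qed simp
    qed
    finally show ?thesis by (simp add: distrib_right scale_right_distrib)
  qed
  also have "0 + (f \<alpha> \<beta>)\<^sup>2 \<odot> (b \<beta> \<alpha> *
      (?P1 + ?P2))
    + - ((f \<alpha> \<beta>)\<^sup>2 \<odot> (
      (?P3 + ?P4) * b \<alpha> \<beta>))
    = (f \<alpha> \<beta>)\<^sup>2 \<odot> (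
        ?D1
      - ?D2)"
  proof -
    have if_distrib: "b \<beta> \<alpha> * (if P then X else 0) = (if P then b \<beta> \<alpha> * X else 0)" 
      "(if P then X else 0) * b \<alpha> \<beta> = (if P then X * b \<alpha> \<beta> else 0)"
      "(if P then X - Y else 0) = (if P then X else 0) - (if P then Y else 0)" for P X Y
      by simp_all
    show ?thesis
      unfolding if_distrib(3) sum_subtractf
      by (simp add: if_distrib(1,2) word_simps distrib_left distrib_right scale_right_distrib scale_right_diff_distrib cong: if_cong)
  qed
  also have "?D1
      = same_part_sum \<beta> (\<lambda>\<gamma>. br (\<Omega> \<beta> \<gamma>) (N \<alpha> \<beta>))"
    unfolding same_part_sum_def
  proof (intro sum.cong refl)
    fix \<eta> assume \<eta>: "\<eta> \<in> K"
    consider "part \<eta> \<noteq> part \<beta>" | "\<eta> = \<beta>" | "part \<eta> = part \<beta>" "\<eta> \<noteq> \<beta>" by blast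
    then show "(if part \<eta> = part \<beta> then b \<beta> \<alpha> * b \<alpha> \<eta> * E \<eta> \<beta> - E \<beta> \<eta> * b \<eta> \<alpha> * b \<alpha> \<beta> else 0) =
        (if part \<eta> = part \<beta> \<and> \<eta> \<noteq> \<beta> then br (\<Omega> \<beta> \<eta>) (N \<alpha> \<beta>) else 0)"
    proof cases
      case 2
      have "br (E \<beta> \<beta>) (b \<beta> \<alpha> * b \<alpha> \<beta>) = 0"
        using K ne by (simp add: br_mult_right br_E_b)
      then show ?thesis using 2 by (simp add: br_def mult.assoc)
    next
      case 3
      have "br (E \<eta> \<beta>) (b \<beta> \<alpha>) = - b \<eta> \<alpha>"
        using \<eta> K ne 3 parts by (subst br_E_b) auto
      moreover have "br (E \<beta> \<eta>) (b \<alpha> \<beta>) = b \<alpha> \<eta>"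
        using \<eta> K ne 3 parts by (subst br_E_b) auto
      ultimately have "E \<eta> \<beta> * b \<beta> \<alpha> = b \<beta> \<alpha> * E \<eta> \<beta> - b \<eta> \<alpha>" "b \<alpha> \<beta> * E \<beta> \<eta> = E \<beta> \<eta> * b \<alpha> \<beta> - b \<alpha> \<eta>"
        by (simp_all add: br_def algebra_simps)
      moreover have "b \<alpha> \<eta> * b \<beta> \<alpha> = b \<beta> \<alpha> * b \<alpha> \<eta>" "b \<alpha> \<beta> * b \<eta> \<alpha> = b \<eta> \<alpha> * b \<alpha> \<beta>"
        using \<eta> K 3 by (auto intro: b_commute)
      ultimately have "b \<alpha> \<eta> * E \<eta> \<beta> * b \<beta> \<alpha> - b \<alpha> \<beta> * E \<beta> \<eta> * b \<eta> \<alpha>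
          = b \<beta> \<alpha> * b \<alpha> \<eta> * E \<eta> \<beta> - E \<beta> \<eta> * b \<eta> \<alpha> * b \<alpha> \<beta>"
        by (simp add: mult.assoc right_diff_distrib left_diff_distrib) (simp add: mult.assoc [symmetric])
      then show ?thesis using \<eta> K 3 parts by (simp add: br_\<Omega>_N(1))
    qed simp
  qed
  also have "?D2
      = same_part_sum \<alpha> (\<lambda>\<gamma>. br (\<Omega> \<alpha> \<gamma>) (N \<beta> \<alpha>))"
    unfolding same_part_sum_def
  proof (intro sum.cong refl)
    fix \<eta> assume \<eta>: "\<eta> \<in> K"
    consider "part \<eta> \<noteq> part \<alpha>" | "\<eta> = \<alpha>" | "part \<eta> = part \<alpha>" "\<eta> \<noteq> \<alpha>" by blast
    then show "(if part \<eta> = part \<alpha> then b \<beta> \<eta> * E \<eta> \<alpha> * b \<alpha> \<beta> - b \<beta> \<alpha> * E \<alpha> \<eta> * b \<eta> \<beta> else 0) =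
        (if part \<eta> = part \<alpha> \<and> \<eta> \<noteq> \<alpha> then br (\<Omega> \<alpha> \<eta>) (N \<beta> \<alpha>) else 0)"
      using \<eta> K parts by cases (simp_all add: br_\<Omega>_N(1))
  qed
  finally show ?thesis .
qed

end

section \<open>Coefficients depending on the times\<close>

text \<open>
  The coefficients of the 2-cycles are \<open>t \<beta> * (\<phi> \<alpha> \<beta>)\<^sup>2 - t \<alpha> * kap\<close>, with \<open>kap\<close> evaluated at the parts of
  \<open>\<alpha>\<close> and \<open>\<beta>\<close>. The relation between \<open>kap\<close> and the reading says that the weight given by \<open>kap\<close> of a word
  \<open>\<eta> \<alpha> \<xi>\<close> is, apart from the factors \<open>\<phi>\<close> of its arrows, the determinant of the ends.
\<close>

locale isomonodromy_relations = weyl_relations scale K part x y b e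
  for scale :: "complex \<Rightarrow> 'r::ring \<Rightarrow> 'r" (infixr \<open>\<odot>\<close> 75)
    and K :: "'k set" and part :: "'k \<Rightarrow> 'j" and x y :: "'j \<Rightarrow> complex"
    and b :: "'k \<Rightarrow> 'k \<Rightarrow> 'r" and e :: 'r +
  fixes kap :: "'j \<Rightarrow> 'j \<Rightarrow> complex"
  assumes kap: "\<lbrakk>P \<noteq> P'; P \<noteq> P''; P' \<noteq> P''\<rbrakk> \<Longrightarrow>
    kap P P'' * (x P * y P'' - x P'' * y P) - kap P P' * (x P * y P' - x P' * y P) =
    inverse (x P * y P' - x P' * y P) * inverse (x P * y P'' - x P'' * y P) * (x P'' * y P' - x P' * y P'')"
begin

definition k :: "'k \<Rightarrow> 'k \<Rightarrow> complex" where
  "k \<alpha> \<beta> = kap (part \<alpha>) (part \<beta>)"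

lemma k_u:
  assumes "part \<alpha> \<noteq> part \<eta>" "part \<alpha> \<noteq> part \<xi>"
  shows "k \<alpha> \<xi> * u \<alpha> \<xi> - k \<alpha> \<eta> * u \<alpha> \<eta> = f \<alpha> \<eta> * f \<alpha> \<xi> * u \<xi> \<eta>"
proof (cases "part \<eta> = part \<xi>")
  case True
  then have "u \<alpha> \<xi> = u \<alpha> \<eta>" by (intro u_cong) auto
  moreover have "k \<alpha> \<xi> = k \<alpha> \<eta>" "u \<xi> \<eta> = 0" using True by (simp_all add: k_def)
  ultimately show ?thesis by simp
next
  case False
  show ?thesis unfolding k_def u_def f_def using assms False by (intro kap)
qed

definition coeff :: "('k \<Rightarrow> complex) \<Rightarrow> 'k \<Rightarrow> 'k \<Rightarrow> complex" where
  "coeff t \<alpha> \<beta> = t \<beta> * (f \<alpha> \<beta>)\<^sup>2 - t \<alpha> * k \<alpha> \<beta>"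

lemma coeff_u:
  assumes "part \<alpha> \<noteq> part \<beta>" "part \<alpha> \<noteq> part \<xi>"
  shows "coeff t \<alpha> \<beta> * u \<alpha> \<beta> - coeff t \<alpha> \<xi> * u \<alpha> \<xi>
     = t \<beta> * f \<alpha> \<beta> - t \<xi> * f \<alpha> \<xi> + t \<alpha> * (f \<alpha> \<beta> * f \<alpha> \<xi> * u \<xi> \<beta>)"
proof -
  have "coeff t \<alpha> \<beta> * u \<alpha> \<beta> - coeff t \<alpha> \<xi> * u \<alpha> \<xi>
     = t \<beta> * f \<alpha> \<beta> * (f \<alpha> \<beta> * u \<alpha> \<beta>) - t \<xi> * f \<alpha> \<xi> * (f \<alpha> \<xi> * u \<alpha> \<xi>)
        + t \<alpha> * (k \<alpha> \<xi> * u \<alpha> \<xi> - k \<alpha> \<beta> * u \<alpha> \<beta>)"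
    by (simp add: coeff_def power2_eq_square algebra_simps)
  then show ?thesis using assms by (simp add: k_u)
qed

definition h2 :: "('k \<Rightarrow> complex) \<Rightarrow> 'k \<Rightarrow> 'r" where
  "h2 t \<alpha> = Q (coeff t \<alpha>) \<alpha>"

text \<open>
  The identity behind \<open>coeff_cycle\<close> with \<open>p, q, r\<close> for the values of \<open>\<phi>\<close> at the three arrows of a cycle.
\<close>

lemma cycle_identity:
  fixes p q r A B t1 t2 t3 :: complex
  assumes "r * A = 1" "q * B = 1"
  shows "- p * - r * (t2 * p - t3 * q + t1 * (p * q * - A)) =
    q * - p * - (t1 * - p - t3 * r + t2 * (- p * r * - B))"
proof -
  have "- p * - r * (t2 * p - t3 * q + t1 * (p * q * - A)) = p * p * r * t2 - p * q * r * t3 - p * p * q * t1 * (r * A)"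
    by (simp add: algebra_simps)
  moreover have "q * - p * - (t1 * - p - t3 * r + t2 * (- p * r * - B)) = p * p * r * t2 * (q * B) - p * q * r * t3 - p * p * q * t1"
    by (simp add: algebra_simps)
  ultimately show ?thesis using assms by simp
qed

lemma coeff_cycle:
  assumes "part \<alpha> \<noteq> part \<beta>" "part \<alpha> \<noteq> part \<xi>" "part \<beta> \<noteq> part \<xi>"
  shows "f \<beta> \<alpha> * f \<xi> \<beta> * (u \<alpha> \<beta> * coeff t \<alpha> \<beta> + u \<xi> \<alpha> * coeff t \<alpha> \<xi>)
       = f \<alpha> \<xi> * f \<beta> \<alpha> * (u \<beta> \<xi> * coeff t \<beta> \<xi> + u \<alpha> \<beta> * coeff t \<beta> \<alpha>)"
proof -
  have "u \<alpha> \<beta> * coeff t \<alpha> \<beta> + u \<xi> \<alpha> * coeff t \<alpha> \<xi> = coeff t \<alpha> \<beta> * u \<alpha> \<beta> - coeff t \<alpha> \<xi> * u \<alpha> \<xi>"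
    unfolding u_swap [of \<xi> \<alpha>] by simp
  also have "\<dots> = t \<beta> * f \<alpha> \<beta> - t \<xi> * f \<alpha> \<xi> + t \<alpha> * (f \<alpha> \<beta> * f \<alpha> \<xi> * u \<xi> \<beta>)"
    by (rule coeff_u [OF assms(1,2)])
  finally have 1: "u \<alpha> \<beta> * coeff t \<alpha> \<beta> + u \<xi> \<alpha> * coeff t \<alpha> \<xi> = \<dots>" .
  have "u \<beta> \<xi> * coeff t \<beta> \<xi> + u \<alpha> \<beta> * coeff t \<beta> \<alpha> = - (coeff t \<beta> \<alpha> * u \<beta> \<alpha> - coeff t \<beta> \<xi> * u \<beta> \<xi>)"
    unfolding u_swap [of \<alpha> \<beta>] by simp
  also have "\<dots> = - (t \<alpha> * f \<beta> \<alpha> - t \<xi> * f \<beta> \<xi> + t \<beta> * (f \<beta> \<alpha> * f \<beta> \<xi> * u \<xi> \<alpha>))"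
    by (subst coeff_u [OF assms(1) [symmetric] assms(3)]) (rule refl)
  finally have 2: "u \<beta> \<xi> * coeff t \<beta> \<xi> + u \<alpha> \<beta> * coeff t \<beta> \<alpha> = \<dots>" .
  have f: "f \<beta> \<alpha> = - f \<alpha> \<beta>" "f \<xi> \<beta> = - f \<beta> \<xi>" and u: "u \<xi> \<beta> = - u \<beta> \<xi>" "u \<xi> \<alpha> = - u \<alpha> \<xi>"
    by (rule f_swap u_swap)+
  show ?thesis unfolding 1 2 unfolding f u
    by (rule cycle_identity) (use assms in simp_all)
qed

lemma b_b_b_rotate:
  assumes "\<alpha> \<in> K" "\<beta> \<in> K" "\<xi> \<in> K"
  shows "b \<alpha> \<beta> * b \<beta> \<xi> * b \<xi> \<alpha> = b \<beta> \<xi> * b \<xi> \<alpha> * b \<alpha> \<beta>"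
proof (cases "\<xi> = \<alpha> \<or> \<xi> = \<beta> \<or> \<alpha> = \<beta>")
  case False
  then have "b \<alpha> \<beta> * b \<beta> \<xi> = b \<beta> \<xi> * b \<alpha> \<beta>" "b \<alpha> \<beta> * b \<xi> \<alpha> = b \<xi> \<alpha> * b \<alpha> \<beta>"
    using assms by (auto intro: b_commute)
  then show ?thesis by (metis mult.assoc)
qed (auto simp: mult.assoc)

text \<open>
  The coefficients may depend on arbitrary times of the indices: the two brackets contain the same
  3-cycles through \<open>\<alpha>\<close> and \<open>\<beta>\<close>, with the same coefficient by \<open>coeff_cycle\<close>.
\<close>

lemma br_h2_G:
  assumes K: "\<alpha> \<in> K" "\<beta> \<in> K" and ne: "\<alpha> \<noteq> \<beta>"
  shows "br (h2 t \<alpha>) (G \<beta>) + br (G \<alpha>) (h2 t \<beta>) = 0"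
proof -
  have scalar: "(f \<beta> \<alpha> * f \<xi> \<beta> * (u \<alpha> \<beta> * coeff t \<alpha> \<beta> + u \<xi> \<alpha> * coeff t \<alpha> \<xi>)) \<odot> (b \<beta> \<alpha> * b \<alpha> \<xi> * b \<xi> \<beta>)
      = (f \<alpha> \<xi> * f \<beta> \<alpha> * (u \<beta> \<xi> * coeff t \<beta> \<xi> + u \<alpha> \<beta> * coeff t \<beta> \<alpha>)) \<odot> (b \<alpha> \<xi> * b \<xi> \<beta> * b \<beta> \<alpha>)"
    if "\<alpha> \<in> K" "\<beta> \<in> K" "\<xi> \<in> K" for \<alpha> \<beta> \<xi>
  proof (cases "part \<alpha> \<noteq> part \<beta> \<and> part \<alpha> \<noteq> part \<xi> \<and> part \<beta> \<noteq> part \<xi>")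
    case True
    then show ?thesis
      by (intro arg_cong2 [where f = "(\<odot>)"] coeff_cycle b_b_b_rotate that) auto
  qed (auto simp: b_same_part)
  then have sums: "(\<Sum>\<xi>\<in>K. (f \<beta> \<alpha> * f \<xi> \<beta> * (u \<alpha> \<beta> * coeff t \<alpha> \<beta> + u \<xi> \<alpha> * coeff t \<alpha> \<xi>)) \<odot> (b \<beta> \<alpha> * b \<alpha> \<xi> * b \<xi> \<beta>))
      = (\<Sum>\<xi>\<in>K. (f \<alpha> \<xi> * f \<beta> \<alpha> * (u \<beta> \<xi> * coeff t \<beta> \<xi> + u \<alpha> \<beta> * coeff t \<beta> \<alpha>)) \<odot> (b \<alpha> \<xi> * b \<xi> \<beta> * b \<beta> \<alpha>))"
    if "\<alpha> \<in> K" "\<beta> \<in> K" for \<alpha> \<beta>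
    using that by (intro sum.cong refl)
  have "br (h2 t \<alpha>) (G \<beta>) = br (h2 t \<beta>) (G \<alpha>)"
    unfolding h2_def br_Q_G [OF K ne] br_Q_G [OF K(2,1) ne [symmetric]] sums [OF K] sums [OF K(2,1)]
    by (rule add.commute)
  then show ?thesis by (simp add: br_swap [of "G \<alpha>"])
qed

text \<open>
  For two indices in one part the only possible contraction is that of the two middle arrows; it
  turns a pair of 3-cycles into a 4-cycle in which \<open>\<alpha>\<close> and \<open>\<beta>\<close> are opposite. The weight of this 4-cycle in
  \<open>\<Omega> \<alpha> \<beta>\<close> is the same multiple of the determinant of its other two indices.
\<close>

lemma br_G_G_same_part:
  assumes K: "\<alpha> \<in> K" "\<beta> \<in> K" and ne: "\<alpha> \<noteq> \<beta>" and parts: "part \<alpha> = part \<beta>"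
  shows "br (G \<alpha>) (G \<beta>) = br (\<Omega> \<alpha> \<beta>) (Q (k \<alpha>) \<alpha>)"
proof -
  define g where "g \<eta> \<xi> = (f \<alpha> \<eta>)\<^sup>2 * (f \<alpha> \<xi>)\<^sup>2 * u \<xi> \<eta>" for \<eta> \<xi>
  have fb: "f \<beta> \<eta> = f \<alpha> \<eta>" "f \<eta> \<beta> = - f \<alpha> \<eta>" "f \<eta> \<alpha> = - f \<alpha> \<eta>" for \<eta>
    using parts by (metis f_cong f_swap)+
  have "br (G \<alpha>) (G \<beta>) = (\<Sum>\<eta>\<in>K. \<Sum>\<xi>\<in>K. g \<eta> \<xi> \<odot> (b \<beta> \<eta> * (b \<alpha> \<xi> * (b \<eta> \<alpha> * b \<xi> \<beta>))))"
    unfolding G_eq [of \<beta>] br_sum_right br_scale_right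
  proof (intro sum.cong refl)
    fix \<eta> \<xi> assume \<eta>\<xi>: "\<eta> \<in> K" "\<xi> \<in> K"
    show "(f \<beta> \<eta> * f \<xi> \<beta>) \<odot> br (G \<alpha>) (b \<beta> \<eta> * b \<eta> \<xi> * b \<xi> \<beta>) = g \<eta> \<xi> \<odot> (b \<beta> \<eta> * (b \<alpha> \<xi> * (b \<eta> \<alpha> * b \<xi> \<beta>)))"
    proof (cases "part \<eta> = part \<alpha> \<or> part \<xi> = part \<alpha> \<or> part \<xi> = part \<eta>")
      case True
      then show ?thesis using parts by (auto simp: b_same_part g_def)
    next
      case False
      then have "\<eta> \<noteq> \<alpha>" "\<xi> \<noteq> \<alpha>" by auto
      then have "br (G \<alpha>) (b \<beta> \<eta>) = 0" "br (G \<alpha>) (b \<xi> \<beta>) = 0"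
        "br (G \<alpha>) (b \<eta> \<xi>) = (f \<alpha> \<xi> * f \<eta> \<alpha> * u \<xi> \<eta>) \<odot> (b \<alpha> \<xi> * b \<eta> \<alpha>)"
        using K \<eta>\<xi> False ne parts by (simp_all add: br_G_b)
      then show ?thesis
        by (simp add: br_mult_right g_def fb word_simps power2_eq_square complex_ac)
    qed
  qed
  also have "\<dots> = (\<Sum>\<eta>\<in>K. \<Sum>\<xi>\<in>K. g \<eta> \<xi> \<odot> (b \<alpha> \<xi> * (b \<xi> \<beta> * (b \<beta> \<eta> * b \<eta> \<alpha>))))"
  proof (intro sum.cong refl)
    fix \<eta> \<xi> assume \<eta>\<xi>: "\<eta> \<in> K" "\<xi> \<in> K"
    show "g \<eta> \<xi> \<odot> (b \<beta> \<eta> * (b \<alpha> \<xi> * (b \<eta> \<alpha> * b \<xi> \<beta>))) = g \<eta> \<xi> \<odot> (b \<alpha> \<xi> * (b \<xi> \<beta> * (b \<beta> \<eta> * b \<eta> \<alpha>)))"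
    proof (cases "part \<eta> = part \<alpha> \<or> part \<xi> = part \<alpha> \<or> part \<xi> = part \<eta>")
      case True
      then show ?thesis using parts by (auto simp: b_same_part g_def)
    next
      case False
      then have "\<eta> \<noteq> \<alpha>" "\<xi> \<noteq> \<alpha>" "\<eta> \<noteq> \<beta>" "\<xi> \<noteq> \<beta>" "\<eta> \<noteq> \<xi>" using parts by auto
      then have "b \<beta> \<eta> * (b \<alpha> \<xi> * (b \<eta> \<alpha> * b \<xi> \<beta>)) = b \<alpha> \<xi> * (b \<beta> \<eta> * (b \<xi> \<beta> * b \<eta> \<alpha>))"
        using K \<eta>\<xi> ne b_commute' [of \<beta> \<eta> \<alpha> \<xi>] b_commute [of \<eta> \<alpha> \<xi> \<beta>] by simp
      also have "\<dots> = b \<alpha> \<xi> * (b \<xi> \<beta> * (b \<beta> \<eta> * b \<eta> \<alpha>))"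
        using K \<eta>\<xi> ne b_commute' [of \<beta> \<eta> \<xi> \<beta>] \<open>\<eta> \<noteq> \<xi>\<close> by simp
      finally show ?thesis by simp
    qed
  qed
  finally have lhs: "br (G \<alpha>) (G \<beta>) = \<dots>" .
  have Q_E: "br (Q (k \<alpha>) \<alpha>) (E \<beta> \<beta>) = 0"
    unfolding E_def br_sum_right br_scale_right
    using K ne parts by (intro sum.neutral ballI) (auto simp: br_mult_right br_Q_b weight_def b_same_part)
  have "br (Q (k \<alpha>) \<alpha>) (E \<alpha> \<beta> * E \<beta> \<alpha>) = (\<Sum>\<eta>\<in>K. \<Sum>\<xi>\<in>K.
      (f \<alpha> \<eta> * f \<beta> \<xi>) \<odot> br (Q (k \<alpha>) \<alpha>) (b \<alpha> \<eta> * (b \<eta> \<beta> * (b \<beta> \<xi> * b \<xi> \<alpha>))))"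
    by (simp add: E_def word_simps br_sum_right, rule trans [OF sum.swap], simp add: complex_ac)
  also have "\<dots> = (\<Sum>\<eta>\<in>K. \<Sum>\<xi>\<in>K. g \<eta> \<xi> \<odot> (b \<alpha> \<eta> * (b \<eta> \<beta> * (b \<beta> \<xi> * b \<xi> \<alpha>))))"
  proof (intro sum.cong refl)
    fix \<eta> \<xi> assume \<eta>\<xi>: "\<eta> \<in> K" "\<xi> \<in> K"
    show "(f \<alpha> \<eta> * f \<beta> \<xi>) \<odot> br (Q (k \<alpha>) \<alpha>) (b \<alpha> \<eta> * (b \<eta> \<beta> * (b \<beta> \<xi> * b \<xi> \<alpha>)))
        = g \<eta> \<xi> \<odot> (b \<alpha> \<eta> * (b \<eta> \<beta> * (b \<beta> \<xi> * b \<xi> \<alpha>)))"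
    proof (cases "part \<eta> = part \<alpha> \<or> part \<xi> = part \<alpha>")
      case True
      then show ?thesis using parts by (auto simp: b_same_part g_def)
    next
      case False
      then have "\<eta> \<noteq> \<alpha>" "\<xi> \<noteq> \<alpha>" by auto
      then have "br (Q (k \<alpha>) \<alpha>) (b \<alpha> \<eta>) = (- (k \<alpha> \<eta> * u \<alpha> \<eta>)) \<odot> b \<alpha> \<eta>" "br (Q (k \<alpha>) \<alpha>) (b \<eta> \<beta>) = 0"
        "br (Q (k \<alpha>) \<alpha>) (b \<beta> \<xi>) = 0" "br (Q (k \<alpha>) \<alpha>) (b \<xi> \<alpha>) = (k \<alpha> \<xi> * u \<alpha> \<xi>) \<odot> b \<xi> \<alpha>"
        using K \<eta>\<xi> ne u_swap [of \<eta> \<alpha>] by (simp_all add: br_Q_b weight_def complex_ac)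
      then have "br (Q (k \<alpha>) \<alpha>) (b \<alpha> \<eta> * (b \<eta> \<beta> * (b \<beta> \<xi> * b \<xi> \<alpha>)))
          = (k \<alpha> \<xi> * u \<alpha> \<xi> - k \<alpha> \<eta> * u \<alpha> \<eta>) \<odot> (b \<alpha> \<eta> * (b \<eta> \<beta> * (b \<beta> \<xi> * b \<xi> \<alpha>)))"
        by (simp add: br_mult_right scale_left_diff_distrib)
      moreover have "k \<alpha> \<xi> * u \<alpha> \<xi> - k \<alpha> \<eta> * u \<alpha> \<eta> = f \<alpha> \<eta> * f \<alpha> \<xi> * u \<xi> \<eta>"
        using False by (intro k_u) auto
      ultimately show ?thesis
        by (simp add: g_def fb power2_eq_square complex_ac)
    qed
  qed
  finally have "br (\<Omega> \<alpha> \<beta>) (Q (k \<alpha>) \<alpha>) = - (\<Sum>\<eta>\<in>K. \<Sum>\<xi>\<in>K. g \<eta> \<xi> \<odot> (b \<alpha> \<eta> * (b \<eta> \<beta> * (b \<beta> \<xi> * b \<xi> \<alpha>))))"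
    by (subst br_swap) (simp add: \<Omega>_def br_diff_right Q_E)
  also have "\<dots> = (\<Sum>\<eta>\<in>K. \<Sum>\<xi>\<in>K. g \<xi> \<eta> \<odot> (b \<alpha> \<eta> * (b \<eta> \<beta> * (b \<beta> \<xi> * b \<xi> \<alpha>))))"
  proof -
    have anti: "- g \<eta> \<xi> = g \<xi> \<eta>" for \<eta> \<xi>
      using u_swap [of \<eta> \<xi>] by (simp add: g_def)
    show ?thesis
      unfolding sum_negf [symmetric] scale_minus_left [symmetric]
      by (intro sum.cong refl arg_cong2 [where f = "(\<odot>)"] anti)
  qed
  also have "\<dots> = br (G \<alpha>) (G \<beta>)"
    unfolding lhs by (rule sum.swap)
  finally show ?thesis ..
qed

text \<open>
  The sums over the pair commute with \<open>\<Omega>\<close>, so only the difference of the two times survives. It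
  cancels the denominator with which \<open>\<Omega>\<close> occurs in the Hamiltonians; the same happens in
  \<open>br_\<Omega>_h2_other_part\<close>.
\<close>

lemma br_\<Omega>_h2_pair:
  assumes K: "\<alpha> \<in> K" "\<mu> \<in> K" and ne: "\<alpha> \<noteq> \<mu>" and part: "part \<alpha> = part \<mu>"
  shows "br (\<Omega> \<alpha> \<mu>) (h2 t \<alpha> + h2 t \<mu>) = (t \<mu> - t \<alpha>) \<odot> br (\<Omega> \<alpha> \<mu>) (Q (k \<alpha>) \<alpha>)"
proof -
  have pair: "br (\<Omega> \<alpha> \<mu>) (Q c \<mu>) = - br (\<Omega> \<alpha> \<mu>) (Q c \<alpha>)" for c
  proof -
    have "br (\<Omega> \<alpha> \<mu>) (Q c \<alpha> + Q c \<mu>) = (\<Sum>\<eta>\<in>K. c \<eta> \<odot> br (\<Omega> \<alpha> \<mu>) (N \<alpha> \<eta> + N \<mu> \<eta>))"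
      by (simp add: Q_def br_add_right br_sum_right sum.distrib scale_right_distrib)
    also have "\<dots> = 0"
    proof (intro sum.neutral ballI)
      fix \<eta> assume "\<eta> \<in> K"
      then show "c \<eta> \<odot> br (\<Omega> \<alpha> \<mu>) (N \<alpha> \<eta> + N \<mu> \<eta>) = 0"
        using br_\<Omega>_N_pair [OF K _ part ne, of \<eta>] part
        by (cases "part \<eta> = part \<alpha>") (simp_all add: N_def b_same_part)
    qed
    finally show ?thesis by (simp add: br_add_right eq_neg_iff_add_eq_0 add.commute)
  qed
  have "k \<mu> = k \<alpha>" using part by (simp add: k_def fun_eq_iff)
  moreover have "f \<mu> = f \<alpha>" using part by (intro ext f_cong) auto
  moreover have "Q (coeff t \<gamma>) \<beta> = Q (\<lambda>\<eta>. t \<eta> * (f \<gamma> \<eta>)\<^sup>2) \<beta> - t \<gamma> \<odot> Q (k \<gamma>) \<beta>" for \<gamma> \<beta>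
    by (simp add: Q_def coeff_def scale_left_diff_distrib sum_subtractf scale_sum_right)
  ultimately show ?thesis
    by (simp add: h2_def br_add_right br_diff_right pair scale_left_diff_distrib)
qed

lemma br_\<Omega>_h2_other_part:
  assumes K: "\<alpha> \<in> K" "\<mu> \<in> K" "\<beta> \<in> K" and ne: "\<alpha> \<noteq> \<mu>" and part: "part \<alpha> = part \<mu>" "part \<beta> \<noteq> part \<alpha>"
  shows "br (\<Omega> \<alpha> \<mu>) (h2 t \<beta>) = ((t \<alpha> - t \<mu>) * (f \<alpha> \<beta>)\<^sup>2) \<odot> br (\<Omega> \<alpha> \<mu>) (N \<beta> \<alpha>)"
proof -
  have "br (\<Omega> \<alpha> \<mu>) (h2 t \<beta>) = (\<Sum>\<eta>\<in>K. coeff t \<beta> \<eta> \<odot> br (\<Omega> \<alpha> \<mu>) (N \<beta> \<eta>))"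
    by (simp add: h2_def Q_def br_sum_right)
  also have "\<dots> = (\<Sum>\<eta>\<in>{\<alpha>, \<mu>}. coeff t \<beta> \<eta> \<odot> br (\<Omega> \<alpha> \<mu>) (N \<beta> \<eta>))"
    using K part by (intro sum.mono_neutral_right) (auto intro!: br_\<Omega>_N_other)
  also have "\<dots> = coeff t \<beta> \<alpha> \<odot> br (\<Omega> \<alpha> \<mu>) (N \<beta> \<alpha>) + coeff t \<beta> \<mu> \<odot> br (\<Omega> \<alpha> \<mu>) (N \<beta> \<mu>)"
    using ne by simp
  also have "br (\<Omega> \<alpha> \<mu>) (N \<beta> \<mu>) = - br (\<Omega> \<alpha> \<mu>) (N \<beta> \<alpha>)"
    using br_\<Omega>_N_pair [OF K part(1) ne part(2)] K
    by (simp add: N_swap [of \<beta>] br_add_right br_\<Omega>_e eq_neg_iff_add_eq_0 add.commute)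
  also have "coeff t \<beta> \<alpha> \<odot> br (\<Omega> \<alpha> \<mu>) (N \<beta> \<alpha>) + coeff t \<beta> \<mu> \<odot> - br (\<Omega> \<alpha> \<mu>) (N \<beta> \<alpha>)
      = (coeff t \<beta> \<alpha> - coeff t \<beta> \<mu>) \<odot> br (\<Omega> \<alpha> \<mu>) (N \<beta> \<alpha>)"
    by (simp add: scale_left_diff_distrib)
  also have "coeff t \<beta> \<alpha> - coeff t \<beta> \<mu> = (t \<alpha> - t \<mu>) * (f \<alpha> \<beta>)\<^sup>2"
  proof -
    have "k \<beta> \<mu> = k \<beta> \<alpha>" using part by (simp add: k_def)
    moreover have "f \<beta> \<mu> = f \<beta> \<alpha>" using part by (intro f_cong) auto
    moreover have "(f \<beta> \<alpha>)\<^sup>2 = (f \<alpha> \<beta>)\<^sup>2" by (subst f_swap) simp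
    ultimately show ?thesis by (simp add: coeff_def algebra_simps)
  qed
  finally show ?thesis .
qed

end

section \<open>Summation over the indices of the nodes\<close>

locale node_relations = isomonodromy_relations scale K part x y b e kap
  for scale :: "complex \<Rightarrow> 'r::ring \<Rightarrow> 'r" (infixr \<open>\<odot>\<close> 75)
    and K :: "'k set" and part :: "'k \<Rightarrow> 'j" and x y :: "'j \<Rightarrow> complex"
    and b :: "'k \<Rightarrow> 'k \<Rightarrow> 'r" and e :: 'r and kap :: "'j \<Rightarrow> 'j \<Rightarrow> complex" +
  fixes node :: "'k \<Rightarrow> 'i::finite" and \<pi> :: "'i \<Rightarrow> 'j"
  assumes part_eq: "part \<alpha> = \<pi> (node \<alpha>)"
begin

definition basis :: "'i \<Rightarrow> 'k set" where
  "basis i = {\<alpha> \<in> K. node \<alpha> = i}"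

definition siblings :: "'i \<Rightarrow> 'i set" where
  "siblings i = {m. \<pi> m = \<pi> i \<and> m \<noteq> i}"

lemma basisD: "\<alpha> \<in> basis i \<Longrightarrow> \<alpha> \<in> K" "\<alpha> \<in> basis i \<Longrightarrow> node \<alpha> = i" "\<alpha> \<in> basis i \<Longrightarrow> part \<alpha> = \<pi> i"
  by (auto simp: basis_def part_eq)

lemma finite_basis [simp]: "finite (basis i)"
  by (simp add: basis_def)

definition node_\<Omega> :: "'i \<Rightarrow> 'i \<Rightarrow> 'r" where
  "node_\<Omega> i m = (\<Sum>\<alpha>\<in>basis i. \<Sum>\<mu>\<in>basis m. \<Omega> \<alpha> \<mu>)"

definition node_h4 :: "('i \<Rightarrow> complex) \<Rightarrow> 'i \<Rightarrow> 'r" where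
  "node_h4 t i = (\<Sum>m\<in>siblings i. inverse (t i - t m) \<odot> node_\<Omega> i m)"

definition node_h3 :: "'i \<Rightarrow> 'r" where
  "node_h3 i = (\<Sum>\<alpha>\<in>basis i. G \<alpha>)"

definition node_h2 :: "('i \<Rightarrow> complex) \<Rightarrow> 'i \<Rightarrow> 'r" where
  "node_h2 t i = (\<Sum>\<alpha>\<in>basis i. h2 (\<lambda>\<eta>. t (node \<eta>)) \<alpha>)"

lemma node_\<Omega>_swap: "\<pi> i = \<pi> m \<Longrightarrow> node_\<Omega> i m = node_\<Omega> m i"
  unfolding node_\<Omega>_def by (subst sum.swap, intro sum.cong refl \<Omega>_swap) (auto simp: basis_def part_eq)

lemma br_e: "br (\<Omega> \<alpha> \<mu>) e = 0" "br (G \<alpha>) e = 0" "br (N \<alpha> \<beta>) e = 0"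
  by (simp_all add: br_\<Omega>_e br_eq_zero_iff G_eq N_def word_simps)

lemma br_node_e: "br (node_h4 t i) e = 0" "br (node_h3 i) e = 0" "br (node_h2 t i) e = 0"
  by (simp_all add: node_h4_def node_h3_def node_h2_def node_\<Omega>_def h2_def Q_def br_sum_left br_e)

lemma br_h2_h2: "br (node_h2 t i) (node_h2 t m) = 0"
  unfolding node_h2_def h2_def by (simp add: br_sum_left br_sum_right br_Q_Q basisD)

lemma br_h2_h3:
  assumes "i \<noteq> m"
  shows "br (node_h2 t i) (node_h3 m) + br (node_h3 i) (node_h2 t m) = 0"
proof -
  have "br (node_h2 t i) (node_h3 m) + br (node_h3 i) (node_h2 t m)
      = (\<Sum>\<alpha>\<in>basis i. \<Sum>\<beta>\<in>basis m. br (h2 (\<lambda>\<eta>. t (node \<eta>)) \<alpha>) (G \<beta>) + br (G \<alpha>) (h2 (\<lambda>\<eta>. t (node \<eta>)) \<beta>))"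
    unfolding node_h2_def node_h3_def br_sum_left unfolding br_sum_right sum.distrib ..
  also have "\<dots> = 0"
    using assms by (intro sum.neutral ballI br_h2_G) (auto simp: basis_def part_eq)
  finally show ?thesis .
qed

text \<open>
  For a fixed second argument usually only one sibling contributes to the quartic part.
\<close>

lemma br_h4_single:
  assumes "\<And>n. n \<in> siblings i \<Longrightarrow> n \<noteq> m \<Longrightarrow> br (node_\<Omega> i n) X = 0"
  shows "br (node_h4 t i) X = (if m \<in> siblings i then inverse (t i - t m) \<odot> br (node_\<Omega> i m) X else 0)"
proof -
  have "br (node_h4 t i) X = (\<Sum>n\<in>siblings i. if n = m then inverse (t i - t m) \<odot> br (node_\<Omega> i m) X else 0)"
    unfolding node_h4_def br_sum_left using assms by (intro sum.cong) auto
  then show ?thesis by simp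
qed

lemma inverse_diff_swap: "inverse (t j - t i) = - inverse (t i - t j)" for t :: "'i \<Rightarrow> complex"
  by (metis inverse_minus_eq minus_diff_eq)

lemma br_\<Omega>_G_node:
  assumes "\<pi> i = \<pi> m" "i \<noteq> m"
  shows br_\<Omega>_h3_other: "n \<noteq> i \<Longrightarrow> n \<noteq> m \<Longrightarrow> br (node_\<Omega> i m) (node_h3 n) = 0"
    and br_\<Omega>_h3_pair: "br (node_\<Omega> i m) (node_h3 i + node_h3 m) = 0"
proof -
  have zero: "br (\<Omega> \<alpha> \<mu>) (G \<gamma>) = 0" if "\<alpha> \<in> basis i" "\<mu> \<in> basis m" "\<gamma> \<in> K" "\<gamma> \<noteq> \<alpha>" "\<gamma> \<noteq> \<mu>" for \<alpha> \<mu> \<gamma>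
    using that assms by (intro br_\<Omega>_diagonal_other equivariant_S) (auto simp: basis_def part_eq)
  show "br (node_\<Omega> i m) (node_h3 n) = 0" if "n \<noteq> i" "n \<noteq> m"
    unfolding node_\<Omega>_def node_h3_def br_sum_left unfolding br_sum_right
    by (intro sum.neutral ballI zero) (use that in \<open>auto simp: basis_def part_eq\<close>)
  have "(\<Sum>\<gamma>\<in>basis i. br (\<Omega> \<alpha> \<mu>) (G \<gamma>)) + (\<Sum>\<gamma>\<in>basis m. br (\<Omega> \<alpha> \<mu>) (G \<gamma>)) = 0"
    if *: "\<alpha> \<in> basis i" "\<mu> \<in> basis m" for \<alpha> \<mu>
  proof -
    have "(\<Sum>\<gamma>\<in>basis i. br (\<Omega> \<alpha> \<mu>) (G \<gamma>)) = (\<Sum>\<gamma>\<in>{\<alpha>}. br (\<Omega> \<alpha> \<mu>) (G \<gamma>))"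
      using * assms by (intro sum.mono_neutral_right ballI zero) (auto simp: basis_def part_eq)
    moreover have "(\<Sum>\<gamma>\<in>basis m. br (\<Omega> \<alpha> \<mu>) (G \<gamma>)) = (\<Sum>\<gamma>\<in>{\<mu>}. br (\<Omega> \<alpha> \<mu>) (G \<gamma>))"
      using * assms by (intro sum.mono_neutral_right ballI zero) (auto simp: basis_def part_eq)
    moreover have "br (\<Omega> \<alpha> \<mu>) (G \<alpha> + G \<mu>) = 0"
      using * assms by (intro br_\<Omega>_diagonal_pair equivariant_S) (auto simp: basis_def part_eq)
    ultimately show ?thesis by (simp add: br_add_right)
  qed
  then show "br (node_\<Omega> i m) (node_h3 i + node_h3 m) = 0"
    unfolding node_\<Omega>_def node_h3_def br_add_right br_sum_left unfolding br_sum_right sum.distrib [symmetric] by simp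
qed

lemma br_h4_h3:
  assumes "i \<noteq> m"
  shows "br (node_h4 t i) (node_h3 m) + br (node_h3 i) (node_h4 t m) = 0"
proof -
  have 1: "br (node_h4 t i) (node_h3 m) = (if \<pi> m = \<pi> i then inverse (t i - t m) \<odot> br (node_\<Omega> i m) (node_h3 m) else 0)"
    if "i \<noteq> m" for i m
    using that by (subst br_h4_single [of i m]) (auto simp: siblings_def intro!: br_\<Omega>_h3_other)
  show ?thesis
  proof (cases "\<pi> i = \<pi> m")
    case True
    have "br (node_\<Omega> i m) (node_h3 m) = - br (node_\<Omega> i m) (node_h3 i)"
      using br_\<Omega>_h3_pair [OF True assms] by (simp add: br_add_right eq_neg_iff_add_eq_0 add.commute)
    then show ?thesis
      unfolding br_swap [of "node_h3 i"] 1 [OF assms] 1 [OF assms [symmetric]]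
      unfolding node_\<Omega>_swap [OF True [symmetric]] inverse_diff_swap [of t m i] using True by simp
  next
    case False
    then show ?thesis
      unfolding br_swap [of "node_h3 i"] 1 [OF assms] 1 [OF assms [symmetric]] by simp
  qed
qed

lemma node_\<Omega>_disjoint:
  assumes "\<pi> i = \<pi> m" "\<pi> j = \<pi> n" "i \<notin> {j, n}" "m \<notin> {j, n}"
  shows "br (node_\<Omega> i m) (node_\<Omega> j n) = 0"
  unfolding node_\<Omega>_def br_sum_left unfolding br_sum_right
  by (intro sum.neutral ballI br_\<Omega>_\<Omega>_other_part) (use assms in \<open>auto simp: basis_def part_eq\<close>)

lemma node_\<Omega>_triple:
  assumes "\<pi> i = \<pi> m" "\<pi> m = \<pi> n" "i \<noteq> m" "i \<noteq> n" "m \<noteq> n"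
  shows "br (node_\<Omega> i m) (node_\<Omega> i n + node_\<Omega> m n) = 0"
proof -
  have "(\<Sum>\<gamma>\<in>basis i. \<Sum>\<nu>\<in>basis n. br (\<Omega> \<alpha> \<mu>) (\<Omega> \<gamma> \<nu>)) + (\<Sum>\<gamma>\<in>basis m. \<Sum>\<nu>\<in>basis n. br (\<Omega> \<alpha> \<mu>) (\<Omega> \<gamma> \<nu>)) = 0"
    if *: "\<alpha> \<in> basis i" "\<mu> \<in> basis m" for \<alpha> \<mu>
  proof -
    have zero: "(\<Sum>\<nu>\<in>basis n. br (\<Omega> \<alpha> \<mu>) (\<Omega> \<gamma> \<nu>)) = 0"
      if "\<gamma> \<in> basis i \<union> basis m" "\<gamma> \<noteq> \<alpha>" "\<gamma> \<noteq> \<mu>" for \<gamma>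
      by (intro sum.neutral ballI br_\<Omega>_\<Omega>_other_part) (use that * assms in \<open>auto simp: basis_def part_eq\<close>)
    have "(\<Sum>\<gamma>\<in>basis i. \<Sum>\<nu>\<in>basis n. br (\<Omega> \<alpha> \<mu>) (\<Omega> \<gamma> \<nu>)) = (\<Sum>\<gamma>\<in>{\<alpha>}. \<Sum>\<nu>\<in>basis n. br (\<Omega> \<alpha> \<mu>) (\<Omega> \<gamma> \<nu>))"
      using * assms by (intro sum.mono_neutral_right ballI zero) (auto simp: basis_def part_eq)
    moreover have "(\<Sum>\<gamma>\<in>basis m. \<Sum>\<nu>\<in>basis n. br (\<Omega> \<alpha> \<mu>) (\<Omega> \<gamma> \<nu>)) = (\<Sum>\<gamma>\<in>{\<mu>}. \<Sum>\<nu>\<in>basis n. br (\<Omega> \<alpha> \<mu>) (\<Omega> \<gamma> \<nu>))"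
      using * assms by (intro sum.mono_neutral_right ballI zero) (auto simp: basis_def part_eq)
    moreover have "(\<Sum>\<nu>\<in>basis n. br (\<Omega> \<alpha> \<mu>) (\<Omega> \<alpha> \<nu> + \<Omega> \<mu> \<nu>)) = 0"
      by (intro sum.neutral ballI br_\<Omega>_\<Omega>_triple) (use * assms in \<open>auto simp: basis_def part_eq\<close>)
    ultimately show ?thesis by (simp add: br_add_right sum.distrib)
  qed
  then show ?thesis
    by (simp add: node_\<Omega>_def br_add_right br_sum_left, simp add: br_sum_right sum.distrib [symmetric])
qed

text \<open>
  The condition defining the space of times.
\<close>

definition separates :: "('i \<Rightarrow> complex) \<Rightarrow> bool" where
  "separates t \<longleftrightarrow> (\<forall>i m. m \<in> siblings i \<longrightarrow> t i \<noteq> t m)"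

lemma inverse_partial_fractions:
  fixes p q :: complex
  assumes "p \<noteq> 0" "q \<noteq> 0" "p + q \<noteq> 0"
  shows "inverse p * inverse q + inverse (p + q) * inverse (- p) - inverse (p + q) * inverse q = 0"
  using assms by (simp add: divide_simps)

text \<open>
  For two siblings \<open>i\<close> and \<open>j\<close> and a third sibling \<open>m\<close>, the braid relations express all brackets between
  \<open>node_\<Omega> i j\<close>, \<open>node_\<Omega> i m\<close> and \<open>node_\<Omega> j m\<close> by a single element, whose coefficient vanishes by partial
  fractions.
\<close>

lemma br_h4_h4:
  assumes t: "separates t" and ne: "i \<noteq> j"
  shows "br (node_h4 t i) (node_h4 t j) = 0"
proof (cases "\<pi> i = \<pi> j")
  case False
  then show ?thesis
    unfolding node_h4_def br_sum_left unfolding br_sum_right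
    by (auto intro!: sum.neutral node_\<Omega>_disjoint simp: siblings_def)
next
  case True
  define r where "r m n = inverse (t m - t n)" for m n
  define T where "T = siblings i - {j}"
  define X where "X n = br (node_\<Omega> i j) (node_\<Omega> j n)" for n
  have T: "siblings i = insert j T" "siblings j = insert i T" "finite T" "i \<notin> T" "j \<notin> T"
    using True ne by (auto simp: T_def siblings_def)
  have inT: "\<pi> n = \<pi> i" "n \<noteq> i" "n \<noteq> j" if "n \<in> T" for n
    using that by (auto simp: T_def siblings_def)
  have sw: "node_\<Omega> j i = node_\<Omega> i j" using True by (simp add: node_\<Omega>_swap)
  have 1: "br (node_\<Omega> i j) (node_\<Omega> i n) = - X n" if "n \<in> T" for n
  proof -
    have "br (node_\<Omega> i j) (node_\<Omega> i n + node_\<Omega> j n) = 0"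
      by (rule node_\<Omega>_triple) (use inT [OF that] True ne in auto)
    then show ?thesis by (simp add: X_def br_add_right eq_neg_iff_add_eq_0)
  qed
  have 2: "br (node_\<Omega> i n) (node_\<Omega> i j) = X n" if "n \<in> T" for n
    using 1 [OF that] by (subst br_swap) simp
  have 3: "br (node_\<Omega> i n) (node_\<Omega> j n) = - X n" if "n \<in> T" for n
  proof -
    have "br (node_\<Omega> i n) (node_\<Omega> i j + node_\<Omega> n j) = 0"
      by (rule node_\<Omega>_triple) (use inT [OF that] True ne in auto)
    moreover have "node_\<Omega> n j = node_\<Omega> j n"
      by (rule node_\<Omega>_swap) (use inT [OF that] True in simp)
    ultimately show ?thesis using 2 [OF that] by (simp add: br_add_right eq_neg_iff_add_eq_0 add.commute)
  qed
  have "br (node_h4 t i) (node_h4 t j) = (\<Sum>m\<in>siblings i. \<Sum>n\<in>siblings j. (r i m * r j n) \<odot> br (node_\<Omega> i m) (node_\<Omega> j n))"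
    unfolding node_h4_def r_def
    by (simp add: br_sum_left br_sum_right scale_sum_right, rule trans [OF sum.swap], simp add: mult.commute)
  also have "\<dots> = (\<Sum>n\<in>T. (r i j * r j n) \<odot> X n) + (\<Sum>m\<in>T. (r i m * r j i) \<odot> X m)
      + (\<Sum>m\<in>T. \<Sum>n\<in>T. (r i m * r j n) \<odot> br (node_\<Omega> i m) (node_\<Omega> j n))"
    unfolding T(1,2) using T(3-5) by (simp add: sum.distrib sw 2 X_def add.assoc)
  also have "(\<Sum>m\<in>T. \<Sum>n\<in>T. (r i m * r j n) \<odot> br (node_\<Omega> i m) (node_\<Omega> j n)) = (\<Sum>m\<in>T. - ((r i m * r j m) \<odot> X m))"
  proof (intro sum.cong refl)
    fix m assume m: "m \<in> T"
    have zero: "br (node_\<Omega> i m) (node_\<Omega> j n) = 0" if "n \<in> T" "n \<noteq> m" for n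
      by (rule node_\<Omega>_disjoint) (use that m inT True ne in auto)
    have "(\<Sum>n\<in>T. (r i m * r j n) \<odot> br (node_\<Omega> i m) (node_\<Omega> j n)) = (\<Sum>n\<in>{m}. (r i m * r j n) \<odot> br (node_\<Omega> i m) (node_\<Omega> j n))"
      using m T(3) zero by (intro sum.mono_neutral_right) auto
    then show "(\<Sum>n\<in>T. (r i m * r j n) \<odot> br (node_\<Omega> i m) (node_\<Omega> j n)) = - ((r i m * r j m) \<odot> X m)"
      using 3 [OF m] by simp
  qed
  also have "(\<Sum>n\<in>T. (r i j * r j n) \<odot> X n) + (\<Sum>m\<in>T. (r i m * r j i) \<odot> X m) + (\<Sum>m\<in>T. - ((r i m * r j m) \<odot> X m))
      = (\<Sum>m\<in>T. (r i j * r j m + r i m * r j i - r i m * r j m) \<odot> X m)"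
    by (simp add: scale_left_distrib scale_left_diff_distrib sum_subtractf sum_negf sum.distrib)
  also have "\<dots> = 0"
  proof (intro sum.neutral ballI)
    fix m assume m: "m \<in> T"
    have "t i \<noteq> t j" "t i \<noteq> t m" "t j \<noteq> t m"
      using t True ne inT [OF m] by (auto simp: separates_def siblings_def)
    then have "r i j * r j m + r i m * r j i - r i m * r j m = 0"
      using inverse_partial_fractions [of "t i - t j" "t j - t m"] by (simp add: r_def)
    then show "(r i j * r j m + r i m * r j i - r i m * r j m) \<odot> X m = 0" by simp
  qed
  finally show ?thesis .
qed

lemma br_\<Omega>_h2_same_part_other:
  assumes K: "\<alpha> \<in> K" "\<mu> \<in> K" "\<beta> \<in> K" and part: "part \<alpha> = part \<mu>" "part \<beta> = part \<alpha>"
    and "\<beta> \<noteq> \<alpha>" "\<beta> \<noteq> \<mu>"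
  shows "br (\<Omega> \<alpha> \<mu>) (h2 t \<beta>) = 0"
proof -
  have "br (\<Omega> \<alpha> \<mu>) (N \<beta> \<eta>) = 0" if "\<eta> \<in> K" for \<eta>
  proof (cases "\<eta> \<in> {\<alpha>, \<mu>}")
    case True
    then have "part \<beta> = part \<eta>" using part by auto
    then show ?thesis by (simp add: N_def b_same_part)
  next
    case False
    then show ?thesis using assms that by (intro br_\<Omega>_N_other) auto
  qed
  then show ?thesis by (simp add: h2_def Q_def br_sum_right)
qed

lemma br_h4_h2_same_part:
  assumes t: "separates t" and ne: "i \<noteq> j" and \<pi>: "\<pi> i = \<pi> j"
  shows "br (node_h4 t i) (node_h2 t j) + br (node_h2 t i) (node_h4 t j) = - br (node_h3 i) (node_h3 j)"
proof -
  define s where "s \<eta> = t (node \<eta>)" for \<eta>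
  have zero: "br (\<Omega> \<alpha> \<mu>) (h2 s \<beta>) = 0"
    if "\<alpha> \<in> basis i" "\<mu> \<in> basis m" "\<beta> \<in> basis j" "\<pi> i = \<pi> m" "\<pi> j = \<pi> i" "\<beta> \<noteq> \<alpha>" "\<beta> \<noteq> \<mu>" for \<alpha> \<beta> \<mu> i j m
    by (rule br_\<Omega>_h2_same_part_other) (use that in \<open>auto simp: basis_def part_eq\<close>)
  have 1: "br (node_h4 t i) (node_h2 t j) = (\<Sum>\<alpha>\<in>basis i. \<Sum>\<mu>\<in>basis j. inverse (t i - t j) \<odot> br (\<Omega> \<alpha> \<mu>) (h2 s \<mu>))"
    if ne: "i \<noteq> j" and \<pi>: "\<pi> i = \<pi> j" for i j
  proof -
    have "br (node_h4 t i) (node_h2 t j) = inverse (t i - t j) \<odot> br (node_\<Omega> i j) (node_h2 t j)"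
    proof (subst br_h4_single [of i j])
      fix n assume n: "n \<in> siblings i" "n \<noteq> j"
      show "br (node_\<Omega> i n) (node_h2 t j) = 0"
        unfolding node_\<Omega>_def node_h2_def br_sum_left unfolding br_sum_right s_def [symmetric]
        by (intro sum.neutral ballI zero [of _ i _ n _ j]) (use n ne \<pi> in \<open>auto simp: siblings_def basis_def part_eq\<close>)
    qed (use ne \<pi> in \<open>simp add: siblings_def\<close>)
    also have "br (node_\<Omega> i j) (node_h2 t j) = (\<Sum>\<alpha>\<in>basis i. \<Sum>\<mu>\<in>basis j. \<Sum>\<beta>\<in>basis j. br (\<Omega> \<alpha> \<mu>) (h2 s \<beta>))"
      unfolding node_\<Omega>_def node_h2_def br_sum_left unfolding br_sum_right s_def [symmetric] ..
    also have "\<dots> = (\<Sum>\<alpha>\<in>basis i. \<Sum>\<mu>\<in>basis j. br (\<Omega> \<alpha> \<mu>) (h2 s \<mu>))"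
    proof (intro sum.cong refl)
      fix \<alpha> \<mu> assume *: "\<alpha> \<in> basis i" "\<mu> \<in> basis j"
      have "(\<Sum>\<beta>\<in>basis j. br (\<Omega> \<alpha> \<mu>) (h2 s \<beta>)) = (\<Sum>\<beta>\<in>{\<mu>}. br (\<Omega> \<alpha> \<mu>) (h2 s \<beta>))"
        by (intro sum.mono_neutral_right ballI zero [of _ i _ j _ j]) (use * ne \<pi> in \<open>auto simp: basis_def part_eq\<close>)
      then show "(\<Sum>\<beta>\<in>basis j. br (\<Omega> \<alpha> \<mu>) (h2 s \<beta>)) = br (\<Omega> \<alpha> \<mu>) (h2 s \<mu>)" by simp
    qed
    finally show ?thesis by (simp add: scale_sum_right)
  qed
  have "br (node_h2 t i) (node_h4 t j) = (\<Sum>\<mu>\<in>basis j. \<Sum>\<alpha>\<in>basis i. inverse (t i - t j) \<odot> br (\<Omega> \<mu> \<alpha>) (h2 s \<alpha>))"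
    unfolding br_swap [of "node_h2 t i"] 1 [OF ne [symmetric] \<pi> [symmetric]] inverse_diff_swap [of t j i]
    by (simp add: sum_negf)
  also have "\<dots> = (\<Sum>\<alpha>\<in>basis i. \<Sum>\<mu>\<in>basis j. inverse (t i - t j) \<odot> br (\<Omega> \<alpha> \<mu>) (h2 s \<alpha>))"
  proof (subst sum.swap, intro sum.cong refl)
    fix \<alpha> \<mu> assume "\<alpha> \<in> basis i" "\<mu> \<in> basis j"
    then have "\<Omega> \<mu> \<alpha> = \<Omega> \<alpha> \<mu>" using \<pi> by (intro \<Omega>_swap) (auto simp: basis_def part_eq)
    then show "inverse (t i - t j) \<odot> br (\<Omega> \<mu> \<alpha>) (h2 s \<alpha>) = inverse (t i - t j) \<odot> br (\<Omega> \<alpha> \<mu>) (h2 s \<alpha>)" by simp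
  qed
  finally have "br (node_h4 t i) (node_h2 t j) + br (node_h2 t i) (node_h4 t j)
      = (\<Sum>\<alpha>\<in>basis i. \<Sum>\<mu>\<in>basis j. inverse (t i - t j) \<odot> br (\<Omega> \<alpha> \<mu>) (h2 s \<alpha> + h2 s \<mu>))"
    unfolding 1 [OF ne \<pi>] by (simp add: sum.distrib br_add_right scale_right_distrib add.commute)
  also have "\<dots> = (\<Sum>\<alpha>\<in>basis i. \<Sum>\<mu>\<in>basis j. - br (G \<alpha>) (G \<mu>))"
  proof (intro sum.cong refl)
    fix \<alpha> \<mu> assume *: "\<alpha> \<in> basis i" "\<mu> \<in> basis j"
    have s: "s \<alpha> = t i" "s \<mu> = t j" using * by (simp_all add: s_def basisD)
    have "t i \<noteq> t j" using t ne \<pi> by (auto simp: separates_def siblings_def)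
    then have "inverse (t i - t j) * (t j - t i) = - 1" by (simp add: field_simps)
    moreover have K: "\<alpha> \<in> K" "\<mu> \<in> K" "\<alpha> \<noteq> \<mu>" "part \<alpha> = part \<mu>" using * ne \<pi> by (auto simp: basis_def part_eq)
    ultimately show "inverse (t i - t j) \<odot> br (\<Omega> \<alpha> \<mu>) (h2 s \<alpha> + h2 s \<mu>) = - br (G \<alpha>) (G \<mu>)"
      by (simp add: br_\<Omega>_h2_pair br_G_G_same_part s)
  qed
  finally show ?thesis
    unfolding node_h3_def br_sum_left unfolding br_sum_right by (simp add: sum_negf)
qed

lemma eq_minus_self:
  assumes "X = - X"
  shows "X = (0 :: 'r)"
proof -
  have "X + X = 0" by (subst (2) assms) simp
  moreover have "X + X = 2 \<odot> X" using scale_left_distrib [of 1 1 X] by simp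
  ultimately show ?thesis by simp
qed

text \<open>
  After the cancellation of the denominators, the right-hand side differs from the left-hand side by
  the terms between different indices of the node \<open>i\<close>, which are antisymmetric.
\<close>

lemma br_h4_h2_other_part:
  assumes t: "separates t" and \<pi>: "\<pi> i \<noteq> \<pi> j"
  shows "br (node_h4 t i) (node_h2 t j)
    = (\<Sum>\<alpha>\<in>basis i. \<Sum>\<beta>\<in>basis j. (f \<alpha> \<beta>)\<^sup>2 \<odot> same_part_sum \<alpha> (\<lambda>\<mu>. br (\<Omega> \<alpha> \<mu>) (N \<beta> \<alpha>)))"
proof -
  define s where "s \<eta> = t (node \<eta>)" for \<eta>
  define g where "g \<beta> \<alpha> \<mu> = (f \<alpha> \<beta>)\<^sup>2 \<odot> br (\<Omega> \<alpha> \<mu>) (N \<beta> \<alpha>)" for \<alpha> \<beta> \<mu>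
  have "br (node_h4 t i) (node_h2 t j) = (\<Sum>\<beta>\<in>basis j. \<Sum>m\<in>siblings i. \<Sum>\<alpha>\<in>basis i. \<Sum>\<mu>\<in>basis m.
      inverse (t i - t m) \<odot> br (\<Omega> \<alpha> \<mu>) (h2 s \<beta>))"
    unfolding node_h4_def node_\<Omega>_def node_h2_def s_def
    by (simp add: br_sum_right br_sum_left scale_sum_right)
  also have "\<dots> = (\<Sum>\<beta>\<in>basis j. \<Sum>m\<in>siblings i. \<Sum>\<alpha>\<in>basis i. \<Sum>\<mu>\<in>basis m. g \<beta> \<alpha> \<mu>)"
  proof (intro sum.cong refl)
    fix \<beta> m \<alpha> \<mu> assume *: "\<beta> \<in> basis j" "m \<in> siblings i" "\<alpha> \<in> basis i" "\<mu> \<in> basis m"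
    have s: "s \<alpha> = t i" "s \<mu> = t m" using * by (simp_all add: s_def basisD)
    have "t i \<noteq> t m" using t * by (auto simp: separates_def)
    moreover have K: "\<alpha> \<in> K" "\<mu> \<in> K" "\<beta> \<in> K" "\<alpha> \<noteq> \<mu>" "part \<alpha> = part \<mu>" "part \<beta> \<noteq> part \<alpha>"
      using * \<pi> by (auto simp: basis_def part_eq siblings_def)
    ultimately show "inverse (t i - t m) \<odot> br (\<Omega> \<alpha> \<mu>) (h2 s \<beta>) = g \<beta> \<alpha> \<mu>"
      by (simp add: br_\<Omega>_h2_other_part s g_def)
  qed
  also have "\<dots> = (\<Sum>\<beta>\<in>basis j. \<Sum>\<alpha>\<in>basis i. same_part_sum \<alpha> (g \<beta> \<alpha>))"
  proof (intro sum.cong refl)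
    fix \<beta> assume \<beta>: "\<beta> \<in> basis j"
    have anti: "g \<beta> \<mu> \<alpha> = - g \<beta> \<alpha> \<mu>" if "\<alpha> \<in> basis i" "\<mu> \<in> basis i" "\<alpha> \<noteq> \<mu>" for \<alpha> \<mu>
    proof -
      have K: "\<alpha> \<in> K" "\<mu> \<in> K" "\<beta> \<in> K" and p: "part \<alpha> = part \<mu>" "part \<beta> \<noteq> part \<alpha>"
        using that \<beta> \<pi> by (auto simp: basis_def part_eq)
      have "\<Omega> \<mu> \<alpha> = \<Omega> \<alpha> \<mu>" using K p by (intro \<Omega>_swap) auto
      moreover have "f \<mu> \<beta> = f \<alpha> \<beta>" using p by (intro f_cong) auto
      moreover have "br (\<Omega> \<alpha> \<mu>) (N \<beta> \<alpha>) + br (\<Omega> \<alpha> \<mu>) (N \<beta> \<mu>) = 0"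
        using br_\<Omega>_N_pair [OF K p(1) that(3) p(2)] K by (simp add: N_swap [of \<beta>] br_add_right br_\<Omega>_e)
      ultimately show ?thesis
        by (simp add: g_def eq_neg_iff_add_eq_0 add.commute scale_right_distrib [symmetric])
    qed
    have inner: "same_part_sum \<alpha> (g \<beta> \<alpha>) = (\<Sum>m\<in>siblings i. \<Sum>\<mu>\<in>basis m. g \<beta> \<alpha> \<mu>) + (\<Sum>\<mu>\<in>basis i. if \<mu> \<noteq> \<alpha> then g \<beta> \<alpha> \<mu> else 0)"
      if "\<alpha> \<in> basis i" for \<alpha>
    proof -
      define P where "P = {\<mu> \<in> K. part \<mu> = part \<alpha>}"
      have "same_part_sum \<alpha> (g \<beta> \<alpha>) = (\<Sum>\<mu>\<in>P. if \<mu> \<noteq> \<alpha> then g \<beta> \<alpha> \<mu> else 0)"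
        unfolding same_part_sum_def P_def by (intro sum.mono_neutral_cong_right) auto
      also have "P = (\<Union>m\<in>insert i (siblings i). basis m)"
        using that by (auto simp: P_def basis_def siblings_def part_eq)
      also have "(\<Sum>\<mu>\<in>\<dots>. if \<mu> \<noteq> \<alpha> then g \<beta> \<alpha> \<mu> else 0) = (\<Sum>m\<in>insert i (siblings i). \<Sum>\<mu>\<in>basis m. if \<mu> \<noteq> \<alpha> then g \<beta> \<alpha> \<mu> else 0)"
        by (intro sum.UNION_disjoint) (auto simp: basis_def)
      also have "\<dots> = (\<Sum>\<mu>\<in>basis i. if \<mu> \<noteq> \<alpha> then g \<beta> \<alpha> \<mu> else 0) + (\<Sum>m\<in>siblings i. \<Sum>\<mu>\<in>basis m. if \<mu> \<noteq> \<alpha> then g \<beta> \<alpha> \<mu> else 0)"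
        by (intro sum.insert) (auto simp: siblings_def)
      also have "(\<Sum>m\<in>siblings i. \<Sum>\<mu>\<in>basis m. if \<mu> \<noteq> \<alpha> then g \<beta> \<alpha> \<mu> else 0) = (\<Sum>m\<in>siblings i. \<Sum>\<mu>\<in>basis m. g \<beta> \<alpha> \<mu>)"
        using that by (intro sum.cong refl) (auto simp: siblings_def basis_def part_eq)
      finally show ?thesis by (simp add: add.commute)
    qed
    define D where "D \<alpha> \<mu> = (if \<mu> \<noteq> \<alpha> then g \<beta> \<alpha> \<mu> else 0)" for \<alpha> \<mu>
    have D: "D \<mu> \<alpha> = - D \<alpha> \<mu>" if "\<alpha> \<in> basis i" "\<mu> \<in> basis i" for \<alpha> \<mu>
      using anti [OF that] by (cases "\<alpha> = \<mu>") (simp_all add: D_def)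
    have "(\<Sum>\<alpha>\<in>basis i. \<Sum>\<mu>\<in>basis i. D \<alpha> \<mu>) = (\<Sum>\<alpha>\<in>basis i. \<Sum>\<mu>\<in>basis i. D \<mu> \<alpha>)"
      by (rule sum.swap)
    also have "\<dots> = (\<Sum>\<alpha>\<in>basis i. \<Sum>\<mu>\<in>basis i. - D \<alpha> \<mu>)"
      by (intro sum.cong refl D)
    also have "\<dots> = - (\<Sum>\<alpha>\<in>basis i. \<Sum>\<mu>\<in>basis i. D \<alpha> \<mu>)"
      by (simp only: sum_negf)
    finally have "(\<Sum>\<alpha>\<in>basis i. \<Sum>\<mu>\<in>basis i. D \<alpha> \<mu>) = \<dots>" .
    then have "(\<Sum>\<alpha>\<in>basis i. \<Sum>\<mu>\<in>basis i. if \<mu> \<noteq> \<alpha> then g \<beta> \<alpha> \<mu> else 0) = 0"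
      unfolding D_def by (rule eq_minus_self)
    then show "(\<Sum>m\<in>siblings i. \<Sum>\<alpha>\<in>basis i. \<Sum>\<mu>\<in>basis m. g \<beta> \<alpha> \<mu>) = (\<Sum>\<alpha>\<in>basis i. same_part_sum \<alpha> (g \<beta> \<alpha>))"
      by (subst sum.swap) (simp add: inner sum.distrib)
  qed
  also have "\<dots> = (\<Sum>\<alpha>\<in>basis i. \<Sum>\<beta>\<in>basis j. same_part_sum \<alpha> (g \<beta> \<alpha>))"
    by (rule sum.swap)
  finally show ?thesis
    by (simp add: g_def same_part_sum_def scale_sum_right if_distrib [of "scale c" for c] cong: if_cong)
qed

lemma br_h4_h2:
  assumes t: "separates t" and ne: "i \<noteq> j"
  shows "br (node_h4 t i) (node_h2 t j) + br (node_h3 i) (node_h3 j) + br (node_h2 t i) (node_h4 t j) = 0"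
proof (cases "\<pi> i = \<pi> j")
  case True
  then show ?thesis using br_h4_h2_same_part [OF t ne] by (simp add: add.commute add.left_commute)
next
  case False
  have "br (node_h3 i) (node_h3 j) = (\<Sum>\<alpha>\<in>basis i. \<Sum>\<beta>\<in>basis j.
        (f \<alpha> \<beta>)\<^sup>2 \<odot> same_part_sum \<beta> (\<lambda>\<gamma>. br (\<Omega> \<beta> \<gamma>) (N \<alpha> \<beta>)) - (f \<alpha> \<beta>)\<^sup>2 \<odot> same_part_sum \<alpha> (\<lambda>\<gamma>. br (\<Omega> \<alpha> \<gamma>) (N \<beta> \<alpha>)))"
    unfolding node_h3_def br_sum_left unfolding br_sum_right using False
    by (intro sum.cong refl) (auto simp: br_G_G_other_part scale_right_diff_distrib simp: basis_def part_eq)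
  moreover have "br (node_h2 t i) (node_h4 t j) = - (\<Sum>\<alpha>\<in>basis i. \<Sum>\<beta>\<in>basis j.
        (f \<alpha> \<beta>)\<^sup>2 \<odot> same_part_sum \<beta> (\<lambda>\<gamma>. br (\<Omega> \<beta> \<gamma>) (N \<alpha> \<beta>)))"
  proof -
    have "(f \<beta> \<alpha>)\<^sup>2 = (f \<alpha> \<beta>)\<^sup>2" for \<alpha> \<beta> by (subst f_swap) simp
    then show ?thesis
      unfolding br_swap [of "node_h2 t i"] br_h4_h2_other_part [OF t False [symmetric]]
      by (subst sum.swap) simp
  qed
  ultimately show ?thesis
    unfolding br_h4_h2_other_part [OF t False] by (simp add: sum_subtractf)
qed

end

section \<open>The product of all complex algebras on a type\<close>

text \<open>
  A ring together with a homomorphism from the complex numbers to its centre.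
\<close>

definition complex_algebra :: "'a ring \<times> (complex \<Rightarrow> 'a) \<Rightarrow> bool" where
  "complex_algebra A \<longleftrightarrow> ring (fst A) \<and> snd A 1 = \<one>\<^bsub>fst A\<^esub> \<and>
    (\<forall>c. snd A c \<in> carrier (fst A)) \<and>
    (\<forall>c c'. snd A (c + c') = snd A c \<oplus>\<^bsub>fst A\<^esub> snd A c') \<and>
    (\<forall>c c'. snd A (c * c') = snd A c \<otimes>\<^bsub>fst A\<^esub> snd A c') \<and>
    (\<forall>c. \<forall>x\<in>carrier (fst A). x \<otimes>\<^bsub>fst A\<^esub> snd A c = snd A c \<otimes>\<^bsub>fst A\<^esub> x)"

lemma complex_algebraD:
  assumes "complex_algebra A"
  shows "ring (fst A)" "snd A 1 = \<one>\<^bsub>fst A\<^esub>" "snd A c \<in> carrier (fst A)"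
    "snd A (c + c') = snd A c \<oplus>\<^bsub>fst A\<^esub> snd A c'" "snd A (c * c') = snd A c \<otimes>\<^bsub>fst A\<^esub> snd A c'"
    "x \<in> carrier (fst A) \<Longrightarrow> x \<otimes>\<^bsub>fst A\<^esub> snd A c = snd A c \<otimes>\<^bsub>fst A\<^esub> x"
  using assms unfolding complex_algebra_def by blast+

lemma complex_algebra_closed:
  assumes "complex_algebra A"
  shows "\<zero>\<^bsub>fst A\<^esub> \<in> carrier (fst A)"
    "X \<in> carrier (fst A) \<Longrightarrow> \<ominus>\<^bsub>fst A\<^esub> X \<in> carrier (fst A)"
    "X \<in> carrier (fst A) \<Longrightarrow> Y \<in> carrier (fst A) \<Longrightarrow> X \<oplus>\<^bsub>fst A\<^esub> Y \<in> carrier (fst A)"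
    "X \<in> carrier (fst A) \<Longrightarrow> Y \<in> carrier (fst A) \<Longrightarrow> X \<otimes>\<^bsub>fst A\<^esub> Y \<in> carrier (fst A)"
proof -
  interpret ring "fst A" by (rule complex_algebraD [OF assms])
  show "\<zero>\<^bsub>fst A\<^esub> \<in> carrier (fst A)"
    "X \<in> carrier (fst A) \<Longrightarrow> \<ominus>\<^bsub>fst A\<^esub> X \<in> carrier (fst A)"
    "X \<in> carrier (fst A) \<Longrightarrow> Y \<in> carrier (fst A) \<Longrightarrow> X \<oplus>\<^bsub>fst A\<^esub> Y \<in> carrier (fst A)"
    "X \<in> carrier (fst A) \<Longrightarrow> Y \<in> carrier (fst A) \<Longrightarrow> X \<otimes>\<^bsub>fst A\<^esub> Y \<in> carrier (fst A)"
    by simp_all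
qed

text \<open>
  The Weyl algebra is not a type, since it depends on parameters. But it is one factor of this
  product, which is a type of class \<open>ring\<close> and a complex vector space. The set is nonempty for every
  type because it contains the family of zeros.
\<close>

typedef 'a algebra_product =
  "(\<Pi>\<^sub>E A\<in>Collect complex_algebra. carrier (fst A)) :: ('a ring \<times> (complex \<Rightarrow> 'a) \<Rightarrow> 'a) set"
proof
  show "(\<lambda>A\<in>Collect complex_algebra. \<zero>\<^bsub>fst A\<^esub>) \<in> (\<Pi>\<^sub>E A\<in>Collect complex_algebra. carrier (fst A))"
    by (intro restrict_PiE_iff [THEN iffD2] ballI) (simp add: complex_algebra_closed)
qed

definition family :: "('a ring \<times> (complex \<Rightarrow> 'a) \<Rightarrow> 'a) \<Rightarrow> 'a algebra_product" where
  "family g = Abs_algebra_product (\<lambda>A\<in>Collect complex_algebra. g A)"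

lemma Rep_family:
  assumes "\<And>A. complex_algebra A \<Longrightarrow> g A \<in> carrier (fst A)" and A: "complex_algebra A"
  shows "Rep_algebra_product (family g) A = g A"
proof -
  have "(\<lambda>A\<in>Collect complex_algebra. g A) \<in> (\<Pi>\<^sub>E A\<in>Collect complex_algebra. carrier (fst A))"
    using assms(1) by (simp add: restrict_PiE_iff)
  then show ?thesis using A by (simp add: family_def Abs_algebra_product_inverse)
qed

lemma algebra_product_eqI:
  assumes "\<And>A. complex_algebra A \<Longrightarrow> Rep_algebra_product F A = Rep_algebra_product G A"
  shows "F = G"
proof -
  have "Rep_algebra_product F = Rep_algebra_product G"
    by (rule PiE_ext [OF Rep_algebra_product Rep_algebra_product]) (use assms in simp)
  then show ?thesis by (simp only: Rep_algebra_product_inject)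
qed

lemma Rep_closed: "complex_algebra A \<Longrightarrow> Rep_algebra_product F A \<in> carrier (fst A)"
  using PiE_mem [OF Rep_algebra_product [of F], of A] by simp

instantiation algebra_product :: (type) ring
begin

definition zero_algebra_product :: "'a algebra_product" where
  "0 = family (\<lambda>A. \<zero>\<^bsub>fst A\<^esub>)"

definition plus_algebra_product :: "'a algebra_product \<Rightarrow> 'a algebra_product \<Rightarrow> 'a algebra_product" where
  "F + G = family (\<lambda>A. Rep_algebra_product F A \<oplus>\<^bsub>fst A\<^esub> Rep_algebra_product G A)"

definition times_algebra_product :: "'a algebra_product \<Rightarrow> 'a algebra_product \<Rightarrow> 'a algebra_product" where
  "F * G = family (\<lambda>A. Rep_algebra_product F A \<otimes>\<^bsub>fst A\<^esub> Rep_algebra_product G A)"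

definition uminus_algebra_product :: "'a algebra_product \<Rightarrow> 'a algebra_product" where
  "- F = family (\<lambda>A. \<ominus>\<^bsub>fst A\<^esub> Rep_algebra_product F A)"

definition minus_algebra_product :: "'a algebra_product \<Rightarrow> 'a algebra_product \<Rightarrow> 'a algebra_product" where
  "F - G = F + - (G :: 'a algebra_product)"

lemma Rep_simps:
  assumes "complex_algebra A"
  shows "Rep_algebra_product 0 A = \<zero>\<^bsub>fst A\<^esub>"
    "Rep_algebra_product (F + G) A = Rep_algebra_product F A \<oplus>\<^bsub>fst A\<^esub> Rep_algebra_product G A"
    "Rep_algebra_product (F * G) A = Rep_algebra_product F A \<otimes>\<^bsub>fst A\<^esub> Rep_algebra_product G A"
    "Rep_algebra_product (- F) A = \<ominus>\<^bsub>fst A\<^esub> Rep_algebra_product F A"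
  unfolding zero_algebra_product_def plus_algebra_product_def times_algebra_product_def uminus_algebra_product_def
  by (rule Rep_family [OF _ assms]; simp add: Rep_closed complex_algebra_closed)+

instance
proof
  fix F G H :: "'a algebra_product"
  show "F + G + H = F + (G + H)"
    by (rule algebra_product_eqI) (simp add: Rep_simps Rep_closed ring.ring_simprules complex_algebraD(1))
  show "F + G = G + F"
    by (rule algebra_product_eqI) (simp add: Rep_simps Rep_closed ring.ring_simprules complex_algebraD(1))
  show "0 + F = F"
    by (rule algebra_product_eqI) (simp add: Rep_simps Rep_closed ring.ring_simprules complex_algebraD(1))
  show "- F + F = 0"
    by (rule algebra_product_eqI) (simp add: Rep_simps Rep_closed ring.ring_simprules complex_algebraD(1))
  show "F - G = F + - G"
    by (simp add: minus_algebra_product_def)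
  show "F * G * H = F * (G * H)"
    by (rule algebra_product_eqI) (simp add: Rep_simps Rep_closed ring.ring_simprules complex_algebraD(1))
  show "(F + G) * H = F * H + G * H"
    by (rule algebra_product_eqI) (simp add: Rep_simps Rep_closed ring.ring_simprules complex_algebraD(1))
  show "F * (G + H) = F * G + F * H"
    by (rule algebra_product_eqI) (simp add: Rep_simps Rep_closed ring.ring_simprules complex_algebraD(1))
qed

end

definition scale_product :: "complex \<Rightarrow> 'a algebra_product \<Rightarrow> 'a algebra_product" where
  "scale_product c F = family (\<lambda>A. snd A c \<otimes>\<^bsub>fst A\<^esub> Rep_algebra_product F A)"

lemma Rep_scale:
  "complex_algebra A \<Longrightarrow> Rep_algebra_product (scale_product c F) A = snd A c \<otimes>\<^bsub>fst A\<^esub> Rep_algebra_product F A"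
  unfolding scale_product_def
  by (rule Rep_family) (simp_all add: Rep_closed complex_algebra_closed complex_algebraD(3))

interpretation product_algebra: complex_ring scale_product
proof
  fix c c' :: complex and F G :: "'a algebra_product"
  have m_lcomm: "X \<otimes>\<^bsub>fst A\<^esub> (snd A c \<otimes>\<^bsub>fst A\<^esub> Y) = snd A c \<otimes>\<^bsub>fst A\<^esub> (X \<otimes>\<^bsub>fst A\<^esub> Y)"
    if A: "complex_algebra A" and "X \<in> carrier (fst A)" "Y \<in> carrier (fst A)" for A :: "'a ring \<times> (complex \<Rightarrow> 'a)" and X Y
  proof -
    interpret ring "fst A" by (rule complex_algebraD [OF A])
    show ?thesis using that complex_algebraD(3,6) [OF A] by (simp add: m_assoc [symmetric])
  qed
  show "scale_product c (F + G) = scale_product c F + scale_product c G"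
    by (rule algebra_product_eqI) (simp add: Rep_simps Rep_scale Rep_closed ring.ring_simprules complex_algebraD(1,3))
  show "scale_product (c + c') F = scale_product c F + scale_product c' F"
    by (rule algebra_product_eqI) (simp add: Rep_simps Rep_scale Rep_closed ring.ring_simprules complex_algebraD(1-5))
  show "scale_product c (scale_product c' F) = scale_product (c * c') F"
    by (rule algebra_product_eqI) (simp add: Rep_simps Rep_scale Rep_closed ring.ring_simprules complex_algebraD(1-5))
  show "scale_product 1 F = F"
    by (rule algebra_product_eqI) (simp add: Rep_scale Rep_closed ring.ring_simprules complex_algebraD(1-5))
  show "scale_product c F * G = scale_product c (F * G)"
    by (rule algebra_product_eqI) (simp add: Rep_simps Rep_scale Rep_closed ring.ring_simprules complex_algebraD(1-5))
  show "F * scale_product c G = scale_product c (F * G)"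
    by (rule algebra_product_eqI) (simp add: Rep_simps Rep_scale Rep_closed m_lcomm)
qed

text \<open>
  The inclusion respects all operations except for the unit.
\<close>

definition into_product :: "'a ring \<times> (complex \<Rightarrow> 'a) \<Rightarrow> 'a \<Rightarrow> 'a algebra_product" where
  "into_product A X = family (\<lambda>A'. if A' = A then X else \<zero>\<^bsub>fst A'\<^esub>)"

context
  fixes A :: "'a ring \<times> (complex \<Rightarrow> 'a)"
  assumes A: "complex_algebra A"
begin

interpretation ring "fst A" by (rule complex_algebraD [OF A])

lemma Rep_into_product:
  assumes "X \<in> carrier (fst A)" "complex_algebra A'"
  shows "Rep_algebra_product (into_product A X) A' = (if A' = A then X else \<zero>\<^bsub>fst A'\<^esub>)"
  unfolding into_product_def using assms by (subst Rep_family) (auto simp: complex_algebra_closed)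

lemma into_product_inject:
  assumes "X \<in> carrier (fst A)" "Y \<in> carrier (fst A)"
  shows "into_product A X = into_product A Y \<longleftrightarrow> X = Y"
proof
  assume "into_product A X = into_product A Y"
  then have "Rep_algebra_product (into_product A X) A = Rep_algebra_product (into_product A Y) A" by simp
  then show "X = Y" unfolding Rep_into_product [OF assms(1) A] Rep_into_product [OF assms(2) A] by simp
qed simp

lemma into_product_zero: "into_product A \<zero>\<^bsub>fst A\<^esub> = 0"
  by (rule algebra_product_eqI) (simp add: Rep_simps Rep_into_product)

lemma into_product_add:
  "X \<in> carrier (fst A) \<Longrightarrow> Y \<in> carrier (fst A) \<Longrightarrow> into_product A (X \<oplus>\<^bsub>fst A\<^esub> Y) = into_product A X + into_product A Y"
  by (rule algebra_product_eqI) (simp add: Rep_simps Rep_into_product ring.ring_simprules complex_algebraD(1))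

lemma into_product_mult:
  "X \<in> carrier (fst A) \<Longrightarrow> Y \<in> carrier (fst A) \<Longrightarrow> into_product A (X \<otimes>\<^bsub>fst A\<^esub> Y) = into_product A X * into_product A Y"
  by (rule algebra_product_eqI) (simp add: Rep_simps Rep_into_product ring.ring_simprules complex_algebraD(1))

lemma into_product_scale:
  "X \<in> carrier (fst A) \<Longrightarrow> into_product A (snd A c \<otimes>\<^bsub>fst A\<^esub> X) = scale_product c (into_product A X)"
  using complex_algebraD(3) [OF A, of c]
  by (intro algebra_product_eqI) (simp add: Rep_scale Rep_into_product ring.ring_simprules complex_algebraD(1,3))

lemma into_product_minus: "X \<in> carrier (fst A) \<Longrightarrow> into_product A (\<ominus>\<^bsub>fst A\<^esub> X) = - into_product A X"
  using into_product_add [of "\<ominus>\<^bsub>fst A\<^esub> X" X] by (simp add: l_neg into_product_zero eq_neg_iff_add_eq_0)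

lemma into_product_finsum:
  "finite S \<Longrightarrow> (\<And>s. s \<in> S \<Longrightarrow> X s \<in> carrier (fst A)) \<Longrightarrow> into_product A (\<Oplus>\<^bsub>fst A\<^esub>s\<in>S. X s) = (\<Sum>s\<in>S. into_product A (X s))"
  by (induction S rule: finite_induct) (auto simp: into_product_zero into_product_add finsum_insert Pi_def)

end

section \<open>The Weyl algebra as a factor of the product\<close>

lemma scalar_central: "scalar c * X = X * scalar c"
proof (induction X rule: Poly_Mapping.update_induct)
  case (update X w z)
  have "Poly_Mapping.update w z X = X + Poly_Mapping.single w z"
    using update.hyps(1)
    by (intro poly_mapping_eqI) (auto simp: lookup_update lookup_add lookup_single when_def in_keys_iff)
  then show ?case
    using update.IH by (simp add: distrib_left distrib_right scalar_def mult_single mult.commute)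
qed simp

lemma sum_swap_out:
  "(\<Sum>j\<in>S. \<Sum>l\<in>S' j. \<Sum>\<alpha>\<in>A. h j l \<alpha>) = (\<Sum>\<alpha>\<in>A. \<Sum>j\<in>S. \<Sum>l\<in>S' j. h j l \<alpha>)"
proof -
  have "(\<Sum>j\<in>S. \<Sum>l\<in>S' j. \<Sum>\<alpha>\<in>A. h j l \<alpha>) = (\<Sum>j\<in>S. \<Sum>\<alpha>\<in>A. \<Sum>l\<in>S' j. h j l \<alpha>)"
    by (intro sum.cong refl sum.swap)
  also have "\<dots> = (\<Sum>\<alpha>\<in>A. \<Sum>j\<in>S. \<Sum>l\<in>S' j. h j l \<alpha>)"
    by (rule sum.swap)
  finally show ?thesis .
qed

lemma inverse_square_mult: "(inverse z)\<^sup>2 * z = inverse (z :: complex)"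
  by (cases "z = 0") (simp_all add: power2_eq_square)

lemma inverse_difference_identity:
  fixes z w w' :: complex
  assumes "z \<noteq> w" "z \<noteq> w'"
  shows "inverse (z - w') - inverse (z - w) = inverse (z - w) * inverse (z - w') * (w' - w)"
  using assms by (simp add: divide_simps)

locale simply_laced_reading = simply_laced \<pi> d a
  for \<pi> :: "'i::finite \<Rightarrow> 'j::finite" and d :: "'i \<Rightarrow> nat" and a :: "'j \<Rightarrow> complex option" +
  assumes inj_a: "inj a"
begin

definition weyl_algebra :: "'i weyl_elt ring \<times> (complex \<Rightarrow> 'i weyl_elt)" where
  "weyl_algebra = (weyl, \<lambda>c. weyl_class (scalar c))"

lemma weyl_algebra_simps [simp]: "fst weyl_algebra = weyl" "snd weyl_algebra c = weyl_class (scalar c)"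
  by (simp_all add: weyl_algebra_def)

lemma complex_algebra_weyl: "complex_algebra weyl_algebra"
  unfolding complex_algebra_def weyl_algebra_simps
proof (intro conjI allI ballI)
  show "ring weyl" by (rule ring_weyl)
  show "weyl_class (scalar 1) = \<one>\<^bsub>weyl\<^esub>"
    using ring_hom_one [OF weyl_class_hom] by (simp add: scalar_one tensor_alg_simps)
  fix c c'
  show "weyl_class (scalar c) \<in> carrier weyl"
    by (intro weyl_class_closed scalar_closed)
  show "weyl_class (scalar (c + c')) = weyl_class (scalar c) \<oplus>\<^bsub>weyl\<^esub> weyl_class (scalar c')"
    by (simp add: weyl_class_add scalar_closed scalar_add)
  show "weyl_class (scalar (c * c')) = weyl_class (scalar c) \<otimes>\<^bsub>weyl\<^esub> weyl_class (scalar c')"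
    by (simp add: weyl_class_mult scalar_closed scalar_mult)
  fix X assume "X \<in> carrier weyl"
  then obtain z where z: "z \<in> carrier tensor_alg" "X = weyl_class z"
    using weyl_class_surj by blast
  show "X \<otimes>\<^bsub>weyl\<^esub> weyl_class (scalar c) = weyl_class (scalar c) \<otimes>\<^bsub>weyl\<^esub> X"
    unfolding z(2) weyl_class_mult [OF z(1) scalar_closed] weyl_class_mult [OF scalar_closed z(1)] scalar_central ..
qed

definition \<iota> :: "'i weyl_elt \<Rightarrow> 'i weyl_elt algebra_product" where
  "\<iota> = into_product weyl_algebra"

lemma \<iota>_inject: "X \<in> carrier weyl \<Longrightarrow> Y \<in> carrier weyl \<Longrightarrow> \<iota> X = \<iota> Y \<longleftrightarrow> X = Y"
  using into_product_inject [OF complex_algebra_weyl, of X Y] by (simp add: \<iota>_def)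

lemma \<iota>_zero: "\<iota> \<zero>\<^bsub>weyl\<^esub> = 0"
  using into_product_zero [OF complex_algebra_weyl] by (simp add: \<iota>_def)

lemma \<iota>_add: "X \<in> carrier weyl \<Longrightarrow> Y \<in> carrier weyl \<Longrightarrow> \<iota> (X \<oplus>\<^bsub>weyl\<^esub> Y) = \<iota> X + \<iota> Y"
  using into_product_add [OF complex_algebra_weyl, of X Y] by (simp add: \<iota>_def)

lemma \<iota>_mult: "X \<in> carrier weyl \<Longrightarrow> Y \<in> carrier weyl \<Longrightarrow> \<iota> (X \<otimes>\<^bsub>weyl\<^esub> Y) = \<iota> X * \<iota> Y"
  using into_product_mult [OF complex_algebra_weyl, of X Y] by (simp add: \<iota>_def)

lemma \<iota>_minus: "X \<in> carrier weyl \<Longrightarrow> \<iota> (\<ominus>\<^bsub>weyl\<^esub> X) = - \<iota> X"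
  using into_product_minus [OF complex_algebra_weyl, of X] by (simp add: \<iota>_def)

lemma \<iota>_scale: "X \<in> carrier weyl \<Longrightarrow> \<iota> (c \<cdot> X) = scale_product c (\<iota> X)"
  using into_product_scale [OF complex_algebra_weyl, of X c] by (simp add: \<iota>_def weyl_scale_def)

lemma \<iota>_finsum:
  "finite S \<Longrightarrow> (\<And>s. s \<in> S \<Longrightarrow> X s \<in> carrier weyl) \<Longrightarrow> \<iota> (\<Oplus>\<^bsub>weyl\<^esub>s\<in>S. X s) = (\<Sum>s\<in>S. \<iota> (X s))"
  using into_product_finsum [OF complex_algebra_weyl, of S X] by (simp add: \<iota>_def)

lemma scale_closed: "X \<in> carrier weyl \<Longrightarrow> c \<cdot> X \<in> carrier weyl"
  unfolding weyl_scale_def using complex_algebra_closed(4) [OF complex_algebra_weyl]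
  by (simp add: weyl_class_closed scalar_closed)

lemma finite_coords: "finite coords"
proof -
  let ?S = "SIGMA i:UNIV. {..<d i}"
  have "coords \<subseteq> (\<lambda>((i, p), (j, q)). Coord i p j q) ` (?S \<times> ?S)"
    by (force simp: coords_def)
  moreover have "finite (?S \<times> ?S)" by (intro finite_cartesian_product finite_SigmaI) auto
  ultimately show ?thesis by (rule finite_surj [rotated])
qed

text \<open>
  The generators of the ideal, specialised to the linear forms given by two coordinates.
\<close>

lemma weyl_relation:
  assumes X: "X \<in> coords" and Y: "Y \<in> coords"
  shows "letter X * letter Y - letter Y * letter X - scalar (coord_bracket X Y) \<in> weyl_ideal"
proof -
  interpret ring tensor_alg by (rule ring_tensor_alg)
  have lin: "lin (\<lambda>z. if z = Z then 1 else 0) = letter Z" if "Z \<in> coords" for Z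
  proof -
    have "lin (\<lambda>z. if z = Z then 1 else 0) = (\<Sum>z\<in>coords. if z = Z then letter Z else 0)"
      unfolding lin_def by (intro sum.cong refl) (simp add: scalar_one scalar_zero)
    then show ?thesis using that by (simp add: finite_coords)
  qed
  define \<delta> where "\<delta> Z z = (if z = Z then 1 else 0 :: complex)" for Z z :: "'i coord"
  have "poisson (\<delta> X) (\<delta> Y) = (\<Sum>z\<in>coords. if z = X then \<Sum>z'\<in>coords. if z' = Y then coord_bracket X Y else 0 else 0)"
    unfolding poisson_def \<delta>_def by (intro sum.cong refl) (auto intro!: sum.cong sum.neutral)
  then have poisson: "poisson (\<delta> X) (\<delta> Y) = coord_bracket X Y"
    using X Y by (simp add: finite_coords)
  have "lin (\<delta> X) * lin (\<delta> Y) - lin (\<delta> Y) * lin (\<delta> X) - scalar (poisson (\<delta> X) (\<delta> Y))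
      \<in> {lin f * lin g - lin g * lin f - scalar (poisson f g) | f g. True}"
    by blast
  then have "letter X * letter Y - letter Y * letter X - scalar (coord_bracket X Y)
      \<in> {lin f * lin g - lin g * lin f - scalar (poisson f g) | f g. True}"
    unfolding poisson unfolding \<delta>_def lin [OF X] lin [OF Y] .
  then show ?thesis
    unfolding weyl_ideal_def
    by (rule subsetD [OF genideal_self, rotated])
       (auto intro!: tensor_alg_diff_closed tensor_alg_mult_closed lin_closed scalar_closed)
qed

lemma \<iota>_relation:
  assumes X: "X \<in> coords" and Y: "Y \<in> coords"
  shows "br (\<iota> (weyl_class (letter X))) (\<iota> (weyl_class (letter Y))) = scale_product (coord_bracket X Y) (\<iota> \<one>\<^bsub>weyl\<^esub>)"
proof -
  interpret weyl: ring weyl by (rule ring_weyl)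
  note cl = letter_closed [OF X] letter_closed [OF Y] scalar_closed [of "coord_bracket X Y"]
  have "weyl_class (letter X) \<otimes>\<^bsub>weyl\<^esub> weyl_class (letter Y)
      = weyl_class (letter Y) \<otimes>\<^bsub>weyl\<^esub> weyl_class (letter X) \<oplus>\<^bsub>weyl\<^esub> coord_bracket X Y \<cdot> \<one>\<^bsub>weyl\<^esub>"
    using weyl_relation [OF X Y] cl
    by (simp add: weyl_class_mult weyl_class_add weyl_class_eq_iff tensor_alg_mult_closed tensor_alg_add_closed
        weyl_scale_def weyl_class_closed diff_diff_eq)
  then have "\<iota> (weyl_class (letter X) \<otimes>\<^bsub>weyl\<^esub> weyl_class (letter Y))
      = \<iota> (weyl_class (letter Y) \<otimes>\<^bsub>weyl\<^esub> weyl_class (letter X) \<oplus>\<^bsub>weyl\<^esub> coord_bracket X Y \<cdot> \<one>\<^bsub>weyl\<^esub>)"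
    by simp
  then show ?thesis
    using cl by (simp add: \<iota>_mult \<iota>_add \<iota>_scale scale_closed weyl_class_closed br_def)
qed

definition index :: "('i \<times> nat) set" where
  "index = (SIGMA i:UNIV. {..<d i})"

definition coordinate :: "'i \<times> nat \<Rightarrow> 'i \<times> nat \<Rightarrow> 'i weyl_elt algebra_product" where
  "coordinate \<alpha> \<beta> = (if \<pi> (fst \<alpha>) \<noteq> \<pi> (fst \<beta>) \<and> \<alpha> \<in> index \<and> \<beta> \<in> index
     then \<iota> (B (fst \<alpha>) (fst \<beta>) (snd \<alpha>) (snd \<beta>)) else 0)"

definition x_coord :: "'j \<Rightarrow> complex" where
  "x_coord P = (case a P of None \<Rightarrow> 1 | Some z \<Rightarrow> z)"

definition y_coord :: "'j \<Rightarrow> complex" where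
  "y_coord P = (case a P of None \<Rightarrow> 0 | Some z \<Rightarrow> 1)"

text \<open>
  The negative of the coefficient of \<open>t i\<close> in \<open>cf i j t\<close>, for \<open>i\<close> and \<open>j\<close> in the parts \<open>P\<close> and \<open>P'\<close>.
\<close>

definition kap :: "'j \<Rightarrow> 'j \<Rightarrow> complex" where
  "kap P P' = (case (a P, a P') of
      (Some z, Some w) \<Rightarrow> (inverse (z - w))\<^sup>2
    | (None, Some w) \<Rightarrow> w
    | (_, None) \<Rightarrow> 0)"

lemma a_distinct: "P \<noteq> P' \<Longrightarrow> a P \<noteq> a P'"
  using inj_a by (auto dest: injD)

lemma B_closed: "\<lbrakk>\<pi> i \<noteq> \<pi> j; p < d i; q < d j\<rbrakk> \<Longrightarrow> B i j p q \<in> carrier weyl"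
  by (rule weyl_le_closed [OF B_le])

lemma \<phi>_eq: "\<pi> i \<noteq> \<pi> j \<Longrightarrow> inverse (x_coord (\<pi> i) * y_coord (\<pi> j) - x_coord (\<pi> j) * y_coord (\<pi> i)) = \<phi> i j"
  using a_distinct [of "\<pi> i" "\<pi> j"] by (auto simp: x_coord_def y_coord_def \<phi>_def split: option.splits)

sublocale rel: node_relations scale_product index "\<pi> \<circ> fst" x_coord y_coord coordinate "\<iota> \<one>\<^bsub>weyl\<^esub>" kap fst \<pi>
proof
  interpret weyl: ring weyl by (rule ring_weyl)
  show "finite index"
    unfolding index_def by (intro finite_SigmaI) auto
  fix P P' :: 'j assume "P \<noteq> P'"
  then show "x_coord P * y_coord P' \<noteq> x_coord P' * y_coord P"
    using a_distinct [of P P'] by (auto simp: x_coord_def y_coord_def split: option.splits)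
next
  interpret weyl: ring weyl by (rule ring_weyl)
  fix \<alpha> \<beta> :: "'i \<times> nat"
  show "coordinate \<alpha> \<beta> = 0" if "(\<pi> \<circ> fst) \<alpha> = (\<pi> \<circ> fst) \<beta>"
    using that by (simp add: coordinate_def)
  show "\<iota> \<one>\<^bsub>weyl\<^esub> * coordinate \<alpha> \<beta> = coordinate \<alpha> \<beta>" "coordinate \<alpha> \<beta> * \<iota> \<one>\<^bsub>weyl\<^esub> = coordinate \<alpha> \<beta>"
    by (auto simp: coordinate_def index_def B_closed simp flip: \<iota>_mult)
  show "(\<pi> \<circ> fst) \<alpha> = \<pi> (fst \<alpha>)" by simp
  fix \<gamma> \<delta> assume K: "\<alpha> \<in> index" "\<beta> \<in> index" "\<gamma> \<in> index" "\<delta> \<in> index"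
  obtain i p j q where \<alpha>\<beta>: "\<alpha> = (i, p)" "\<beta> = (j, q)" by (cases \<alpha>, cases \<beta>)
  obtain m r l s where \<gamma>\<delta>: "\<gamma> = (m, r)" "\<delta> = (l, s)" by (cases \<gamma>, cases \<delta>)
  let ?c = "if \<alpha> = \<delta> \<and> \<beta> = \<gamma>
    then x_coord ((\<pi> \<circ> fst) \<alpha>) * y_coord ((\<pi> \<circ> fst) \<beta>) - x_coord ((\<pi> \<circ> fst) \<beta>) * y_coord ((\<pi> \<circ> fst) \<alpha>) else 0"
  have "br (coordinate \<alpha> \<beta>) (coordinate \<gamma> \<delta>) = scale_product ?c (\<iota> \<one>\<^bsub>weyl\<^esub>)"
  proof (cases "\<pi> i \<noteq> \<pi> j \<and> \<pi> m \<noteq> \<pi> l")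
    case True
    have "Coord i p j q \<in> coords" "Coord m r l s \<in> coords"
      using K True \<alpha>\<beta> \<gamma>\<delta> by (auto simp: coords_def index_def)
    moreover have "coord_bracket (Coord i p j q) (Coord m r l s) = ?c"
      using \<phi>_eq [of i j, symmetric] True \<alpha>\<beta> \<gamma>\<delta> by auto
    ultimately show ?thesis
      using \<iota>_relation [of "Coord i p j q" "Coord m r l s"] K True \<alpha>\<beta> \<gamma>\<delta>
      by (simp add: coordinate_def B_def)
  next
    case False
    then show ?thesis using \<alpha>\<beta> \<gamma>\<delta> by (auto simp: coordinate_def)
  qed
  then show "br (coordinate \<alpha> \<beta>) (coordinate \<gamma> \<delta>) =
      (if \<alpha> = \<delta> \<and> \<beta> = \<gamma>
       then scale_product (x_coord ((\<pi> \<circ> fst) \<alpha>) * y_coord ((\<pi> \<circ> fst) \<beta>) - x_coord ((\<pi> \<circ> fst) \<beta>) * y_coord ((\<pi> \<circ> fst) \<alpha>)) (\<iota> \<one>\<^bsub>weyl\<^esub>)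
       else 0)" by simp
next
  fix P P' P'' :: 'j assume "P \<noteq> P'" "P \<noteq> P''" "P' \<noteq> P''"
  then have "a P \<noteq> a P'" "a P \<noteq> a P''" "a P' \<noteq> a P''" by (simp_all add: a_distinct)
  then show "kap P P'' * (x_coord P * y_coord P'' - x_coord P'' * y_coord P) - kap P P' * (x_coord P * y_coord P' - x_coord P' * y_coord P)
    = inverse (x_coord P * y_coord P' - x_coord P' * y_coord P) * inverse (x_coord P * y_coord P'' - x_coord P'' * y_coord P)
      * (x_coord P'' * y_coord P' - x_coord P' * y_coord P'')"
    by (auto simp: kap_def x_coord_def y_coord_def inverse_square_mult inverse_difference_identity
        simp del: power_inverse split: option.splits)
qed

end

section \<open>The quantum Hamiltonians as sums of words\<close>

notation scale_product (infixr \<open>\<odot>\<close> 75)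

context simply_laced_reading
begin

abbreviation "e \<equiv> \<iota> \<one>\<^bsub>weyl\<^esub>"
abbreviation "b \<equiv> coordinate"
abbreviation "basis \<equiv> rel.basis"
abbreviation "H \<equiv> quantum_hamiltonian"

lemma basis_eq: "basis i = Pair i ` {..<d i}"
  unfolding rel.basis_def by (auto simp: index_def)

lemma sum_basis: "(\<Sum>\<alpha>\<in>basis i. g \<alpha>) = (\<Sum>p<d i. g (i, p))"
  unfolding basis_eq by (subst sum.reindex) (auto simp: inj_on_def)

lemma sum_index: "(\<Sum>\<alpha>\<in>index. g \<alpha>) = (\<Sum>i\<in>UNIV. \<Sum>\<alpha>\<in>basis i. g \<alpha>)"
  unfolding sum_basis unfolding index_def by (subst sum.Sigma) (auto simp: case_prod_beta)

lemma sum_index_others: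
  assumes "\<And>\<eta>. \<eta> \<in> index \<Longrightarrow> \<pi> (fst \<eta>) = \<pi> i \<Longrightarrow> g \<eta> = 0"
  shows "(\<Sum>\<eta>\<in>index. g \<eta>) = (\<Sum>j\<in>others i. \<Sum>\<eta>\<in>basis j. g \<eta>)"
  unfolding sum_index using assms
  by (intro sum.mono_neutral_right) (auto simp: others_def rel.basis_def intro!: sum.neutral)

lemma b_eq: "\<pi> i \<noteq> \<pi> j \<Longrightarrow> p < d i \<Longrightarrow> q < d j \<Longrightarrow> b (i, p) (j, q) = \<iota> (B i j p q)"
  by (simp add: coordinate_def index_def)

lemma f_eq: "\<pi> i \<noteq> \<pi> j \<Longrightarrow> \<alpha> \<in> basis i \<Longrightarrow> \<beta> \<in> basis j \<Longrightarrow> rel.f \<alpha> \<beta> = \<phi> i j"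
  by (simp add: rel.f_def rel.u_def rel.basis_def \<phi>_eq)

lemma f_eq_others:
  "\<alpha> \<in> basis i \<Longrightarrow> \<beta> \<in> basis j \<Longrightarrow> j \<in> others i \<Longrightarrow> rel.f \<alpha> \<beta> = \<phi> i j"
  "\<beta> \<in> basis j \<Longrightarrow> \<alpha> \<in> basis i \<Longrightarrow> j \<in> others i \<Longrightarrow> rel.f \<beta> \<alpha> = \<phi> j i"
  by (intro f_eq; force simp: others_def)+

lemma weyl_mult_closed: "X \<in> carrier weyl \<Longrightarrow> Y \<in> carrier weyl \<Longrightarrow> X \<otimes>\<^bsub>weyl\<^esub> Y \<in> carrier weyl"
  and weyl_add_closed: "X \<in> carrier weyl \<Longrightarrow> Y \<in> carrier weyl \<Longrightarrow> X \<oplus>\<^bsub>weyl\<^esub> Y \<in> carrier weyl"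
  using complex_algebra_closed [OF complex_algebra_weyl] by auto

lemma weyl_finsum_closed: "(\<And>s. s \<in> S \<Longrightarrow> X s \<in> carrier weyl) \<Longrightarrow> (\<Oplus>\<^bsub>weyl\<^esub>s\<in>S. X s) \<in> carrier weyl"
  using abelian_monoid.finsum_closed [of weyl X S] ring.is_abelian_group [OF ring_weyl]
  by (auto simp: abelian_group_def)

lemma Tr2_closed: "\<pi> i \<noteq> \<pi> j \<Longrightarrow> Tr2 i j \<in> carrier weyl"
  and Tr4_closed: "\<pi> i \<noteq> \<pi> j \<Longrightarrow> \<pi> j \<noteq> \<pi> m \<Longrightarrow> \<pi> m \<noteq> \<pi> l \<Longrightarrow> \<pi> l \<noteq> \<pi> i \<Longrightarrow> Tr4 i j m l \<in> carrier weyl"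
  by (auto intro: weyl_le_closed Tr2_le Tr4_le)

definition represents :: "'i weyl_elt \<Rightarrow> 'i weyl_elt algebra_product \<Rightarrow> bool" where
  "represents X Y \<longleftrightarrow> X \<in> carrier weyl \<and> \<iota> X = Y"

lemma represents_mult: "represents X Y \<Longrightarrow> represents X' Y' \<Longrightarrow> represents (X \<otimes>\<^bsub>weyl\<^esub> X') (Y * Y')"
  and represents_add: "represents X Y \<Longrightarrow> represents X' Y' \<Longrightarrow> represents (X \<oplus>\<^bsub>weyl\<^esub> X') (Y + Y')"
  and represents_scale: "represents X Y \<Longrightarrow> represents (c \<cdot> X) (c \<odot> Y)"
  by (auto simp: represents_def weyl_mult_closed weyl_add_closed scale_closed \<iota>_mult \<iota>_add \<iota>_scale)

lemma represents_finsum: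
  "finite S \<Longrightarrow> (\<And>s. s \<in> S \<Longrightarrow> represents (X s) (Y s)) \<Longrightarrow> represents (\<Oplus>\<^bsub>weyl\<^esub>s\<in>S. X s) (\<Sum>s\<in>S. Y s)"
  unfolding represents_def by (auto simp: \<iota>_finsum intro!: weyl_finsum_closed sum.cong)

lemma represents_B: "\<pi> i \<noteq> \<pi> j \<Longrightarrow> p < d i \<Longrightarrow> q < d j \<Longrightarrow> represents (B i j p q) (b (i, p) (j, q))"
  by (simp add: represents_def B_closed b_eq)

lemma represents_Tr2:
  assumes "\<pi> i \<noteq> \<pi> j"
  shows "represents (Tr2 i j) (\<Sum>\<alpha>\<in>basis i. \<Sum>\<beta>\<in>basis j. b \<alpha> \<beta> * b \<beta> \<alpha>)"
  unfolding Tr2_def sum_basis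
  by (intro represents_finsum represents_mult represents_B) (use assms in auto)

lemma represents_Tr3:
  assumes "\<pi> i \<noteq> \<pi> j" "\<pi> j \<noteq> \<pi> m" "\<pi> m \<noteq> \<pi> i"
  shows "represents (Tr3 i j m) (\<Sum>\<alpha>\<in>basis i. \<Sum>\<beta>\<in>basis j. \<Sum>\<gamma>\<in>basis m. b \<alpha> \<beta> * b \<beta> \<gamma> * b \<gamma> \<alpha>)"
  unfolding Tr3_def sum_basis
  by (intro represents_finsum represents_mult represents_B) (use assms in auto)

lemma represents_Tr4:
  assumes "\<pi> i \<noteq> \<pi> j" "\<pi> j \<noteq> \<pi> m" "\<pi> m \<noteq> \<pi> l" "\<pi> l \<noteq> \<pi> i"
  shows "represents (Tr4 i j m l) (\<Sum>\<alpha>\<in>basis i. \<Sum>\<beta>\<in>basis j. \<Sum>\<gamma>\<in>basis m. \<Sum>\<delta>\<in>basis l.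
      b \<alpha> \<beta> * b \<beta> \<gamma> * b \<gamma> \<delta> * b \<delta> \<alpha>)"
  unfolding Tr4_def sum_basis
  by (intro represents_finsum represents_mult represents_B) (use assms in auto)

lemma representsD: "represents X Y \<Longrightarrow> X \<in> carrier weyl" "represents X Y \<Longrightarrow> \<iota> X = Y"
  by (simp_all add: represents_def)

lemma represents_\<iota>: "X \<in> carrier weyl \<Longrightarrow> represents X (\<iota> X)"
  by (simp add: represents_def)

lemma \<iota>_H3: "\<iota> (H3 i) = rel.node_h3 i"
proof -
  have "\<iota> (H3 i) = (\<Sum>j\<in>others i. \<Sum>l\<in>{l \<in> others i. \<pi> j \<noteq> \<pi> l}.
      (\<phi> i l * \<phi> j i) \<odot> (\<Sum>\<alpha>\<in>basis i. \<Sum>\<eta>\<in>basis l. \<Sum>\<xi>\<in>basis j. b \<alpha> \<eta> * b \<eta> \<xi> * b \<xi> \<alpha>))"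
    unfolding H3_def
    by (intro representsD(2) represents_finsum represents_scale represents_Tr3) (auto simp: others_def)
  also have "\<dots> = (\<Sum>j\<in>others i. \<Sum>l\<in>{l \<in> others i. \<pi> j \<noteq> \<pi> l}.
      \<Sum>\<alpha>\<in>basis i. \<Sum>\<eta>\<in>basis l. \<Sum>\<xi>\<in>basis j. (rel.f \<alpha> \<eta> * rel.f \<xi> \<alpha>) \<odot> (b \<alpha> \<eta> * b \<eta> \<xi> * b \<xi> \<alpha>))"
    unfolding product_algebra.scale_sum_right
    by (intro sum.cong refl) (simp add: f_eq_others)
  also have "\<dots> = (\<Sum>\<alpha>\<in>basis i. \<Sum>j\<in>others i. \<Sum>l\<in>{l \<in> others i. \<pi> j \<noteq> \<pi> l}.
      \<Sum>\<eta>\<in>basis l. \<Sum>\<xi>\<in>basis j. (rel.f \<alpha> \<eta> * rel.f \<xi> \<alpha>) \<odot> (b \<alpha> \<eta> * b \<eta> \<xi> * b \<xi> \<alpha>))"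
    by (rule sum_swap_out)
  also have "\<dots> = rel.node_h3 i"
    unfolding rel.node_h3_def
  proof (intro sum.cong refl)
    fix \<alpha> assume \<alpha>: "\<alpha> \<in> basis i"
    define g where "g \<eta> \<xi> = (rel.f \<alpha> \<eta> * rel.f \<xi> \<alpha>) \<odot> (b \<alpha> \<eta> * b \<eta> \<xi> * b \<xi> \<alpha>)" for \<eta> \<xi>
    have zero: "g \<eta> \<xi> = 0" if "\<pi> (fst \<eta>) = \<pi> i \<or> \<pi> (fst \<xi>) = \<pi> i \<or> \<pi> (fst \<eta>) = \<pi> (fst \<xi>)" for \<eta> \<xi>
      using that \<alpha> by (auto simp: g_def coordinate_def rel.basis_def)
    have "rel.G \<alpha> = (\<Sum>\<eta>\<in>index. \<Sum>\<xi>\<in>index. g \<eta> \<xi>)"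
      by (simp add: rel.G_eq g_def)
    also have "\<dots> = (\<Sum>\<xi>\<in>index. \<Sum>\<eta>\<in>index. g \<eta> \<xi>)"
      by (rule sum.swap)
    also have "\<dots> = (\<Sum>j\<in>others i. \<Sum>\<xi>\<in>basis j. \<Sum>\<eta>\<in>index. g \<eta> \<xi>)"
      by (rule sum_index_others) (simp add: zero)
    also have "\<dots> = (\<Sum>j\<in>others i. \<Sum>\<eta>\<in>index. \<Sum>\<xi>\<in>basis j. g \<eta> \<xi>)"
      by (intro sum.cong refl sum.swap)
    also have "\<dots> = (\<Sum>j\<in>others i. \<Sum>l\<in>others i. \<Sum>\<eta>\<in>basis l. \<Sum>\<xi>\<in>basis j. g \<eta> \<xi>)"
      by (intro sum.cong refl sum_index_others) (simp add: zero)
    also have "\<dots> = (\<Sum>j\<in>others i. \<Sum>l\<in>{l \<in> others i. \<pi> j \<noteq> \<pi> l}. \<Sum>\<eta>\<in>basis l. \<Sum>\<xi>\<in>basis j. g \<eta> \<xi>)"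
      by (intro sum.cong refl sum.mono_neutral_right) (auto intro!: sum.neutral zero simp: rel.basis_def)
    finally show "(\<Sum>j\<in>others i. \<Sum>l\<in>{l \<in> others i. \<pi> j \<noteq> \<pi> l}.
      \<Sum>\<eta>\<in>basis l. \<Sum>\<xi>\<in>basis j. (rel.f \<alpha> \<eta> * rel.f \<xi> \<alpha>) \<odot> (b \<alpha> \<eta> * b \<eta> \<xi> * b \<xi> \<alpha>)) = rel.G \<alpha>"
      by (simp add: g_def)
  qed
  finally show ?thesis .
qed

lemma cf_eq:
  assumes "\<pi> i \<noteq> \<pi> j"
  shows "cf i j t = t j * (\<phi> i j)\<^sup>2 - t i * kap (\<pi> i) (\<pi> j)"
  using a_distinct [OF assms]
  by (auto simp: cf_def kap_def \<phi>_def algebra_simps split: option.splits)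

lemma coeff_eq:
  assumes "\<pi> i \<noteq> \<pi> j" "\<alpha> \<in> basis i" "\<beta> \<in> basis j"
  shows "rel.coeff (\<lambda>\<eta>. t (fst \<eta>)) \<alpha> \<beta> = cf i j t"
  unfolding cf_eq [OF assms(1)] rel.coeff_def rel.k_def f_eq [OF assms]
  using assms(2,3) by (simp add: rel.basis_def)

lemma \<iota>_H2: "\<exists>c. \<iota> (H2 i t) = rel.node_h2 t i + c \<odot> e"
proof -
  define c where "c = (\<Sum>j\<in>others i. - (cf i j t / 2) * (\<Sum>\<alpha>\<in>basis i. \<Sum>\<beta>\<in>basis j. rel.u \<alpha> \<beta>))"
  define T where "T j = (\<Sum>\<alpha>\<in>basis i. \<Sum>\<beta>\<in>basis j. rel.N \<alpha> \<beta>)" for j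
  have "\<iota> (H2 i t) = (\<Sum>j\<in>others i. (cf i j t / 2) \<odot> (\<iota> (Tr2 i j) + \<iota> (Tr2 j i)))"
    unfolding H2_def
    by (intro representsD(2) represents_finsum represents_scale represents_add represents_\<iota> Tr2_closed)
       (auto simp: others_def)
  also have "\<dots> = (\<Sum>j\<in>others i. cf i j t \<odot> T j + (- (cf i j t / 2) * (\<Sum>\<alpha>\<in>basis i. \<Sum>\<beta>\<in>basis j. rel.u \<alpha> \<beta>)) \<odot> e)"
  proof (intro sum.cong refl)
    fix j assume "j \<in> others i"
    then have j: "\<pi> i \<noteq> \<pi> j" "\<pi> j \<noteq> \<pi> i" by (auto simp: others_def)
    have "\<iota> (Tr2 j i) = (\<Sum>\<alpha>\<in>basis i. \<Sum>\<beta>\<in>basis j. rel.N \<beta> \<alpha>)"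
      unfolding representsD(2) [OF represents_Tr2 [OF j(2)]] rel.N_def by (rule sum.swap)
    also have "\<dots> = (\<Sum>\<alpha>\<in>basis i. \<Sum>\<beta>\<in>basis j. rel.N \<alpha> \<beta> + (- rel.u \<alpha> \<beta>) \<odot> e)"
      by (intro sum.cong refl, subst rel.N_swap) (auto simp: rel.basis_def)
    also have "\<dots> = T j + (- (\<Sum>\<alpha>\<in>basis i. \<Sum>\<beta>\<in>basis j. rel.u \<alpha> \<beta>)) \<odot> e"
      by (simp add: T_def sum.distrib product_algebra.scale_sum_left sum_negf sum_subtractf)
    finally have 1: "\<iota> (Tr2 j i) = \<dots>" .
    have 2: "\<iota> (Tr2 i j) = T j"
      by (simp add: representsD(2) [OF represents_Tr2 [OF j(1)]] T_def rel.N_def)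
    have half: "(cf i j t / 2) \<odot> (T j + T j) = cf i j t \<odot> T j"
      unfolding product_algebra.scale_right_distrib product_algebra.scale_left_distrib [symmetric] by simp
    show "(cf i j t / 2) \<odot> (\<iota> (Tr2 i j) + \<iota> (Tr2 j i))
       = cf i j t \<odot> T j + (- (cf i j t / 2) * (\<Sum>\<alpha>\<in>basis i. \<Sum>\<beta>\<in>basis j. rel.u \<alpha> \<beta>)) \<odot> e"
      unfolding 1 2 add.assoc [symmetric] product_algebra.scale_right_distrib [of _ "T j + T j"] half by simp
  qed
  also have "\<dots> = (\<Sum>j\<in>others i. cf i j t \<odot> T j) + c \<odot> e"
    by (simp only: sum.distrib c_def product_algebra.scale_sum_left)
  also have "(\<Sum>j\<in>others i. cf i j t \<odot> T j) = (\<Sum>j\<in>others i. \<Sum>\<alpha>\<in>basis i. \<Sum>\<beta>\<in>basis j.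
      rel.coeff (\<lambda>\<eta>. t (fst \<eta>)) \<alpha> \<beta> \<odot> rel.N \<alpha> \<beta>)"
    unfolding T_def product_algebra.scale_sum_right
    by (intro sum.cong refl arg_cong2 [where f = scale_product] coeff_eq [symmetric]) (auto simp: others_def)
  also have "\<dots> = (\<Sum>\<alpha>\<in>basis i. \<Sum>j\<in>others i. \<Sum>\<beta>\<in>basis j. rel.coeff (\<lambda>\<eta>. t (fst \<eta>)) \<alpha> \<beta> \<odot> rel.N \<alpha> \<beta>)"
    by (rule sum.swap)
  also have "\<dots> = rel.node_h2 t i"
    unfolding rel.node_h2_def rel.h2_def rel.Q_def
    by (intro sum.cong refl sum_index_others [symmetric]) (auto simp: rel.N_def coordinate_def rel.basis_def)
  finally show ?thesis by blast
qed

text \<open>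
  The coefficient of \<open>1 / (t i - t m)\<close> in the quartic part of the Hamiltonian of \<open>i\<close>.
\<close>

definition W :: "'i \<Rightarrow> 'i \<Rightarrow> 'i weyl_elt" where
  "W i m = (\<Oplus>\<^bsub>weyl\<^esub>j\<in>others i. \<Oplus>\<^bsub>weyl\<^esub>l\<in>others i - {j}. (\<phi> i j * \<phi> i l) \<cdot> Tr4 i j m l)
      \<oplus>\<^bsub>weyl\<^esub> (\<Oplus>\<^bsub>weyl\<^esub>j\<in>others i. (\<phi> i j)\<^sup>2 \<cdot> Tr4 j m j i)"

lemma W_le: "m \<in> siblings i \<Longrightarrow> W i m \<in> weyl_le 4"
  unfolding W_def
  by (intro weyl_le_sum weyl_le_add weyl_le_scale Tr4_le) (auto simp: others_def siblings_def)

lemma W_closed: "m \<in> siblings i \<Longrightarrow> W i m \<in> carrier weyl"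
  by (rule weyl_le_closed [OF W_le])

lemma \<iota>_W_sum:
  assumes "m \<in> siblings i"
  shows "\<iota> (W i m) = (\<Sum>j\<in>others i. \<Sum>l\<in>others i - {j}. (\<phi> i j * \<phi> i l) \<odot> \<iota> (Tr4 i j m l))
     + (\<Sum>j\<in>others i. (\<phi> i j)\<^sup>2 \<odot> \<iota> (Tr4 j m j i))"
  unfolding W_def
  by (intro representsD(2) represents_finsum represents_scale represents_add represents_\<iota> Tr4_closed)
     (use assms in \<open>auto simp: others_def siblings_def\<close>)

lemma H4_eq: "H4 i t = (\<Oplus>\<^bsub>weyl\<^esub>m\<in>siblings i. inverse (t i - t m) \<cdot> W i m)"
proof -
  have H4: "H4 i t \<in> carrier weyl"
    unfolding H4_def
    by (rule weyl_le_closed [of _ 4], intro weyl_le_sum weyl_le_add weyl_le_scale Tr4_le) (auto simp: others_def siblings_def)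
  have "\<iota> (H4 i t) = (\<Sum>m\<in>siblings i.
      (\<Sum>j\<in>others i. \<Sum>l\<in>others i - {j}. (\<phi> i j * \<phi> i l / (t i - t m)) \<odot> \<iota> (Tr4 i j m l))
     + (\<Sum>j\<in>others i. ((\<phi> i j)\<^sup>2 / (t i - t m)) \<odot> \<iota> (Tr4 j m j i)))"
    unfolding H4_def
    by (intro representsD(2) represents_finsum represents_scale represents_add represents_\<iota> Tr4_closed)
       (auto simp: others_def siblings_def)
  also have "\<dots> = (\<Sum>m\<in>siblings i. inverse (t i - t m) \<odot> \<iota> (W i m))"
    by (intro sum.cong refl)
       (simp add: \<iota>_W_sum product_algebra.scale_right_distrib product_algebra.scale_sum_right divide_inverse mult.commute)
  also have "\<dots> = \<iota> (\<Oplus>\<^bsub>weyl\<^esub>m\<in>siblings i. inverse (t i - t m) \<cdot> W i m)"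
    by (intro representsD(2) [symmetric] represents_finsum represents_scale represents_\<iota> W_closed) auto
  finally show ?thesis
    using H4 by (subst (asm) \<iota>_inject) (auto intro!: weyl_finsum_closed scale_closed W_closed)
qed

definition W_const :: "'i \<Rightarrow> 'i \<Rightarrow> complex" where
  "W_const i m = (\<Sum>\<alpha>\<in>basis i. \<Sum>\<mu>\<in>basis m. - (\<Sum>\<eta>\<in>index. rel.f \<mu> \<eta> * rel.u \<eta> \<mu>))"

lemma W_const_swap: "\<pi> i = \<pi> m \<Longrightarrow> W_const i m = W_const m i"
proof -
  assume \<pi>: "\<pi> i = \<pi> m"
  have "(\<Sum>\<eta>\<in>index. rel.f \<mu> \<eta> * rel.u \<eta> \<mu>) = (\<Sum>\<eta>\<in>index. rel.f \<alpha> \<eta> * rel.u \<eta> \<alpha>)"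
    if "\<alpha> \<in> basis i" "\<mu> \<in> basis m" for \<alpha> \<mu>
  proof -
    have "rel.f \<mu> \<eta> = rel.f \<alpha> \<eta>" "rel.u \<eta> \<mu> = rel.u \<eta> \<alpha>" for \<eta>
      using that \<pi> by (auto intro!: rel.f_cong rel.u_cong simp: rel.basis_def)
    then show ?thesis by simp
  qed
  then show ?thesis
    unfolding W_const_def by (subst sum.swap) (simp cong: sum.cong)
qed

text \<open>
  A degenerate 4-cycle is moved from the order in which it occurs in \<open>E \<alpha> \<mu> * E \<mu> \<alpha>\<close> to the order that
  starts and ends at its centre.
\<close>

lemma reorder_word:
  assumes i: "\<alpha> \<in> basis i" "\<mu> \<in> basis m" "m \<in> siblings i" and j: "j \<in> others i" "\<eta> \<in> basis j" "\<xi> \<in> basis j"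
  shows "b \<alpha> \<eta> * b \<eta> \<mu> * b \<mu> \<xi> * b \<xi> \<alpha>
    = b \<eta> \<mu> * b \<mu> \<xi> * b \<xi> \<alpha> * b \<alpha> \<eta> + (if \<xi> = \<eta> then rel.u \<alpha> \<eta> \<odot> rel.N \<eta> \<mu> else 0)"
proof -
  have K: "\<alpha> \<in> index" "\<mu> \<in> index" "\<eta> \<in> index" "\<xi> \<in> index"
    using assms by (auto simp: rel.basis_def)
  have ne: "\<alpha> \<noteq> \<mu>" "\<alpha> \<noteq> \<xi>"
    using assms by (auto simp: rel.basis_def siblings_def others_def)
  have "br (b \<alpha> \<eta>) (b \<eta> \<mu>) = 0" "br (b \<alpha> \<eta>) (b \<mu> \<xi>) = 0"
    using K ne by (simp_all add: rel.br_b_u)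
  then have "br (b \<alpha> \<eta>) (b \<eta> \<mu> * b \<mu> \<xi> * b \<xi> \<alpha>) = (if \<xi> = \<eta> then rel.u \<alpha> \<eta> \<odot> rel.N \<eta> \<mu> else 0)"
    using K by (simp add: br_mult_right rel.br_b_u rel.N_def mult.assoc)
  then show ?thesis by (simp add: br_def mult.assoc algebra_simps)
qed

text \<open>
  By \<open>reorder_word\<close>, the prescribed order of the degenerate 4-cycles subtracts from \<open>E \<alpha> \<mu> * E \<mu> \<alpha>\<close> the
  sum of \<open>\<phi> \<mu> \<eta> * N \<eta> \<mu>\<close> over all \<open>\<eta>\<close>, and this is \<open>E \<mu> \<mu>\<close> up to a constant.
\<close>

lemma \<iota>_W:
  assumes m: "m \<in> siblings i"
  shows "\<iota> (W i m) = rel.node_\<Omega> i m + W_const i m \<odot> e"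
proof -
  define w where "w \<alpha> \<mu> \<eta> \<xi> = b \<alpha> \<eta> * b \<eta> \<mu> * b \<mu> \<xi> * b \<xi> \<alpha>" for \<alpha> \<mu> \<eta> \<xi>
  define w' where "w' \<alpha> \<mu> \<eta> \<xi> = b \<eta> \<mu> * b \<mu> \<xi> * b \<xi> \<alpha> * b \<alpha> \<eta>" for \<alpha> \<mu> \<eta> \<xi>
  let ?w = "\<lambda>\<alpha> \<mu> j l. \<Sum>\<eta>\<in>basis j. \<Sum>\<xi>\<in>basis l. w \<alpha> \<mu> \<eta> \<xi>"
  let ?w' = "\<lambda>\<alpha> \<mu> j. \<Sum>\<eta>\<in>basis j. \<Sum>\<xi>\<in>basis j. w' \<alpha> \<mu> \<eta> \<xi>"
  have \<pi>: "\<pi> m = \<pi> i" "m \<noteq> i" using m by (auto simp: siblings_def)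
  have 1: "(\<phi> i j * \<phi> i l) \<odot> \<iota> (Tr4 i j m l) = (\<Sum>\<alpha>\<in>basis i. \<Sum>\<mu>\<in>basis m.
      (\<phi> i j * \<phi> i l) \<odot> ?w \<alpha> \<mu> j l)"
    if "j \<in> others i" "l \<in> others i" for j l
  proof -
    have "\<iota> (Tr4 i j m l) = (\<Sum>\<alpha>\<in>basis i. \<Sum>\<eta>\<in>basis j. \<Sum>\<mu>\<in>basis m. \<Sum>\<xi>\<in>basis l. w \<alpha> \<mu> \<eta> \<xi>)"
      unfolding w_def by (rule representsD(2) [OF represents_Tr4]) (use that \<pi> in \<open>auto simp: others_def\<close>)
    also have "\<dots> = (\<Sum>\<alpha>\<in>basis i. \<Sum>\<mu>\<in>basis m. \<Sum>\<eta>\<in>basis j. \<Sum>\<xi>\<in>basis l. w \<alpha> \<mu> \<eta> \<xi>)"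
      by (intro sum.cong refl sum.swap)
    finally show ?thesis by (simp only: product_algebra.scale_sum_right)
  qed
  have 2: "(\<phi> i j)\<^sup>2 \<odot> \<iota> (Tr4 j m j i) = (\<Sum>\<alpha>\<in>basis i. \<Sum>\<mu>\<in>basis m.
      (\<phi> i j)\<^sup>2 \<odot> ?w' \<alpha> \<mu> j)"
    if "j \<in> others i" for j
  proof -
    have "\<iota> (Tr4 j m j i) = (\<Sum>\<eta>\<in>basis j. \<Sum>\<mu>\<in>basis m. \<Sum>\<xi>\<in>basis j. \<Sum>\<alpha>\<in>basis i. w' \<alpha> \<mu> \<eta> \<xi>)"
      unfolding w'_def by (rule representsD(2) [OF represents_Tr4]) (use that \<pi> in \<open>auto simp: others_def\<close>)
    also have "\<dots> = (\<Sum>\<mu>\<in>basis m. \<Sum>\<eta>\<in>basis j. \<Sum>\<xi>\<in>basis j. \<Sum>\<alpha>\<in>basis i. w' \<alpha> \<mu> \<eta> \<xi>)"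
      by (rule sum.swap)
    also have "\<dots> = (\<Sum>\<mu>\<in>basis m. \<Sum>\<alpha>\<in>basis i. \<Sum>\<eta>\<in>basis j. \<Sum>\<xi>\<in>basis j. w' \<alpha> \<mu> \<eta> \<xi>)"
      by (intro sum.cong refl sum_swap_out)
    also have "\<dots> = (\<Sum>\<alpha>\<in>basis i. \<Sum>\<mu>\<in>basis m. \<Sum>\<eta>\<in>basis j. \<Sum>\<xi>\<in>basis j. w' \<alpha> \<mu> \<eta> \<xi>)"
      by (rule sum.swap)
    finally show ?thesis by (simp only: product_algebra.scale_sum_right)
  qed
  define Z where "Z \<alpha> \<mu> = (\<Sum>j\<in>others i. \<Sum>l\<in>others i - {j}. (\<phi> i j * \<phi> i l) \<odot> ?w \<alpha> \<mu> j l)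
      + (\<Sum>j\<in>others i. (\<phi> i j)\<^sup>2 \<odot> ?w' \<alpha> \<mu> j)" for \<alpha> \<mu>
  have "\<iota> (W i m) = (\<Sum>\<alpha>\<in>basis i. \<Sum>\<mu>\<in>basis m. Z \<alpha> \<mu>)"
  proof -
    have "(\<Sum>j\<in>others i. \<Sum>l\<in>others i - {j}. (\<phi> i j * \<phi> i l) \<odot> \<iota> (Tr4 i j m l))
      = (\<Sum>j\<in>others i. \<Sum>l\<in>others i - {j}. \<Sum>\<alpha>\<in>basis i. \<Sum>\<mu>\<in>basis m.
          (\<phi> i j * \<phi> i l) \<odot> ?w \<alpha> \<mu> j l)"
      by (intro sum.cong refl 1) auto
    also have "\<dots> = (\<Sum>\<alpha>\<in>basis i. \<Sum>\<mu>\<in>basis m. \<Sum>j\<in>others i. \<Sum>l\<in>others i - {j}.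
          (\<phi> i j * \<phi> i l) \<odot> ?w \<alpha> \<mu> j l)"
      by (rule trans [OF sum_swap_out], intro sum.cong refl sum_swap_out)
    finally have 3: "(\<Sum>j\<in>others i. \<Sum>l\<in>others i - {j}. (\<phi> i j * \<phi> i l) \<odot> \<iota> (Tr4 i j m l)) = \<dots>" .
    have "(\<Sum>j\<in>others i. (\<phi> i j)\<^sup>2 \<odot> \<iota> (Tr4 j m j i)) = (\<Sum>j\<in>others i. \<Sum>\<alpha>\<in>basis i. \<Sum>\<mu>\<in>basis m.
        (\<phi> i j)\<^sup>2 \<odot> ?w' \<alpha> \<mu> j)"
      by (intro sum.cong refl 2)
    also have "\<dots> = (\<Sum>\<alpha>\<in>basis i. \<Sum>\<mu>\<in>basis m. \<Sum>j\<in>others i.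
        (\<phi> i j)\<^sup>2 \<odot> ?w' \<alpha> \<mu> j)"
      by (rule trans [OF sum.swap], intro sum.cong refl sum.swap)
    finally have 4: "(\<Sum>j\<in>others i. (\<phi> i j)\<^sup>2 \<odot> \<iota> (Tr4 j m j i)) = \<dots>" .
    show ?thesis unfolding \<iota>_W_sum [OF m] 3 4 Z_def sum.distrib ..
  qed
  also have "\<dots> = (\<Sum>\<alpha>\<in>basis i. \<Sum>\<mu>\<in>basis m. rel.\<Omega> \<alpha> \<mu> + (- (\<Sum>\<eta>\<in>index. rel.f \<mu> \<eta> * rel.u \<eta> \<mu>)) \<odot> e)"
  proof (intro sum.cong refl)
    fix \<alpha> \<mu> assume \<alpha>: "\<alpha> \<in> basis i" and \<mu>: "\<mu> \<in> basis m"
    have f: "rel.f \<mu> \<eta> = rel.f \<alpha> \<eta>" for \<eta>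
      using \<alpha> \<mu> \<pi> by (intro rel.f_cong) (auto simp: rel.basis_def)
    have zero: "w \<alpha> \<mu> \<eta> \<xi> = 0" if "\<pi> (fst \<eta>) = \<pi> i \<or> \<pi> (fst \<xi>) = \<pi> i" for \<eta> \<xi>
      using that \<alpha> by (auto simp: w_def coordinate_def rel.basis_def)
    define g where "g \<eta> \<xi> = (rel.f \<alpha> \<eta> * rel.f \<alpha> \<xi>) \<odot> w \<alpha> \<mu> \<eta> \<xi>" for \<eta> \<xi>
    \<comment> \<open>words through the nodes \<open>j\<close> and \<open>l\<close>; the 4-cycle is degenerate if \<open>j = l\<close>\<close>
    have block: "(\<Sum>\<eta>\<in>basis j. \<Sum>\<xi>\<in>basis l. g \<eta> \<xi>) = (\<phi> i j * \<phi> i l) \<odot> ?w \<alpha> \<mu> j l"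
      if "j \<in> others i" "l \<in> others i" for j l
      unfolding product_algebra.scale_sum_right g_def
      by (intro sum.cong refl) (use that \<alpha> in \<open>simp add: f_eq_others\<close>)
    have diagonal: "(\<Sum>\<eta>\<in>basis j. \<Sum>\<xi>\<in>basis j. g \<eta> \<xi>)
        = (\<phi> i j)\<^sup>2 \<odot> ?w' \<alpha> \<mu> j + (\<Sum>\<eta>\<in>basis j. rel.f \<mu> \<eta> \<odot> rel.N \<eta> \<mu>)"
      if j: "j \<in> others i" for j
    proof -
      have "(\<Sum>\<xi>\<in>basis j. w \<alpha> \<mu> \<eta> \<xi>) = (\<Sum>\<xi>\<in>basis j. w' \<alpha> \<mu> \<eta> \<xi>) + rel.u \<alpha> \<eta> \<odot> rel.N \<eta> \<mu>"
        if \<eta>: "\<eta> \<in> basis j" for \<eta>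
      proof -
        have "(\<Sum>\<xi>\<in>basis j. w \<alpha> \<mu> \<eta> \<xi>) = (\<Sum>\<xi>\<in>basis j. w' \<alpha> \<mu> \<eta> \<xi> + (if \<xi> = \<eta> then rel.u \<alpha> \<eta> \<odot> rel.N \<eta> \<mu> else 0))"
          unfolding w_def w'_def using \<alpha> \<mu> m j \<eta> by (intro sum.cong refl reorder_word)
        then show ?thesis using \<eta> by (simp add: sum.distrib)
      qed
      then have "(\<Sum>\<eta>\<in>basis j. \<Sum>\<xi>\<in>basis j. g \<eta> \<xi>) = (\<phi> i j)\<^sup>2 \<odot> ?w' \<alpha> \<mu> j
          + (\<Sum>\<eta>\<in>basis j. ((\<phi> i j)\<^sup>2 * rel.u \<alpha> \<eta>) \<odot> rel.N \<eta> \<mu>)"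
        using block [OF j j]
        by (simp add: sum.distrib product_algebra.scale_right_distrib product_algebra.scale_sum_right power2_eq_square)
      also have "(\<Sum>\<eta>\<in>basis j. ((\<phi> i j)\<^sup>2 * rel.u \<alpha> \<eta>) \<odot> rel.N \<eta> \<mu>) = (\<Sum>\<eta>\<in>basis j. rel.f \<mu> \<eta> \<odot> rel.N \<eta> \<mu>)"
      proof (intro sum.cong refl)
        fix \<eta> assume \<eta>: "\<eta> \<in> basis j"
        have ne: "(\<pi> \<circ> fst) \<alpha> \<noteq> (\<pi> \<circ> fst) \<eta>" and "rel.f \<alpha> \<eta> = \<phi> i j"
          using \<alpha> \<eta> j f_eq [of i j \<alpha> \<eta>] by (auto simp: rel.basis_def others_def)
        then have "(\<phi> i j)\<^sup>2 * rel.u \<alpha> \<eta> = rel.f \<alpha> \<eta> * (rel.f \<alpha> \<eta> * rel.u \<alpha> \<eta>)"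
          by (simp add: power2_eq_square)
        also have "\<dots> = rel.f \<alpha> \<eta>" by (subst rel.f_u [OF ne]) simp
        finally show "((\<phi> i j)\<^sup>2 * rel.u \<alpha> \<eta>) \<odot> rel.N \<eta> \<mu> = rel.f \<mu> \<eta> \<odot> rel.N \<eta> \<mu>" by (simp add: f)
      qed
      finally show ?thesis .
    qed
    have "rel.E \<alpha> \<mu> * rel.E \<mu> \<alpha> = (\<Sum>\<eta>\<in>index. \<Sum>\<xi>\<in>index. g \<eta> \<xi>)"
      unfolding rel.E_def g_def w_def f
      by (simp add: sum_product mult.assoc mult.commute [where 'a = complex])
    also have "\<dots> = (\<Sum>j\<in>others i. \<Sum>\<eta>\<in>basis j. \<Sum>\<xi>\<in>index. g \<eta> \<xi>)"
      by (rule sum_index_others) (simp add: g_def zero)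
    also have "\<dots> = (\<Sum>j\<in>others i. \<Sum>\<xi>\<in>index. \<Sum>\<eta>\<in>basis j. g \<eta> \<xi>)"
      by (intro sum.cong refl sum.swap)
    also have "\<dots> = (\<Sum>j\<in>others i. \<Sum>l\<in>others i. \<Sum>\<xi>\<in>basis l. \<Sum>\<eta>\<in>basis j. g \<eta> \<xi>)"
      by (intro sum.cong refl sum_index_others) (simp add: g_def zero)
    also have "\<dots> = (\<Sum>j\<in>others i. \<Sum>l\<in>others i. \<Sum>\<eta>\<in>basis j. \<Sum>\<xi>\<in>basis l. g \<eta> \<xi>)"
      by (intro sum.cong refl sum.swap)
    also have "\<dots> = (\<Sum>j\<in>others i. (\<Sum>\<eta>\<in>basis j. \<Sum>\<xi>\<in>basis j. g \<eta> \<xi>)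
        + (\<Sum>l\<in>others i - {j}. \<Sum>\<eta>\<in>basis j. \<Sum>\<xi>\<in>basis l. g \<eta> \<xi>))"
      by (intro sum.cong refl sum.remove) auto
    also have "\<dots> = (\<Sum>j\<in>others i. ((\<phi> i j)\<^sup>2 \<odot> ?w' \<alpha> \<mu> j + (\<Sum>\<eta>\<in>basis j. rel.f \<mu> \<eta> \<odot> rel.N \<eta> \<mu>))
        + (\<Sum>l\<in>others i - {j}. (\<phi> i j * \<phi> i l) \<odot> ?w \<alpha> \<mu> j l))"
      by (intro sum.cong refl arg_cong2 [where f = "(+)"] diagonal block) auto
    also have "\<dots> = Z \<alpha> \<mu> + (\<Sum>j\<in>others i. \<Sum>\<eta>\<in>basis j. rel.f \<mu> \<eta> \<odot> rel.N \<eta> \<mu>)"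
      by (simp add: Z_def sum.distrib algebra_simps)
    also have "(\<Sum>j\<in>others i. \<Sum>\<eta>\<in>basis j. rel.f \<mu> \<eta> \<odot> rel.N \<eta> \<mu>) = (\<Sum>\<eta>\<in>index. rel.f \<mu> \<eta> \<odot> rel.N \<eta> \<mu>)"
      by (rule sum_index_others [symmetric]) (use \<mu> \<pi> in \<open>auto simp: rel.N_def coordinate_def rel.basis_def\<close>)
    also have "\<dots> = (\<Sum>\<eta>\<in>index. rel.f \<mu> \<eta> \<odot> rel.N \<mu> \<eta> + (rel.f \<mu> \<eta> * rel.u \<eta> \<mu>) \<odot> e)"
    proof (intro sum.cong refl)
      fix \<eta> assume "\<eta> \<in> index"
      then have "rel.N \<eta> \<mu> = rel.N \<mu> \<eta> + rel.u \<eta> \<mu> \<odot> e"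
        using \<mu> by (intro rel.N_swap) (auto simp: rel.basis_def)
      then show "rel.f \<mu> \<eta> \<odot> rel.N \<eta> \<mu> = rel.f \<mu> \<eta> \<odot> rel.N \<mu> \<eta> + (rel.f \<mu> \<eta> * rel.u \<eta> \<mu>) \<odot> e"
        by (simp add: product_algebra.scale_right_distrib)
    qed
    also have "\<dots> = rel.E \<mu> \<mu> + (\<Sum>\<eta>\<in>index. rel.f \<mu> \<eta> * rel.u \<eta> \<mu>) \<odot> e"
      by (simp add: sum.distrib rel.E_def rel.N_def product_algebra.scale_sum_left)
    finally have "rel.E \<alpha> \<mu> * rel.E \<mu> \<alpha> = Z \<alpha> \<mu> + (rel.E \<mu> \<mu> + (\<Sum>\<eta>\<in>index. rel.f \<mu> \<eta> * rel.u \<eta> \<mu>) \<odot> e)" .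
    then show "Z \<alpha> \<mu> = rel.\<Omega> \<alpha> \<mu> + (- (\<Sum>\<eta>\<in>index. rel.f \<mu> \<eta> * rel.u \<eta> \<mu>)) \<odot> e"
      by (simp add: rel.\<Omega>_def)
  qed
  also have "\<dots> = rel.node_\<Omega> i m + W_const i m \<odot> e"
    by (simp only: rel.node_\<Omega>_def W_const_def sum.distrib product_algebra.scale_sum_left)
  finally show ?thesis .
qed

end

section \<open>Strong flatness\<close>

text \<open>
  The coefficients of the commutator of two polynomials with terms in degrees 2, 3 and 4.
\<close>

lemma sum_br_graded:
  fixes F F' :: "nat \<Rightarrow> 'r::ring"
  assumes F: "\<And>k. k \<notin> {2, 3, 4} \<Longrightarrow> F k = 0" and F': "\<And>k. k \<notin> {2, 3, 4} \<Longrightarrow> F' k = 0"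
    and 4: "br (F 2) (F' 2) = 0"
    and 5: "br (F 2) (F' 3) + br (F 3) (F' 2) = 0"
    and 6: "br (F 2) (F' 4) + br (F 3) (F' 3) + br (F 4) (F' 2) = 0"
    and 7: "br (F 3) (F' 4) + br (F 4) (F' 3) = 0"
    and 8: "br (F 4) (F' 4) = 0"
  shows "(\<Sum>k\<le>n. br (F k) (F' (n - k))) = 0"
proof -
  define g where "g k = (if k \<le> n then br (F k) (F' (n - k)) else 0)" for k
  have "(\<Sum>k\<le>n. br (F k) (F' (n - k))) = (\<Sum>k\<in>{..n} \<inter> {2, 3, 4}. g k)"
    by (intro sum.mono_neutral_cong_right) (auto simp: F g_def)
  also have "\<dots> = (\<Sum>k\<in>{2, 3, 4}. g k)"
    by (intro sum.mono_neutral_left) (auto simp: g_def)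
  also have "\<dots> = g 2 + g 3 + g 4"
    by (simp add: add.assoc)
  also have "\<dots> = 0"
  proof -
    consider "n = 4" | "n = 5" | "n = 6" | "n = 7" | "n = 8" | "n \<notin> {4, 5, 6, 7, 8}" by blast
    then show ?thesis
    proof cases
      case 6
      have "F' (n - k) = 0" if "k \<in> {2, 3, 4}" "k \<le> n" for k
        by (rule F') (use 6 that in auto)
      then have "g 2 = 0" "g 3 = 0" "g 4 = 0"
        by (simp_all add: g_def)
      then show ?thesis by simp
    qed (use assms(3-7) F' [of 0] F' [of 1] F' [of 5] F' [of 6] in \<open>simp_all add: g_def\<close>)
  qed
  finally show ?thesis .
qed

context simply_laced_reading
begin

lemma siblings_eq: "rel.siblings i = siblings i"
  by (simp add: rel.siblings_def siblings_def)

lemma \<iota>_H4: "\<exists>c. \<iota> (H4 i t) = rel.node_h4 t i + c \<odot> e"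
proof -
  have "\<iota> (H4 i t) = (\<Sum>m\<in>siblings i. inverse (t i - t m) \<odot> \<iota> (W i m))"
    unfolding H4_eq by (intro representsD(2) represents_finsum represents_scale represents_\<iota> W_closed) auto
  also have "\<dots> = rel.node_h4 t i + (\<Sum>m\<in>siblings i. inverse (t i - t m) * W_const i m) \<odot> e"
    by (simp add: \<iota>_W rel.node_h4_def siblings_eq product_algebra.scale_right_distrib sum.distrib
        product_algebra.scale_sum_left)
  finally show ?thesis by blast
qed

lemma br_e_left: "br e (rel.node_h4 t i) = 0" "br e (rel.node_h3 i) = 0" "br e (rel.node_h2 t i) = 0"
  by (subst br_swap, simp add: rel.br_node_e)+

lemma rees_le: "g \<in> rees \<Longrightarrow> g n \<in> weyl_le n"
  by (simp add: rees_def)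

lemma rees_closed: "g \<in> rees \<Longrightarrow> g n \<in> carrier weyl"
  by (rule weyl_le_closed, rule rees_le)

lemma hamiltonian_closed: "H i t k \<in> carrier weyl"
  by (rule rees_closed [OF quantum_hamiltonian_rees])

lemma sum_br_hamiltonians:
  assumes t: "t \<in> times" and ne: "i \<noteq> j"
  shows "(\<Sum>k\<le>n. br (\<iota> (H i t k)) (\<iota> (H j t (n - k)))) = 0"
proof -
  have sep: "rel.separates t"
    using t by (auto simp: rel.separates_def siblings_eq times_def siblings_def)
  obtain c4 c4' where h4: "\<iota> (H4 i t) = rel.node_h4 t i + c4 \<odot> e" "\<iota> (H4 j t) = rel.node_h4 t j + c4' \<odot> e"
    using \<iota>_H4 by metis
  obtain c2 c2' where h2: "\<iota> (H2 i t) = rel.node_h2 t i + c2 \<odot> e" "\<iota> (H2 j t) = rel.node_h2 t j + c2' \<odot> e"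
    using \<iota>_H2 by metis
  have h3: "\<iota> (\<ominus>\<^bsub>weyl\<^esub> H3 i) = - rel.node_h3 i" for i
    using hamiltonian_closed [of i t 3] unfolding \<iota>_H3 [symmetric]
    by (intro \<iota>_minus weyl_le_closed [of _ 3], unfold H3_def, intro weyl_le_sum weyl_le_scale Tr3_le) (auto simp: others_def)
  note expand = h4 h2 h3 br_add_left br_add_right br_minus_left br_minus_right rel.br_node_e br_e_left
  have zero: "\<iota> (H m t k) = 0" if "k \<notin> {2, 3, 4}" for m k
    using that by (simp add: quantum_hamiltonian_def \<iota>_zero)
  show ?thesis
  proof (rule sum_br_graded)
    show "\<iota> (H i t k) = 0" "\<iota> (H j t k) = 0" if "k \<notin> {2, 3, 4}" for k
      by (rule zero [OF that])+
    show "br (\<iota> (H i t 2)) (\<iota> (H j t 2)) = 0"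
      by (simp add: quantum_hamiltonian_def expand rel.br_h2_h2)
    show "br (\<iota> (H i t 2)) (\<iota> (H j t 3)) + br (\<iota> (H i t 3)) (\<iota> (H j t 2)) = 0"
      using rel.br_h2_h3 [OF ne, of t] by (simp add: quantum_hamiltonian_def expand neg_eq_iff_add_eq_0)
    show "br (\<iota> (H i t 2)) (\<iota> (H j t 4)) + br (\<iota> (H i t 3)) (\<iota> (H j t 3))
        + br (\<iota> (H i t 4)) (\<iota> (H j t 2)) = 0"
      using rel.br_h4_h2 [OF sep ne] by (simp add: quantum_hamiltonian_def expand add_ac)
    show "br (\<iota> (H i t 3)) (\<iota> (H j t 4)) + br (\<iota> (H i t 4)) (\<iota> (H j t 3)) = 0"
      using rel.br_h4_h3 [OF ne, of t] by (simp add: quantum_hamiltonian_def expand neg_eq_iff_add_eq_0 add.commute)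
    show "br (\<iota> (H i t 4)) (\<iota> (H j t 4)) = 0"
      by (simp add: quantum_hamiltonian_def expand rel.br_h4_h4 [OF sep ne])
  qed
qed

lemma weyl_hat_simps:
  "add weyl_hat f g = (\<lambda>n. f n \<oplus>\<^bsub>weyl\<^esub> g n)" "zero weyl_hat = (\<lambda>n. \<zero>\<^bsub>weyl\<^esub>)"
  "mult weyl_hat f g = (\<lambda>n. \<Oplus>\<^bsub>weyl\<^esub>k\<in>{..n}. f k \<otimes>\<^bsub>weyl\<^esub> g (n - k))"
  by (simp_all add: weyl_hat_def power_series_def)

text \<open>
  The negative of \<open>f\<close> is a definite description in \<open>weyl_hat\<close>. It is the coefficientwise negative, which
  exists in \<open>weyl_hat\<close> because \<open>rees\<close> is closed under it, and is unique coefficient by coefficient.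
\<close>

lemma weyl_hat_a_inv:
  assumes f: "f \<in> rees"
  shows "\<ominus>\<^bsub>weyl_hat\<^esub> f = (\<lambda>n. \<ominus>\<^bsub>weyl\<^esub> f n)"
proof -
  interpret weyl: ring weyl by (rule ring_weyl)
  have "(\<lambda>n. \<ominus>\<^bsub>weyl\<^esub> f n) \<in> rees"
    unfolding rees_def
  proof (intro CollectI conjI allI)
    show "\<ominus>\<^bsub>weyl\<^esub> f n \<in> weyl_le n" for n
      by (rule weyl_le_minus [OF rees_le [OF f]])
    have "\<ominus>\<^bsub>weyl\<^esub> f k = \<zero>\<^bsub>weyl\<^esub>" if "f k = \<zero>\<^bsub>weyl\<^esub>" for k
      unfolding that by (rule weyl.minus_zero)
    then have "{k. \<ominus>\<^bsub>weyl\<^esub> f k \<noteq> \<zero>\<^bsub>weyl\<^esub>} \<subseteq> {k. f k \<noteq> \<zero>\<^bsub>weyl\<^esub>}" by blast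
    moreover have "finite {k. f k \<noteq> \<zero>\<^bsub>weyl\<^esub>}"
      using f unfolding rees_def by blast
    ultimately show "finite {k. \<ominus>\<^bsub>weyl\<^esub> f k \<noteq> \<zero>\<^bsub>weyl\<^esub>}"
      by (rule finite_subset)
  qed
  then have neg: "(\<lambda>n. \<ominus>\<^bsub>weyl\<^esub> f n) \<in> carrier weyl_hat" using rees_subset by blast
  show ?thesis
    unfolding a_inv_def [of weyl_hat] m_inv_def [of "add_monoid weyl_hat"]
  proof (rule the_equality)
    show "(\<lambda>n. \<ominus>\<^bsub>weyl\<^esub> f n) \<in> carrier (add_monoid weyl_hat) \<and>
        f \<otimes>\<^bsub>add_monoid weyl_hat\<^esub> (\<lambda>n. \<ominus>\<^bsub>weyl\<^esub> f n) = \<one>\<^bsub>add_monoid weyl_hat\<^esub> \<and>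
        (\<lambda>n. \<ominus>\<^bsub>weyl\<^esub> f n) \<otimes>\<^bsub>add_monoid weyl_hat\<^esub> f = \<one>\<^bsub>add_monoid weyl_hat\<^esub>"
      using neg by (simp add: weyl_hat_simps rees_closed [OF f] weyl.r_neg weyl.l_neg)
    fix g assume g: "g \<in> carrier (add_monoid weyl_hat) \<and>
        f \<otimes>\<^bsub>add_monoid weyl_hat\<^esub> g = \<one>\<^bsub>add_monoid weyl_hat\<^esub> \<and> g \<otimes>\<^bsub>add_monoid weyl_hat\<^esub> f = \<one>\<^bsub>add_monoid weyl_hat\<^esub>"
    show "g = (\<lambda>n. \<ominus>\<^bsub>weyl\<^esub> f n)"
    proof
      fix n
      have 1: "g n \<in> carrier weyl" using g by (auto simp: weyl_hat_def intro: weyl_le_closed)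
      have 2: "g n \<oplus>\<^bsub>weyl\<^esub> f n = \<zero>\<^bsub>weyl\<^esub>"
        using g by (simp add: weyl_hat_simps fun_eq_iff)
      show "g n = \<ominus>\<^bsub>weyl\<^esub> f n"
        by (rule weyl.minus_equality [OF 2 rees_closed [OF f] 1, symmetric])
    qed
  qed
qed

lemma weyl_hat_diff_zero:
  assumes "f \<in> rees" "g \<in> rees" "\<And>n. f n = g n"
  shows "f \<ominus>\<^bsub>weyl_hat\<^esub> g = \<zero>\<^bsub>weyl_hat\<^esub>"
proof -
  interpret weyl: ring weyl by (rule ring_weyl)
  show ?thesis
    unfolding a_minus_def weyl_hat_a_inv [OF assms(2)] weyl_hat_simps
    using assms(3) by (simp add: fun_eq_iff rees_closed [OF assms(2)] weyl.r_neg)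
qed

lemma rees_mult:
  assumes f: "f \<in> rees" and g: "g \<in> rees"
  shows "f \<otimes>\<^bsub>weyl_hat\<^esub> g \<in> rees"
proof -
  interpret weyl: ring weyl by (rule ring_weyl)
  have "finite {k. f k \<noteq> \<zero>\<^bsub>weyl\<^esub>}" "finite {k. g k \<noteq> \<zero>\<^bsub>weyl\<^esub>}" using f g by (auto simp: rees_def)
  then obtain M M' where "\<And>k. f k \<noteq> \<zero>\<^bsub>weyl\<^esub> \<Longrightarrow> k < M" "\<And>k. g k \<noteq> \<zero>\<^bsub>weyl\<^esub> \<Longrightarrow> k < M'"
    unfolding finite_nat_set_iff_bounded by blast
  then have M: "\<And>k. M \<le> k \<Longrightarrow> f k = \<zero>\<^bsub>weyl\<^esub>" "\<And>k. M' \<le> k \<Longrightarrow> g k = \<zero>\<^bsub>weyl\<^esub>" by (meson not_le)+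
  have zero: "(f \<otimes>\<^bsub>weyl_hat\<^esub> g) n = \<zero>\<^bsub>weyl\<^esub>" if "M + M' \<le> n" for n
  proof -
    have "f k \<otimes>\<^bsub>weyl\<^esub> g (n - k) = \<zero>\<^bsub>weyl\<^esub>" for k
    proof (cases "M \<le> k")
      case True
      then show ?thesis by (simp add: M rees_closed [OF g])
    next
      case False
      then have "M' \<le> n - k" using that by simp
      then show ?thesis by (simp add: M rees_closed [OF f])
    qed
    then show ?thesis by (simp add: weyl_hat_simps)
  qed
  have "n < M + M'" if nz: "(f \<otimes>\<^bsub>weyl_hat\<^esub> g) n \<noteq> \<zero>\<^bsub>weyl\<^esub>" for n
  proof (rule ccontr)
    assume "\<not> n < M + M'"
    then have "M + M' \<le> n" by simp
    from zero [OF this] nz show False by contradiction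
  qed
  then have "finite {n. (f \<otimes>\<^bsub>weyl_hat\<^esub> g) n \<noteq> \<zero>\<^bsub>weyl\<^esub>}"
    unfolding finite_nat_set_iff_bounded by blast
  moreover have "(f \<otimes>\<^bsub>weyl_hat\<^esub> g) n \<in> weyl_le n" for n
    unfolding weyl_hat_simps
  proof (intro weyl_le_sum)
    fix k assume "k \<in> {..n}"
    then show "f k \<otimes>\<^bsub>weyl\<^esub> g (n - k) \<in> weyl_le n"
      using weyl_le_mult [OF rees_le [OF f, of k] rees_le [OF g, of "n - k"]] by simp
  qed
  ultimately show ?thesis unfolding rees_def by blast
qed

lemma hamiltonians_commute:
  assumes t: "t \<in> times"
  shows "commutator weyl_hat (H i t) (H j t) = \<zero>\<^bsub>weyl_hat\<^esub>"
proof (cases "i = j")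
  case True
  then show ?thesis
    unfolding commutator_def by (intro weyl_hat_diff_zero rees_mult quantum_hamiltonian_rees) simp
next
  case False
  have conv: "represents ((H i t \<otimes>\<^bsub>weyl_hat\<^esub> H j t) n)
     (\<Sum>k\<le>n. \<iota> (H i t k) * \<iota> (H j t (n - k)))" for i j n
    unfolding weyl_hat_simps
    by (intro represents_finsum represents_mult represents_\<iota> hamiltonian_closed) simp
  have "(H i t \<otimes>\<^bsub>weyl_hat\<^esub> H j t) n
      = (H j t \<otimes>\<^bsub>weyl_hat\<^esub> H i t) n" for n
  proof -
    have "(\<Sum>k\<le>n. \<iota> (H j t k) * \<iota> (H i t (n - k)))
        = (\<Sum>k\<le>n. \<iota> (H j t (n - k)) * \<iota> (H i t k))"
      by (rule sum.reindex_bij_witness [of _ "\<lambda>k. n - k" "\<lambda>k. n - k"]) auto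
    then have "(\<Sum>k\<le>n. \<iota> (H i t k) * \<iota> (H j t (n - k)))
        = (\<Sum>k\<le>n. \<iota> (H j t k) * \<iota> (H i t (n - k)))"
      using sum_br_hamiltonians [OF t False, of n] by (simp add: br_def sum_subtractf)
    then have "\<iota> ((H i t \<otimes>\<^bsub>weyl_hat\<^esub> H j t) n)
        = \<iota> ((H j t \<otimes>\<^bsub>weyl_hat\<^esub> H i t) n)"
      unfolding representsD(2) [OF conv] .
    then show ?thesis
      unfolding \<iota>_inject [OF representsD(1) [OF conv] representsD(1) [OF conv]] .
  qed
  then show ?thesis
    unfolding commutator_def by (intro weyl_hat_diff_zero rees_mult quantum_hamiltonian_rees)
qed

text \<open>
  Partial derivatives are defined with sums over initial segments of the natural numbers; this is the
  version for an arbitrary finite index set.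
\<close>

lemma has_partial_finsum:
  assumes "finite S" and X: "\<And>s. s \<in> S \<Longrightarrow> X s \<in> carrier weyl"
    and g: "\<And>s. s \<in> S \<Longrightarrow> ((\<lambda>z. g s (t(j := z))) has_field_derivative g' s) (at (t j))"
  shows "has_partial (\<lambda>r. \<Oplus>\<^bsub>weyl\<^esub>s\<in>S. g s r \<cdot> X s) j t (\<Oplus>\<^bsub>weyl\<^esub>s\<in>S. g' s \<cdot> X s)"
proof -
  interpret weyl: ring weyl by (rule ring_weyl)
  obtain h where h: "bij_betw h {0..<card S} S"
    using ex_bij_betw_nat_finite [OF assms(1)] by blast
  have img: "h ` {..<card S} = S" and inj: "inj_on h {..<card S}"
    using h by (auto simp: bij_betw_def lessThan_atLeast0)
  have hS: "h n \<in> S" if "n < card S" for n using img that by auto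
  have reindex: "(\<Oplus>\<^bsub>weyl\<^esub>s\<in>S. c s \<cdot> X s) = (\<Oplus>\<^bsub>weyl\<^esub>n\<in>{..<card S}. c (h n) \<cdot> X (h n))" for c
    using weyl.finsum_reindex [OF _ inj, of "\<lambda>s. c s \<cdot> X s"] X unfolding img
    by (auto simp: scale_closed)
  show ?thesis
    unfolding has_partial_def reindex
    by (intro exI [of _ "card S"] exI [of _ "\<lambda>n. X (h n)"] exI [of _ "\<lambda>n z. g (h n) (t(j := z))"]
        exI [of _ "\<lambda>n. g' (h n)"]) (auto simp: X g hS)
qed

lemma scale_one: "X \<in> carrier weyl \<Longrightarrow> 1 \<cdot> X = X"
  and scale_zero: "X \<in> carrier weyl \<Longrightarrow> 0 \<cdot> X = \<zero>\<^bsub>weyl\<^esub>"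
proof -
  interpret weyl: ring weyl by (rule ring_weyl)
  assume "X \<in> carrier weyl"
  then show "1 \<cdot> X = X" "0 \<cdot> X = \<zero>\<^bsub>weyl\<^esub>"
    using complex_algebraD(2) [OF complex_algebra_weyl]
    by (simp_all add: weyl_scale_def scalar_zero weyl_class_zero)
qed

lemma has_partial_const:
  assumes X: "X \<in> carrier weyl"
  shows "has_partial (\<lambda>r. X) j t \<zero>\<^bsub>weyl\<^esub>"
proof -
  interpret weyl: ring weyl by (rule ring_weyl)
  have "has_partial (\<lambda>r. \<Oplus>\<^bsub>weyl\<^esub>s\<in>{()}. 1 \<cdot> X) j t (\<Oplus>\<^bsub>weyl\<^esub>s\<in>{()}. 0 \<cdot> X)"
    by (rule has_partial_finsum) (auto simp: X)
  then show ?thesis using X by (simp add: scale_one scale_zero)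
qed

definition D4 :: "'i \<Rightarrow> 'i \<Rightarrow> ('i \<Rightarrow> complex) \<Rightarrow> 'i weyl_elt" where
  "D4 i j t = (\<Oplus>\<^bsub>weyl\<^esub>m\<in>siblings i.
     (((if j = m then 1 else 0) - (if j = i then 1 else 0)) * (inverse (t i - t m))\<^sup>2) \<cdot> W i m)"

definition D2 :: "'i \<Rightarrow> 'i \<Rightarrow> 'i weyl_elt" where
  "D2 i j = (\<Oplus>\<^bsub>weyl\<^esub>m\<in>others i.
     (((if j = m then (\<phi> i m)\<^sup>2 else 0) - (if j = i then kap (\<pi> i) (\<pi> m) else 0)) / 2) \<cdot> (Tr2 i m \<oplus>\<^bsub>weyl\<^esub> Tr2 m i))"

definition H_derivative :: "'i \<Rightarrow> 'i \<Rightarrow> ('i \<Rightarrow> complex) \<Rightarrow> 'i weyl_series" where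
  "H_derivative i j t k = (if k = 4 then D4 i j t else if k = 2 then D2 i j else \<zero>\<^bsub>weyl\<^esub>)"

lemma has_partial_H4:
  assumes t: "t \<in> times"
  shows "has_partial (H4 i) j t (D4 i j t)"
  unfolding H4_eq [abs_def] D4_def
proof (rule has_partial_finsum)
  fix m assume m: "m \<in> siblings i"
  then have "t i - t m \<noteq> 0" using t by (auto simp: siblings_def times_def)
  moreover have "m \<noteq> i" using m by (simp add: siblings_def)
  ultimately show "((\<lambda>z. inverse ((t(j := z)) i - (t(j := z)) m)) has_field_derivative
      ((if j = m then 1 else 0) - (if j = i then 1 else 0)) * (inverse (t i - t m))\<^sup>2) (at (t j))"
    by (cases "j = i"; cases "j = m") (auto intro!: derivative_eq_intros simp: power2_eq_square)
qed (auto intro: W_closed)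

lemma has_partial_H2: "has_partial (H2 i) j t (D2 i j)"
  unfolding H2_def [abs_def] D2_def
proof (rule has_partial_finsum)
  fix m assume "m \<in> others i"
  then have m: "\<pi> i \<noteq> \<pi> m" "m \<noteq> i" by (auto simp: others_def)
  then show "((\<lambda>z. cf i m (t(j := z)) / 2) has_field_derivative
      ((if j = m then (\<phi> i m)\<^sup>2 else 0) - (if j = i then kap (\<pi> i) (\<pi> m) else 0)) / 2) (at (t j))"
    unfolding cf_eq [OF m(1)]
    by (cases "j = i"; cases "j = m") (auto intro!: derivative_eq_intros)
qed (auto simp: others_def intro!: weyl_add_closed Tr2_closed)

lemma has_partial_hamiltonian:
  assumes "t \<in> times"
  shows "has_partial (\<lambda>s. H i s k) j t (H_derivative i j t k)"
proof -
  have "\<ominus>\<^bsub>weyl\<^esub> H3 i \<in> carrier weyl"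
    using hamiltonian_closed [of i t 3] by (simp add: quantum_hamiltonian_def)
  moreover have "\<zero>\<^bsub>weyl\<^esub> \<in> carrier weyl"
    using weyl_le_zero by (rule weyl_le_closed)
  ultimately show ?thesis
    using has_partial_H4 [OF assms] has_partial_H2
    by (cases "k = 4"; cases "k = 3"; cases "k = 2")
      (simp_all add: quantum_hamiltonian_def H_derivative_def has_partial_const)
qed

lemma partial_hamiltonian: "t \<in> times \<Longrightarrow> partial (H i) j t = H_derivative i j t"
  by (intro partial_eqI has_partial_hamiltonian)

lemma H_derivative_rees: "H_derivative i j t \<in> rees"
proof -
  have "D4 i j t \<in> weyl_le 4"
    unfolding D4_def by (intro weyl_le_sum weyl_le_scale W_le)
  moreover have "D2 i j \<in> weyl_le 2"
    unfolding D2_def by (intro weyl_le_sum weyl_le_scale weyl_le_add Tr2_le) (auto simp: others_def)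
  moreover have "finite {k. H_derivative i j t k \<noteq> \<zero>\<^bsub>weyl\<^esub>}"
    by (rule finite_subset [of _ "{2, 4}"]) (auto simp: H_derivative_def)
  ultimately show ?thesis
    by (simp add: rees_def H_derivative_def weyl_le_zero)
qed

lemma W_swap:
  assumes m: "m \<in> siblings i"
  shows "W i m = W m i"
proof -
  have i: "i \<in> siblings m" and \<pi>: "\<pi> i = \<pi> m" using m by (auto simp: siblings_def)
  have "\<iota> (W i m) = \<iota> (W m i)"
    unfolding \<iota>_W [OF m] \<iota>_W [OF i] using \<pi> by (simp add: rel.node_\<Omega>_swap W_const_swap)
  then show ?thesis using m i by (simp add: \<iota>_inject W_closed)
qed

lemma weyl_finsum_delta:
  assumes "finite S" and X: "\<And>s. s \<in> S \<Longrightarrow> X s \<in> carrier weyl"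
  shows "(\<Oplus>\<^bsub>weyl\<^esub>s\<in>S. if j = s then X s else \<zero>\<^bsub>weyl\<^esub>) = (if j \<in> S then X j else \<zero>\<^bsub>weyl\<^esub>)"
proof (cases "j \<in> S")
  interpret weyl: ring weyl by (rule ring_weyl)
  case True
  then show ?thesis using weyl.finsum_singleton [OF True assms(1), of X] X by auto
next
  interpret weyl: ring weyl by (rule ring_weyl)
  case False
  then have "(\<Oplus>\<^bsub>weyl\<^esub>s\<in>S. if j = s then X s else \<zero>\<^bsub>weyl\<^esub>) = (\<Oplus>\<^bsub>weyl\<^esub>s\<in>S. \<zero>\<^bsub>weyl\<^esub>)"
    by (intro weyl.finsum_cong') auto
  then show ?thesis using False by simp
qed

lemma D4_eq:
  assumes "i \<noteq> j"
  shows "D4 i j t = (if j \<in> siblings i then (inverse (t i - t j))\<^sup>2 \<cdot> W i j else \<zero>\<^bsub>weyl\<^esub>)"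
proof -
  interpret weyl: ring weyl by (rule ring_weyl)
  have "D4 i j t = (\<Oplus>\<^bsub>weyl\<^esub>m\<in>siblings i. if j = m then (inverse (t i - t m))\<^sup>2 \<cdot> W i m else \<zero>\<^bsub>weyl\<^esub>)"
    unfolding D4_def using assms by (intro weyl.finsum_cong') (auto simp: scale_closed W_closed scale_zero)
  then show ?thesis by (simp add: weyl_finsum_delta scale_closed W_closed)
qed

lemma D2_eq:
  assumes "i \<noteq> j"
  shows "D2 i j = (if j \<in> others i then ((\<phi> i j)\<^sup>2 / 2) \<cdot> (Tr2 i j \<oplus>\<^bsub>weyl\<^esub> Tr2 j i) else \<zero>\<^bsub>weyl\<^esub>)"
proof -
  interpret weyl: ring weyl by (rule ring_weyl)
  have cl: "Tr2 i m \<oplus>\<^bsub>weyl\<^esub> Tr2 m i \<in> carrier weyl" if "m \<in> others i" for m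
    using that by (auto simp: others_def intro!: weyl_add_closed Tr2_closed)
  have "D2 i j = (\<Oplus>\<^bsub>weyl\<^esub>m\<in>others i. if j = m then ((\<phi> i m)\<^sup>2 / 2) \<cdot> (Tr2 i m \<oplus>\<^bsub>weyl\<^esub> Tr2 m i) else \<zero>\<^bsub>weyl\<^esub>)"
    unfolding D2_def using assms by (intro weyl.finsum_cong') (auto simp: scale_closed cl scale_zero)
  then show ?thesis by (simp add: weyl_finsum_delta scale_closed cl)
qed

lemma H_derivative_swap: "H_derivative i j t = H_derivative j i t"
proof (cases "i = j")
  case False
  interpret weyl: ring weyl by (rule ring_weyl)
  have "D4 i j t = D4 j i t"
  proof -
    have "(inverse (t i - t j))\<^sup>2 = (inverse (t j - t i))\<^sup>2"
      by (simp add: power2_commute power_inverse)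
    moreover have "j \<in> siblings i \<longleftrightarrow> i \<in> siblings j" by (auto simp: siblings_def)
    ultimately show ?thesis
      using False W_swap [of j i] by (simp add: D4_eq)
  qed
  moreover have "D2 i j = D2 j i"
  proof (cases "j \<in> others i")
    case True
    then have \<pi>: "\<pi> i \<noteq> \<pi> j" "i \<in> others j" by (auto simp: others_def)
    have "x_coord (\<pi> i) * y_coord (\<pi> j) - x_coord (\<pi> j) * y_coord (\<pi> i) = - (x_coord (\<pi> j) * y_coord (\<pi> i) - x_coord (\<pi> i) * y_coord (\<pi> j))"
      by simp
    then have "\<phi> i j = - \<phi> j i"
      using \<phi>_eq [OF \<pi>(1)] \<phi>_eq [OF \<pi>(1) [symmetric]] by (metis inverse_minus_eq)
    moreover have "Tr2 i j \<oplus>\<^bsub>weyl\<^esub> Tr2 j i = Tr2 j i \<oplus>\<^bsub>weyl\<^esub> Tr2 i j"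
      using \<pi> by (intro weyl.a_comm Tr2_closed) auto
    ultimately show ?thesis using True \<pi> False by (simp add: D2_eq)
  next
    case notin: False
    then have "i \<notin> others j" by (auto simp: others_def)
    then show ?thesis using notin False by (simp add: D2_eq)
  qed
  ultimately show ?thesis by (simp add: H_derivative_def fun_eq_iff)
qed simp

theorem hamiltonians_strongly_flat: "strongly_flat H"
  unfolding strongly_flat_def connection_form_def differentiable_in_def
proof (intro conjI ballI allI)
  fix t i j k assume t: "t \<in> times"
  show "H i t \<in> carrier weyl_hat"
    using quantum_hamiltonian_rees rees_subset by blast
  show "\<exists>D. has_partial (\<lambda>s. H i s k) j t D"
    using has_partial_hamiltonian [OF t] by blast
  show "commutator weyl_hat (H i t) (H j t) = \<zero>\<^bsub>weyl_hat\<^esub>"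
    by (rule hamiltonians_commute [OF t])
  show "partial (H i) j t \<ominus>\<^bsub>weyl_hat\<^esub> partial (H j) i t = \<zero>\<^bsub>weyl_hat\<^esub>"
    unfolding partial_hamiltonian [OF t]
    by (intro weyl_hat_diff_zero H_derivative_rees) (simp add: H_derivative_swap [of i j])
qed

end

theorem theorem5p1:
  fixes \<pi> :: "'i::finite \<Rightarrow> 'j::finite"
    and d :: "'i \<Rightarrow> nat"
    and a :: "'j \<Rightarrow> complex option"
  assumes "CARD('j) \<ge> 2" and "surj \<pi>" and "inj a"
  shows "simply_laced.strongly_flat \<pi> d a (simply_laced.quantum_hamiltonian \<pi> d a)"
proof -
  interpret simply_laced_reading \<pi> d a by standard (rule assms(3))
  show ?thesis by (rule hamiltonians_strongly_flat)
qed

end
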